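(* There exists an absolute constant $C>0$ such that for every $c\in(1,2)$ and every finitely supported $f\colon\mathbb{Z}\to\mathbb{C}$ $$\|\mathcal{C}_c f\|_{\ell^2(\mathbb{Z})}\le C(c-1)^{-\frac12}(2-c)^{-\frac{13}{4}}\|f\|_{\ell^2(\mathbb{Z})}\quad\text{and}\quad \|\mathcal{C}^{\mathrm{sgn}}_c f\|_{\ell^2(\mathbb{Z})}\le C(c-1)^{-\frac12}(2-c)^{-\frac{13}{4}}\|f\|_{\ell^2(\mathbb{Z})}.$$
   Context: For $c\in(1,2)$ and a finitely supported $f\colon\mathbb{Z}\to\mathbb{C}$, the $c$-modulated Carleson operators are defined for $x\in\mathbb{Z}$ by $$\mathcal{C}_{c}f(x)=\sup_{\lambda\in[-1/2,1/2)}\Big|\sum_{n\neq 0}f(x-n)\frac{e^{2\pi i\lambda\lfloor|n|^c\rfloor}}{n}\Big|,\qquad \mathcal{C}^{\mathrm{sgn}}_{c}f(x)=\sup_{\lambda\in[-1/2,1/2)}\Big|\sum_{n\neq 0}f(x-n)\frac{e^{2\pi i\lambda\,\mathrm{sign}(n)\lfloor|n|^c\rfloor}}{n}\Big|,$$ where the sums run over $n\in\mathbb{Z}\setminus\{0\}$ and $\lfloor\cdot\rfloor$ is the integer part. *)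

theory Defs
  imports "HOL-Analysis.Analysis"
begin

definition has_ell2_norm :: "('a \<Rightarrow> 'b::real_normed_vector) \<Rightarrow> bool" where
  "has_ell2_norm g \<longleftrightarrow> (\<lambda>x. (norm (g x))\<^sup>2) summable_on UNIV"

(* infsum is 0 on families that are not summable, so an upper bound on ell2_norm g is
   meaningful only together with has_ell2_norm g. *)
definition ell2_norm :: "('a \<Rightarrow> 'b::real_normed_vector) \<Rightarrow> real" where
  "ell2_norm g = sqrt (\<Sum>\<^sub>\<infinity>x. (norm (g x))\<^sup>2)"

(* For finitely supported f the sums below are finite, and the suprema are over bounded
   sets of reals; see carleson_sum_finite and the bdd_above lemmas. *)
definition carleson :: "real \<Rightarrow> (int \<Rightarrow> complex) \<Rightarrow> int \<Rightarrow> real" where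
  "carleson c f x =
     (SUP t\<in>{-1/2..<1/2::real}.
        norm (\<Sum>\<^sub>\<infinity>n\<in>{n. n \<noteq> 0}.
          f (x - n) *
          (exp (2 * of_real pi * \<i> * of_real t * of_int \<lfloor>real_of_int \<bar>n\<bar> powr c\<rfloor>) / of_int n)))"

definition carleson_sgn :: "real \<Rightarrow> (int \<Rightarrow> complex) \<Rightarrow> int \<Rightarrow> real" where
  "carleson_sgn c f x =
     (SUP t\<in>{-1/2..<1/2::real}.
        norm (\<Sum>\<^sub>\<infinity>n\<in>{n. n \<noteq> 0}.
          f (x - n) *
          (exp (2 * of_real pi * \<i> * of_real t * of_int (sgn n * \<lfloor>real_of_int \<bar>n\<bar> powr c\<rfloor>)) / of_int n)))"

lemma carleson_sum_finite:
  fixes f k :: "int \<Rightarrow> complex"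
  assumes "finite {y. f y \<noteq> 0}"
  shows "finite {n. n \<noteq> 0 \<and> f (x - n) \<noteq> 0}"
    and "(\<Sum>\<^sub>\<infinity>n\<in>{n. n \<noteq> 0}. f (x - n) * k n) = (\<Sum>n | n \<noteq> 0 \<and> f (x - n) \<noteq> 0. f (x - n) * k n)"
proof -
  have "{n. n \<noteq> 0 \<and> f (x - n) \<noteq> 0} \<subseteq> (\<lambda>y. x - y) ` {y. f y \<noteq> 0}"
  proof
    fix n assume "n \<in> {n. n \<noteq> 0 \<and> f (x - n) \<noteq> 0}"
    then show "n \<in> (\<lambda>y. x - y) ` {y. f y \<noteq> 0}"
      by (intro image_eqI[of _ _ "x - n"]) auto
  qed
  then show fin: "finite {n. n \<noteq> 0 \<and> f (x - n) \<noteq> 0}"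
    using assms finite_surj by blast
  have "(\<Sum>\<^sub>\<infinity>n\<in>{n. n \<noteq> 0}. f (x - n) * k n) =
        (\<Sum>\<^sub>\<infinity>n\<in>{n. n \<noteq> 0 \<and> f (x - n) \<noteq> 0}. f (x - n) * k n)"
    by (rule infsum_cong_neutral) auto
  then show "(\<Sum>\<^sub>\<infinity>n\<in>{n. n \<noteq> 0}. f (x - n) * k n) =
      (\<Sum>n | n \<noteq> 0 \<and> f (x - n) \<noteq> 0. f (x - n) * k n)"
    using fin by simp
qed

lemma carleson_sum_bound:
  fixes f :: "int \<Rightarrow> complex" and a :: "int \<Rightarrow> int"
  assumes "finite {y. f y \<noteq> 0}"
  shows "norm (\<Sum>\<^sub>\<infinity>n\<in>{n. n \<noteq> 0}.
           f (x - n) * (exp (2 * of_real pi * \<i> * of_real t * of_int (a n)) / of_int n))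
         \<le> (\<Sum>n | n \<noteq> 0 \<and> f (x - n) \<noteq> 0. norm (f (x - n)) / \<bar>real_of_int n\<bar>)"
proof -
  have "norm (exp (2 * of_real pi * \<i> * of_real t * of_int (a n))) = 1" for n
    by (simp add: norm_exp_eq_Re)
  then show ?thesis
    unfolding carleson_sum_finite(2)[OF assms]
    by (intro sum_norm_le) (simp add: norm_mult norm_divide)
qed

lemma bdd_above_carleson:
  assumes "finite {y. f y \<noteq> 0}"
  shows "bdd_above ((\<lambda>t. norm (\<Sum>\<^sub>\<infinity>n\<in>{n. n \<noteq> 0}.
           f (x - n) * (exp (2 * of_real pi * \<i> * of_real t *
             of_int \<lfloor>real_of_int \<bar>n\<bar> powr c\<rfloor>) / of_int n))) ` {-1/2..<1/2::real})"
  by (rule bdd_aboveI2, rule carleson_sum_bound[OF assms])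

lemma bdd_above_carleson_sgn:
  assumes "finite {y. f y \<noteq> 0}"
  shows "bdd_above ((\<lambda>t. norm (\<Sum>\<^sub>\<infinity>n\<in>{n. n \<noteq> 0}.
           f (x - n) * (exp (2 * of_real pi * \<i> * of_real t *
             of_int (sgn n * \<lfloor>real_of_int \<bar>n\<bar> powr c\<rfloor>)) / of_int n))) ` {-1/2..<1/2::real})"
  by (rule bdd_aboveI2, rule carleson_sum_bound[OF assms])

end

theory Submission
  imports Defs
begin

text \<open>
  Linearise the supremum by a choice of \<open>\<lambda>(x)\<close>. On \<open>|n| \<le> |\<lambda>|^(-1/c)\<close> the modulation is harmless
  and the operator is a maximal Hilbert transform up to averages. On the remaining dyadic blocks
  \<open>N < n \<le> 2 N\<close>, the kernel of \<open>TT*\<close> is an exponential sum with phase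
  \<open>\<mu> (t + h)^c - \<mu>' t^c\<close>; its second derivative is \<open>t^(c - 2)\<close> times a function that is monotone in \<open>t\<close>,
  so van der Corput's second derivative test gives a power saving in \<open>|\<lambda>| N^c\<close>, which is at most
  \<open>N^c\<close> with \<open>c < 2\<close>. The scale \<open>N\<close> is allowed to depend on \<open>x\<close>, and the maximal function that then
  bounds \<open>TT*\<close> is itself bounded by a \<open>TT*\<close> bootstrap. The integer part is removed trivially if
  \<open>|\<lambda>| \<le> N^(-(2 - c)/8)\<close>; otherwise \<open>e(-\<lambda> frac u)\<close> is replaced by its discrete Fejer mean in \<open>u\<close>,
  whose error is small unless \<open>n^c\<close> is close to an integer, which is rare by the same exponential
  sum bounds.
\<close>

section \<open>Maximal functions and the TT* method\<close>

text \<open>The obstacle is that the modulations chosen at two points x and y are unrelated, so the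
  second derivative of the TT* phase may vanish inside a block. On comparable scales it vanishes at
  most once, and its monotone factor passes zero at a speed proportional to (2 - c) |\<lambda>| |h|;
  this explains the trivial treatment of small |h| and a loss 1 / (2 - c). Away from the zero the
  second derivative carries the factor c (c - 1), and the test costs its inverse square root. TT*
  halves both losses, but the count of n with n^c near an integer enters through Young's inequality
  and keeps the full (c - 1)^(-1/2). Summing the decay over dyadic scales costs another 1 / (2 - c).
  The outcome is C (c - 1)^(-1/2) (2 - c)^(-2), which implies the stated bound because 0 < 2 - c <
  1. A scale depending on x is forced by the blocks with small |\<lambda>|: they decay only in
  |\<lambda>| N^c, so they have to be indexed by their distance from the threshold
  |\<lambda>|^(-1/c). Blocks with larger |\<lambda>| decay in N and are summed at fixed
  scale.\<close>

lemma L2_set_sum_le: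
  assumes "finite I"
  shows "L2_set (\<lambda>x. \<Sum>i\<in>I. u i x) X \<le> (\<Sum>i\<in>I. L2_set (u i) X)"
  using assms
proof (induction I rule: finite_induct)
  case empty then show ?case by (simp add: L2_set_def)
next
  case (insert a I)
  have "L2_set (\<lambda>x. \<Sum>i\<in>insert a I. u i x) X = L2_set (\<lambda>x. u a x + (\<Sum>i\<in>I. u i x)) X"
    using insert by simp
  also have "\<dots> \<le> L2_set (u a) X + L2_set (\<lambda>x. \<Sum>i\<in>I. u i x) X"
    by (rule L2_set_triangle_ineq)
  finally show ?case using insert by simp
qed

text \<open>With u = T f, the square of |u| is the pairing of f with the adjoint image
  \<open>v\<close> of u, and the square of |v| is the TT* form at u. Cauchy-Schwarz then gives P
  \<le> F sqrt (B P), and one factor sqrt P is divided out. Absolute values are put on whole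
  correlations, so from here on oscillation matters only inside the sum over \<open>S\<close>.
  \<open>K\<close> need not be a convolution, which lets all parameters depend on x.\<close>

lemma TT_star:
  fixes K :: "'a \<Rightarrow> 'b \<Rightarrow> complex" and f :: "'b \<Rightarrow> complex"
  assumes B: "B \<ge> 0"
    and L: "\<And>g. (\<And>x. 0 \<le> g x) \<Longrightarrow>
      (\<Sum>x\<in>X. \<Sum>y\<in>X. norm (\<Sum>m\<in>S. K x m * cnj (K y m)) * g x * g y) \<le> B * (\<Sum>x\<in>X. (g x)\<^sup>2)"
  shows "L2_set (\<lambda>x. norm (\<Sum>m\<in>S. K x m * f m)) X \<le> sqrt B * L2_set (\<lambda>m. norm (f m)) S"
proof -
  define u where "u x = (\<Sum>m\<in>S. K x m * f m)" for x
  define v where "v m = (\<Sum>x\<in>X. cnj (u x) * K x m)" for m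
  define P where "P = (\<Sum>x\<in>X. (norm (u x))\<^sup>2)"
  define V where "V = (\<Sum>m\<in>S. (norm (v m))\<^sup>2)"
  define F where "F = L2_set (\<lambda>m. norm (f m)) S"
  have P0: "P \<ge> 0" and V0: "V \<ge> 0" and F0: "F \<ge> 0"
    by (auto simp: P_def V_def F_def sum_nonneg)
  have "complex_of_real P = (\<Sum>x\<in>X. cnj (u x) * u x)"
    unfolding P_def of_real_sum complex_norm_square by (simp add: mult.commute)
  also have "\<dots> = (\<Sum>x\<in>X. \<Sum>m\<in>S. cnj (u x) * (K x m * f m))"
    by (simp add: u_def sum_distrib_left)
  also have "\<dots> = (\<Sum>m\<in>S. f m * v m)"
    by (subst sum.swap) (simp add: v_def sum_distrib_left mult_ac)
  finally have "P = norm (\<Sum>m\<in>S. f m * v m)"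
    using P0 by (metis abs_of_nonneg norm_of_real)
  also have "\<dots> \<le> (\<Sum>m\<in>S. \<bar>norm (f m)\<bar> * \<bar>norm (v m)\<bar>)"
    by (rule sum_norm_le) (simp add: norm_mult)
  also have "\<dots> \<le> F * L2_set (\<lambda>m. norm (v m)) S"
    unfolding F_def by (rule L2_set_mult_ineq)
  also have "L2_set (\<lambda>m. norm (v m)) S = sqrt V"
    by (simp add: L2_set_def V_def)
  finally have PF: "P \<le> F * sqrt V" .
  have "complex_of_real V = (\<Sum>m\<in>S. v m * cnj (v m))"
    unfolding V_def of_real_sum complex_norm_square by simp
  also have "\<dots> = (\<Sum>m\<in>S. \<Sum>x\<in>X. \<Sum>y\<in>X. cnj (u x) * u y * (K x m * cnj (K y m)))"
    unfolding v_def cnj_sum sum_product by (intro sum.cong refl) (simp add: mult_ac)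
  also have "\<dots> = (\<Sum>x\<in>X. \<Sum>m\<in>S. \<Sum>y\<in>X. cnj (u x) * u y * (K x m * cnj (K y m)))"
    by (rule sum.swap)
  also have "\<dots> = (\<Sum>x\<in>X. \<Sum>y\<in>X. \<Sum>m\<in>S. cnj (u x) * u y * (K x m * cnj (K y m)))"
    by (intro sum.cong refl sum.swap)
  also have "\<dots> = (\<Sum>x\<in>X. \<Sum>y\<in>X. cnj (u x) * u y * (\<Sum>m\<in>S. K x m * cnj (K y m)))"
    by (simp add: sum_distrib_left)
  finally have "V = norm (\<Sum>x\<in>X. \<Sum>y\<in>X. cnj (u x) * u y * (\<Sum>m\<in>S. K x m * cnj (K y m)))"
    using V0 by (metis abs_of_nonneg norm_of_real)
  also have "\<dots> \<le> (\<Sum>x\<in>X. \<Sum>y\<in>X. norm (\<Sum>m\<in>S. K x m * cnj (K y m)) * norm (u x) * norm (u y))"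
    by (intro sum_norm_le) (simp add: norm_mult mult_ac)
  also have "\<dots> \<le> B * P"
    unfolding P_def by (rule L) simp
  finally have VB: "V \<le> B * P" .
  have "P \<le> F * sqrt (B * P)"
    using PF VB F0 by (meson mult_left_mono order_trans real_sqrt_le_mono)
  then have *: "sqrt P * sqrt P \<le> (sqrt B * F) * sqrt P"
    using P0 by (simp add: real_sqrt_mult mult_ac)
  have "sqrt P \<le> sqrt B * F"
  proof (cases "P = 0")
    case True then show ?thesis using B F0 by simp
  next
    case False then show ?thesis using * P0
      by (metis mult_le_cancel_right_pos order_le_less real_sqrt_gt_zero)
  qed
  then show ?thesis by (simp add: L2_set_def P_def F_def u_def)
qed

section \<open>Averages over intervals whose radius depends on the point\<close>

definition avg_kernel :: "nat \<Rightarrow> int \<Rightarrow> real" where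
  "avg_kernel r h = (if \<bar>h\<bar> \<le> int r then 1 / (2 * real r + 1) else 0)"

lemma avg_kernel_nonneg: "avg_kernel r h \<ge> 0" by (simp add: avg_kernel_def)
lemma avg_kernel_le_1: "avg_kernel r h \<le> 1" by (simp add: avg_kernel_def)

lemma avg_kernel_sum_le_1:
  assumes "finite X"
  shows "(\<Sum>m\<in>X. avg_kernel r (y - m)) \<le> 1"
proof -
  have "(\<Sum>m\<in>X. avg_kernel r (y - m)) = (\<Sum>m\<in>X \<inter> {m. \<bar>y - m\<bar> \<le> int r}. 1 / (2 * real r + 1))"
    using assms by (simp add: avg_kernel_def sum.If_cases)
  also have "\<dots> = card (X \<inter> {m. \<bar>y - m\<bar> \<le> int r}) / (2 * real r + 1)" by simp
  also have "\<dots> \<le> 1"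
  proof -
    have "card (X \<inter> {m. \<bar>y - m\<bar> \<le> int r}) \<le> card {y - int r..y + int r}"
      by (intro card_mono) auto
    also have "\<dots> = 2 * r + 1" by simp
    finally have "real (card (X \<inter> {m. \<bar>y - m\<bar> \<le> int r})) \<le> real (2 * r + 1)" by linarith
    then show ?thesis by (simp add: divide_le_eq)
  qed
  finally show ?thesis .
qed

text \<open>The narrower average has mass at most 1, and both factors are nonzero only if |x - y| is
  at most twice the larger radius; so the sum is at most the wider average at doubled radius, with
  the factor 2 from 1 / (2 r + 1) \<le> 2 / (4 r + 1). Having both radii on the right makes the
  bound symmetric.\<close>

lemma avg_kernel_TT_star:
  assumes "finite X"
  shows "(\<Sum>m\<in>X. avg_kernel r (x - m) * avg_kernel s (y - m)) \<le> 2 * avg_kernel (2 * r) (x - y) + 2 * avg_kernel (2 * s) (x - y)"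
proof -
  have main: "(\<Sum>m\<in>X. avg_kernel r (x - m) * avg_kernel s (y - m)) \<le> 2 * avg_kernel (2 * r) (x - y)" if "s \<le> r" for r s x y
  proof -
    have "(\<Sum>m\<in>X. avg_kernel r (x - m) * avg_kernel s (y - m)) \<le> (\<Sum>m\<in>X. 2 * avg_kernel (2 * r) (x - y) * avg_kernel s (y - m))"
    proof (rule sum_mono)
      fix m
      show "avg_kernel r (x - m) * avg_kernel s (y - m) \<le> 2 * avg_kernel (2 * r) (x - y) * avg_kernel s (y - m)"
      proof (cases "\<bar>x - m\<bar> \<le> int r \<and> \<bar>y - m\<bar> \<le> int s")
        case True
        have "1 / (2 * real r + 1) \<le> 2 / (2 * real (2 * r) + 1)"
          by (simp add: field_simps)
        moreover have "\<bar>x - y\<bar> \<le> int (2 * r)" using True that by linarith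
        ultimately have "avg_kernel r (x - m) \<le> 2 * avg_kernel (2 * r) (x - y)"
          using True by (simp add: avg_kernel_def)
        then show ?thesis by (intro mult_right_mono avg_kernel_nonneg)
      next
        case False
        then have "avg_kernel r (x - m) * avg_kernel s (y - m) = 0" by (auto simp: avg_kernel_def)
        then show ?thesis using mult_nonneg_nonneg[OF avg_kernel_nonneg[of "2 * r" "x - y"] avg_kernel_nonneg[of s "y - m"]] by linarith
      qed
    qed
    also have "\<dots> = 2 * avg_kernel (2 * r) (x - y) * (\<Sum>m\<in>X. avg_kernel s (y - m))" by (simp add: sum_distrib_left)
    also have "\<dots> \<le> 2 * avg_kernel (2 * r) (x - y) * 1"
      by (intro mult_left_mono avg_kernel_sum_le_1 assms) (simp add: avg_kernel_nonneg)
    finally show ?thesis by simp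
  qed
  show ?thesis
  proof (cases "s \<le> r")
    case True
    then show ?thesis using main[of s r x y] avg_kernel_nonneg[of "2 * s" "x - y"] by linarith
  next
    case False
    have "avg_kernel (2 * s) (y - x) = avg_kernel (2 * s) (x - y)" by (simp add: avg_kernel_def abs_minus_commute)
    moreover have "(\<Sum>m\<in>X. avg_kernel r (x - m) * avg_kernel s (y - m)) = (\<Sum>m\<in>X. avg_kernel s (y - m) * avg_kernel r (x - m))"
      by (simp add: mult.commute)
    ultimately show ?thesis using False main[of r s y x] avg_kernel_nonneg[of "2 * r" "x - y"] by linarith
  qed
qed

text \<open>Bootstrapping: by \<open>TT_star\<close>, a bound \<open>b\<close> valid for all choices of radii improves to
  \<open>sqrt (4 * b)\<close>, so the best bound is at most 4.\<close>

lemma maximal_bound: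
  fixes f :: "int \<Rightarrow> complex" and r :: "int \<Rightarrow> nat"
  assumes X: "finite X"
  shows "L2_set (\<lambda>x. norm (\<Sum>y\<in>X. of_real (avg_kernel (r x) (x - y)) * f y)) X \<le> 4 * L2_set (\<lambda>y. norm (f y)) X"
proof -
  define A where "A = (\<lambda>r (f::int \<Rightarrow> complex). L2_set (\<lambda>x. norm (\<Sum>y\<in>X. of_real (avg_kernel (r x) (x - y)) * f y)) X)"
  define N where "N = (\<lambda>f::int \<Rightarrow> complex. L2_set (\<lambda>y. norm (f y)) X)"
  \<comment> \<open>Membership quantifies over all radius functions because TT* doubles the radii: a
    bound for \<open>r\<close> is improved by means of the bound for \<open>2 * r\<close>.\<close>
  define G where "G = {b. 0 \<le> b \<and> (\<forall>r f. A r f \<le> b * N f)}"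
  have N0: "N f \<ge> 0" for f by (simp add: N_def)
  \<comment> \<open>This crude bound depends on \<open>X\<close> and only makes \<open>G\<close>
    nonempty: bootstrapping needs a finite constant to start from.\<close>
  have triv: "real (card X) \<in> G"
  proof -
    have "A r f \<le> real (card X) * N f" for r f
    proof -
      have "norm (\<Sum>y\<in>X. of_real (avg_kernel (r x) (x - y)) * f y) \<le> (\<Sum>y\<in>X. \<bar>1\<bar> * \<bar>norm (f y)\<bar>)" for x
        by (rule sum_norm_le) (simp add: norm_mult avg_kernel_nonneg avg_kernel_le_1 mult_left_le_one_le)
      also have "(\<Sum>y\<in>X. \<bar>1\<bar> * \<bar>norm (f y)\<bar>) \<le> L2_set (\<lambda>_. 1) X * N f"
        unfolding N_def by (rule L2_set_mult_ineq)
      finally have "norm (\<Sum>y\<in>X. of_real (avg_kernel (r x) (x - y)) * f y) \<le> sqrt (card X) * N f" for x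
        by (simp add: L2_set_def)
      then have "A r f \<le> L2_set (\<lambda>x. sqrt (card X) * N f) X"
        unfolding A_def by (intro L2_set_mono) auto
      also have "\<dots> = real (card X) * N f"
        using N0 by (simp add: L2_set_def real_sqrt_mult power_mult_distrib)
      finally show ?thesis .
    qed
    then show ?thesis by (simp add: G_def)
  qed
  have improve: "sqrt (4 * b) \<in> G" if b: "b \<in> G" for b
  proof -
    have b0: "b \<ge> 0" and bA: "\<And>r f. A r f \<le> b * N f" using b by (auto simp: G_def)
    have "A r f \<le> sqrt (4 * b) * N f" for r f
      unfolding A_def N_def
    proof (rule TT_star)
      show "0 \<le> 4 * b" using b0 by simp
      fix g :: "int \<Rightarrow> real" assume g: "\<And>x. 0 \<le> g x"
      have bil: "(\<Sum>x\<in>X. \<Sum>y\<in>X. avg_kernel (2 * r x) (x - y) * g x * g y) \<le> b * (\<Sum>x\<in>X. (g x)\<^sup>2)"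
      proof -
        have "(\<Sum>x\<in>X. \<Sum>y\<in>X. avg_kernel (2 * r x) (x - y) * g x * g y)
            = (\<Sum>x\<in>X. \<bar>g x\<bar> * \<bar>norm (\<Sum>y\<in>X. of_real (avg_kernel (2 * r x) (x - y)) * complex_of_real (g y))\<bar>)"
        proof (rule sum.cong[OF refl])
          fix x
          have "(\<Sum>y\<in>X. of_real (avg_kernel (2 * r x) (x - y)) * complex_of_real (g y)) = of_real (\<Sum>y\<in>X. avg_kernel (2 * r x) (x - y) * g y)"
            by simp
          then have "norm (\<Sum>y\<in>X. of_real (avg_kernel (2 * r x) (x - y)) * complex_of_real (g y)) = (\<Sum>y\<in>X. avg_kernel (2 * r x) (x - y) * g y)"
            using norm_of_real[where 'a=complex, of "\<Sum>y\<in>X. avg_kernel (2 * r x) (x - y) * g y"] g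
            by (simp add: sum_nonneg avg_kernel_nonneg)
          then show "(\<Sum>y\<in>X. avg_kernel (2 * r x) (x - y) * g x * g y) = \<bar>g x\<bar> * \<bar>norm (\<Sum>y\<in>X. of_real (avg_kernel (2 * r x) (x - y)) * complex_of_real (g y))\<bar>"
            using g by (simp add: sum_distrib_left sum_nonneg avg_kernel_nonneg mult_ac)
        qed
        also have "\<dots> \<le> L2_set g X * A (\<lambda>x. 2 * r x) (\<lambda>y. of_real (g y))"
          unfolding A_def by (rule L2_set_mult_ineq)
        also have "\<dots> \<le> L2_set g X * (b * N (\<lambda>y. of_real (g y)))"
          by (intro mult_left_mono bA) simp
        also have "N (\<lambda>y. of_real (g y)) = L2_set g X" by (simp add: N_def L2_set_def)
        also have "L2_set g X * (b * L2_set g X) = b * (\<Sum>x\<in>X. (g x)\<^sup>2)"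
          by (simp add: L2_set_def sum_nonneg mult_ac)
        finally show ?thesis .
      qed
      have bil': "(\<Sum>x\<in>X. \<Sum>y\<in>X. avg_kernel (2 * r y) (x - y) * g x * g y) \<le> b * (\<Sum>x\<in>X. (g x)\<^sup>2)"
      proof -
        have "(\<Sum>x\<in>X. \<Sum>y\<in>X. avg_kernel (2 * r y) (x - y) * g x * g y) = (\<Sum>x\<in>X. \<Sum>y\<in>X. avg_kernel (2 * r x) (x - y) * g x * g y)"
          by (subst sum.swap) (intro sum.cong refl, simp add: avg_kernel_def abs_minus_commute mult_ac)
        then show ?thesis using bil by simp
      qed
      have "(\<Sum>x\<in>X. \<Sum>y\<in>X. norm (\<Sum>m\<in>X. of_real (avg_kernel (r x) (x - m)) * cnj (complex_of_real (avg_kernel (r y) (y - m)))) * g x * g y)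
        \<le> (\<Sum>x\<in>X. \<Sum>y\<in>X. (2 * avg_kernel (2 * r x) (x - y) + 2 * avg_kernel (2 * r y) (x - y)) * g x * g y)"
      proof (intro sum_mono mult_right_mono g)
        fix x y
        have "(\<Sum>m\<in>X. of_real (avg_kernel (r x) (x - m)) * cnj (complex_of_real (avg_kernel (r y) (y - m))))
          = of_real (\<Sum>m\<in>X. avg_kernel (r x) (x - m) * avg_kernel (r y) (y - m))" by simp
        then have "norm (\<Sum>m\<in>X. of_real (avg_kernel (r x) (x - m)) * cnj (complex_of_real (avg_kernel (r y) (y - m))))
          = (\<Sum>m\<in>X. avg_kernel (r x) (x - m) * avg_kernel (r y) (y - m))"
          using norm_of_real[where 'a=complex, of "\<Sum>m\<in>X. avg_kernel (r x) (x - m) * avg_kernel (r y) (y - m)"]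
          by (simp add: sum_nonneg avg_kernel_nonneg)
        then show "norm (\<Sum>m\<in>X. of_real (avg_kernel (r x) (x - m)) * cnj (complex_of_real (avg_kernel (r y) (y - m))))
          \<le> 2 * avg_kernel (2 * r x) (x - y) + 2 * avg_kernel (2 * r y) (x - y)"
          using avg_kernel_TT_star[OF X, of "r x" x "r y" y] by simp
      qed
      also have "\<dots> = 2 * (\<Sum>x\<in>X. \<Sum>y\<in>X. avg_kernel (2 * r x) (x - y) * g x * g y) + 2 * (\<Sum>x\<in>X. \<Sum>y\<in>X. avg_kernel (2 * r y) (x - y) * g x * g y)"
        unfolding sum_distrib_left sum.distrib[symmetric]
        by (intro sum.cong refl) (simp add: algebra_simps)
      also have "\<dots> \<le> 4 * b * (\<Sum>x\<in>X. (g x)\<^sup>2)" using bil bil' by linarith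
      finally show "(\<Sum>x\<in>X. \<Sum>y\<in>X. norm (\<Sum>m\<in>X. of_real (avg_kernel (r x) (x - m)) * cnj (complex_of_real (avg_kernel (r y) (y - m)))) * g x * g y)
        \<le> 4 * b * (\<Sum>x\<in>X. (g x)\<^sup>2)" .
    qed
    then show ?thesis using b0 by (simp add: G_def)
  qed
  \<comment> \<open>The infimum itself lies in \<open>G\<close>, so \<open>improve\<close> applies
    to it and yields b \<le> sqrt (4 b).\<close>
  define b where "b = Inf G"
  have bdd: "bdd_below G" by (rule bdd_belowI[of _ 0]) (simp add: G_def)
  have ne: "G \<noteq> {}" using triv by blast
  have b0: "b \<ge> 0" unfolding b_def by (rule cInf_greatest[OF ne]) (simp add: G_def)
  have "A r f \<le> b * N f" for r f
  proof (cases "N f = 0")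
    case True
    have "A r f \<le> real (card X) * N f" using triv unfolding G_def by blast
    then show ?thesis using True by simp
  next
    case False
    then have "N f > 0" using N0[of f] by simp
    then have "A r f / N f \<le> b" unfolding b_def
      by (intro cInf_greatest[OF ne]) (simp add: G_def divide_le_eq)
    then show ?thesis using \<open>N f > 0\<close> by (simp add: divide_le_eq)
  qed
  then have bG: "b \<in> G" using b0 by (simp add: G_def)
  have "b \<le> sqrt (4 * b)" unfolding b_def using cInf_lower[OF improve[OF bG] bdd] b_def by simp
  then have "b\<^sup>2 \<le> 4 * b" using b0 real_le_rsqrt by (metis real_sqrt_ge_zero mult_nonneg_nonneg power_mono real_sqrt_pow2 zero_le_numeral)
  then have "b \<le> 4" using b0 by (cases "b = 0") (auto simp: power2_eq_square)
  then have "A r f \<le> 4 * N f" using bG N0[of f] by (fastforce simp: G_def intro: order_trans mult_right_mono)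
  then show ?thesis by (simp add: A_def N_def)
qed

text \<open>The evaluation points and the support may differ: with \<open>g\<close> extended by
  zero, both live in \<open>X \<union> S\<close>, where \<open>maximal_bound\<close>
  applies.\<close>

lemma maximal_real:
  fixes g :: "int \<Rightarrow> real" and r :: "int \<Rightarrow> nat"
  assumes X: "finite X" and S: "finite S" and g: "\<And>x. 0 \<le> g x"
  shows "L2_set (\<lambda>x. \<Sum>y\<in>S. avg_kernel (r x) (x - y) * g y) X \<le> 4 * L2_set g S"
proof -
  define f where "f y = (if y \<in> S then complex_of_real (g y) else 0)" for y
  have "(\<Sum>y\<in>S. avg_kernel (r x) (x - y) * g y) = norm (\<Sum>y\<in>X \<union> S. of_real (avg_kernel (r x) (x - y)) * f y)" for x
  proof -
    have "(\<Sum>y\<in>X \<union> S. of_real (avg_kernel (r x) (x - y)) * f y) = (\<Sum>y\<in>S. of_real (avg_kernel (r x) (x - y)) * f y)"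
      using X S by (intro sum.mono_neutral_right) (auto simp: f_def)
    also have "\<dots> = of_real (\<Sum>y\<in>S. avg_kernel (r x) (x - y) * g y)" by (simp add: f_def)
    finally show ?thesis using norm_of_real[where 'a=complex, of "\<Sum>y\<in>S. avg_kernel (r x) (x - y) * g y"] g
      by (simp add: sum_nonneg avg_kernel_nonneg)
  qed
  then have "L2_set (\<lambda>x. \<Sum>y\<in>S. avg_kernel (r x) (x - y) * g y) X
      \<le> L2_set (\<lambda>x. norm (\<Sum>y\<in>X \<union> S. of_real (avg_kernel (r x) (x - y)) * f y)) (X \<union> S)"
    using X S unfolding L2_set_def by (auto intro!: real_sqrt_le_mono sum_mono2)
  also have "\<dots> \<le> 4 * L2_set (\<lambda>y. norm (f y)) (X \<union> S)" using X S by (intro maximal_bound) auto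
  also have "L2_set (\<lambda>y. norm (f y)) (X \<union> S) = L2_set g S"
    unfolding L2_set_def using X S
    by (intro arg_cong[of _ _ sqrt] sum.mono_neutral_cong_right) (auto simp: f_def)
  finally show ?thesis .
qed

text \<open>The form with the radius at y is the transpose of the one with the radius at x. Both are
  needed, since TT* kernels are bounded by averages at either point.\<close>

lemma maximal_bilinear:
  fixes g :: "int \<Rightarrow> real" and r :: "int \<Rightarrow> nat"
  assumes X: "finite X" and g: "\<And>x. 0 \<le> g x"
  shows "(\<Sum>x\<in>X. \<Sum>y\<in>X. avg_kernel (r x) (x - y) * g x * g y) \<le> 4 * (\<Sum>x\<in>X. (g x)\<^sup>2)"
    and "(\<Sum>x\<in>X. \<Sum>y\<in>X. avg_kernel (r y) (x - y) * g x * g y) \<le> 4 * (\<Sum>x\<in>X. (g x)\<^sup>2)"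
proof -
  have "(\<Sum>x\<in>X. \<Sum>y\<in>X. avg_kernel (r x) (x - y) * g x * g y) = (\<Sum>x\<in>X. \<bar>g x\<bar> * \<bar>\<Sum>y\<in>X. avg_kernel (r x) (x - y) * g y\<bar>)"
    using g by (intro sum.cong refl) (simp add: sum_distrib_left sum_nonneg avg_kernel_nonneg mult_ac)
  also have "\<dots> \<le> L2_set g X * L2_set (\<lambda>x. \<Sum>y\<in>X. avg_kernel (r x) (x - y) * g y) X"
    by (rule L2_set_mult_ineq)
  also have "\<dots> \<le> L2_set g X * (4 * L2_set g X)"
    by (intro mult_left_mono maximal_real X g) simp
  also have "\<dots> = 4 * (\<Sum>x\<in>X. (g x)\<^sup>2)"
    by (simp add: L2_set_def sum_nonneg mult_ac)
  finally show *: "(\<Sum>x\<in>X. \<Sum>y\<in>X. avg_kernel (r x) (x - y) * g x * g y) \<le> 4 * (\<Sum>x\<in>X. (g x)\<^sup>2)" .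
  have "(\<Sum>x\<in>X. \<Sum>y\<in>X. avg_kernel (r y) (x - y) * g x * g y) = (\<Sum>x\<in>X. \<Sum>y\<in>X. avg_kernel (r x) (x - y) * g x * g y)"
    by (subst sum.swap) (intro sum.cong refl, simp add: avg_kernel_def abs_minus_commute mult_ac)
  then show "(\<Sum>x\<in>X. \<Sum>y\<in>X. avg_kernel (r y) (x - y) * g x * g y) \<le> 4 * (\<Sum>x\<in>X. (g x)\<^sup>2)" using * by simp
qed

section \<open>The maximal Hilbert transform\<close>

definition poisson_kernel :: "nat \<Rightarrow> int \<Rightarrow> real" where
  "poisson_kernel r h = real r / ((real r)\<^sup>2 + (real_of_int h)\<^sup>2)"

lemma poisson_kernel_nonneg: "poisson_kernel r h \<ge> 0" by (simp add: poisson_kernel_def)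
lemma poisson_kernel_commute: "poisson_kernel r (x - y) = poisson_kernel r (y - x)" by (simp add: poisson_kernel_def power2_commute)

text \<open>A single term suffices: for the least \<open>s\<close> with |h| \<le> 2^s r, the Poisson
  kernel is of order 1 / (4^s r), that is 2^(-s) times the average at radius 2^s r. \<open>A\<close>
  only keeps the sum finite.\<close>

lemma poisson_kernel_le_avk_sum:
  assumes r: "r \<ge> 1" and h: "\<bar>h\<bar> \<le> 2 ^ A * int r"
  shows "poisson_kernel r h \<le> (\<Sum>s\<le>A. 12 * (1/2) ^ s * avg_kernel (2 ^ s * r) h)"
proof -
  define s where "s = (LEAST s. \<bar>h\<bar> \<le> 2 ^ s * int r)"
  have s1: "\<bar>h\<bar> \<le> 2 ^ s * int r" unfolding s_def using h by (rule LeastI)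
  have sA: "s \<le> A" unfolding s_def using h by (rule Least_le)
  have r0: "real r \<ge> 1" using r by simp
  have "poisson_kernel r h \<le> 12 * (1/2) ^ s * avg_kernel (2 ^ s * r) h"
  proof (cases s)
    case 0
    have "poisson_kernel r h \<le> real r / (real r)\<^sup>2" unfolding poisson_kernel_def
      using r0 by (intro divide_left_mono) (auto intro!: mult_pos_pos add_pos_nonneg)
    also have "\<dots> = 1 / real r" by (simp add: power2_eq_square)
    also have "\<dots> \<le> 12 * (1 / (2 * real r + 1))" using r0 by (simp add: field_simps)
    finally show ?thesis using 0 s1 by (simp add: avg_kernel_def)
  next
    case (Suc t)
    have "\<not> \<bar>h\<bar> \<le> 2 ^ t * int r" using not_less_Least[of t "\<lambda>s. \<bar>h\<bar> \<le> 2 ^ s * int r"] Suc s_def by simp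
    then have "2 ^ t * int r < \<bar>h\<bar>" by simp
    then have "real_of_int (2 ^ t * int r) < real_of_int \<bar>h\<bar>" by (simp only: of_int_less_iff)
    then have ht: "2 ^ t * real r < \<bar>real_of_int h\<bar>" by simp
    have "(2 ^ t * real r)\<^sup>2 \<le> (real_of_int h)\<^sup>2"
      using power_mono[OF less_imp_le[OF ht], of 2] by simp
    then have "poisson_kernel r h \<le> real r / (2 ^ t * real r)\<^sup>2" unfolding poisson_kernel_def
      using r0 by (intro divide_left_mono) (auto intro!: mult_pos_pos add_pos_nonneg simp: add_increasing)
    also have "\<dots> = 4 / (4 ^ s * real r)"
    proof -
      have "(2 ^ t * real r)\<^sup>2 = 4 ^ t * (real r)\<^sup>2" by (simp add: power_mult_distrib power2_eq_square flip: power_mult_distrib)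
      then show ?thesis using r0 Suc by (simp add: power2_eq_square)
    qed
    also have "\<dots> \<le> 12 * (1/2) ^ s * (1 / (2 * real (2 ^ s * r) + 1))"
    proof -
      have *: "2 * (2 ^ s * real r) + 1 \<le> 3 * (2 ^ s * real r)"
        using mult_mono[of 1 "(2::real) ^ s" 1 "real r"] r0 by (simp add: mult.commute)
      have "4 / (4 ^ s * real r) = 12 * (1/2) ^ s * (1 / (3 * (2 ^ s * real r)))"
        using r0 by (simp add: field_simps flip: power_mult_distrib)
      also have "\<dots> \<le> 12 * (1/2) ^ s * (1 / (2 * (2 ^ s * real r) + 1))"
        using * r0 by (intro mult_left_mono divide_left_mono) (auto intro!: mult_pos_pos add_nonneg_pos)
      finally show ?thesis by simp
    qed
    finally show ?thesis using s1 by (simp add: avg_kernel_def)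
  qed
  also have "\<dots> \<le> (\<Sum>s\<le>A. 12 * (1/2) ^ s * avg_kernel (2 ^ s * r) h)"
    using sA by (intro member_le_sum) (auto simp: avg_kernel_nonneg)
  finally show ?thesis .
qed

text \<open>The constant is 12 * 4 * 2: the comparison with averages, the maximal bound and the
  geometric series. The number \<open>A\<close> of dyadic scales depends on \<open>X\<close> but
  drops out.\<close>

lemma poisson_kernel_bilinear:
  fixes g :: "int \<Rightarrow> real" and r :: "int \<Rightarrow> nat"
  assumes X: "finite X" and g: "\<And>x. 0 \<le> g x" and r: "\<And>x. r x \<ge> 1"
  shows "(\<Sum>x\<in>X. \<Sum>y\<in>X. poisson_kernel (r x) (x - y) * g x * g y) \<le> 96 * (\<Sum>x\<in>X. (g x)\<^sup>2)"
proof -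
  define A where "A = nat (\<Sum>x\<in>X. \<bar>x\<bar>) * 2"
  have A: "\<bar>x - y\<bar> \<le> 2 ^ A * int (r x)" if "x \<in> X" "y \<in> X" for x y
  proof -
    have "\<bar>x\<bar> \<le> (\<Sum>x\<in>X. \<bar>x\<bar>)" "\<bar>y\<bar> \<le> (\<Sum>x\<in>X. \<bar>x\<bar>)"
      using X that by (auto intro!: member_le_sum)
    then have "\<bar>x - y\<bar> \<le> int A" by (simp add: A_def)
    also have "int A \<le> 2 ^ A" using less_exp[of A] by (metis less_imp_le of_nat_le_iff of_nat_numeral of_nat_power)
    also have "(2::int) ^ A \<le> 2 ^ A * int (r x)" using r[of x] by simp
    finally show ?thesis .
  qed
  have "(\<Sum>x\<in>X. \<Sum>y\<in>X. poisson_kernel (r x) (x - y) * g x * g y)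
      \<le> (\<Sum>x\<in>X. \<Sum>y\<in>X. (\<Sum>s\<le>A. 12 * (1/2) ^ s * avg_kernel (2 ^ s * r x) (x - y)) * g x * g y)"
    using r A by (intro sum_mono mult_right_mono g poisson_kernel_le_avk_sum) auto
  also have "\<dots> = (\<Sum>x\<in>X. \<Sum>y\<in>X. \<Sum>s\<le>A. 12 * (1/2) ^ s * (avg_kernel (2 ^ s * r x) (x - y) * g x * g y))"
    by (simp add: sum_distrib_right mult.assoc)
  also have "\<dots> = (\<Sum>x\<in>X. \<Sum>s\<le>A. \<Sum>y\<in>X. 12 * (1/2) ^ s * (avg_kernel (2 ^ s * r x) (x - y) * g x * g y))"
    by (intro sum.cong refl sum.swap)
  also have "\<dots> = (\<Sum>s\<le>A. \<Sum>x\<in>X. \<Sum>y\<in>X. 12 * (1/2) ^ s * (avg_kernel (2 ^ s * r x) (x - y) * g x * g y))"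
    by (rule sum.swap)
  also have "\<dots> = (\<Sum>s\<le>A. 12 * (1/2) ^ s * (\<Sum>x\<in>X. \<Sum>y\<in>X. avg_kernel (2 ^ s * r x) (x - y) * g x * g y))"
    by (simp add: sum_distrib_left)
  also have "\<dots> \<le> (\<Sum>s\<le>A. 12 * (1/2) ^ s * (4 * (\<Sum>x\<in>X. (g x)\<^sup>2)))"
    by (intro sum_mono mult_left_mono maximal_bilinear(1) X g) simp
  also have "\<dots> = 48 * (\<Sum>x\<in>X. (g x)\<^sup>2) * (\<Sum>s\<le>A. (1/2) ^ s)"
    unfolding sum_distrib_left[of _ _ "{..A}"] by (intro sum.cong refl) simp
  also have "(\<Sum>s\<le>A. (1/2::real) ^ s) \<le> 2"
    by (simp add: sum_gp0)
  then have "48 * (\<Sum>x\<in>X. (g x)\<^sup>2) * (\<Sum>s\<le>A. (1/2) ^ s) \<le> 48 * (\<Sum>x\<in>X. (g x)\<^sup>2) * 2"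
    by (intro mult_left_mono) (auto simp: sum_nonneg)
  finally show ?thesis by simp
qed

text \<open>The odd kernel \<open>hilbert_kernel R n\<close> is a truncation of \<open>1/n\<close> that vanishes continuously at \<open>R\<close>;
  at \<open>n = 0\<close> it is 0 because of the convention \<open>1/0 = 0\<close>.\<close>

definition hilbert_kernel :: "nat \<Rightarrow> int \<Rightarrow> real" where
  "hilbert_kernel R n = (if \<bar>n\<bar> \<le> int R then 1 / real_of_int n - real_of_int n / (real R)\<^sup>2 else 0)"

text \<open>The part of 1/n that the truncation removes: linear up to \<open>R\<close> and 1/n
  beyond, hence of size at most 1 / R and Lipschitz with constant 1 / R^2. A sharp cutoff would
  instead leave a jump of height 1 / R.\<close>

definition hilbert_tail :: "nat \<Rightarrow> int \<Rightarrow> real" where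
  "hilbert_tail R n = (if \<bar>n\<bar> \<le> int R then real_of_int n / (real R)\<^sup>2 else 1 / real_of_int n)"

lemma hilbert_kernel_kap: "hilbert_kernel R n = 1 / real_of_int n - hilbert_tail R n"
  by (simp add: hilbert_kernel_def hilbert_tail_def)

lemma hilbert_kernel_minus: "hilbert_kernel R (- n) = - hilbert_kernel R n" by (simp add: hilbert_kernel_def)
lemma hilbert_tail_minus: "hilbert_tail R (- n) = - hilbert_tail R n" by (simp add: hilbert_tail_def)

lemma hilbert_tail_abs_le:
  assumes "R \<ge> 1" shows "\<bar>hilbert_tail R n\<bar> \<le> 1 / real R"
proof (cases "\<bar>n\<bar> \<le> int R")
  case True
  then have "\<bar>real_of_int n\<bar> \<le> real R" by linarith
  then show ?thesis using True assms by (simp add: hilbert_tail_def field_simps power2_eq_square)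
next
  case False
  then have "real R \<le> \<bar>real_of_int n\<bar>" by linarith
  then show ?thesis using False assms by (simp add: hilbert_tail_def field_simps)
qed

lemma hilbert_tail_lipschitz:
  assumes R: "R \<ge> 1" shows "\<bar>hilbert_tail R a - hilbert_tail R b\<bar> \<le> \<bar>real_of_int a - real_of_int b\<bar> / (real R)\<^sup>2"
proof -
  have le: "hilbert_tail R a - hilbert_tail R b \<le> (real_of_int a - real_of_int b) / (real R)\<^sup>2" if "b \<le> a" "0 \<le> a" "0 \<le> b" for a b
  proof -
    have "real R > 0" using R by simp
    show ?thesis
    proof (cases "a \<le> int R")
      case True
      then show ?thesis using that by (simp add: hilbert_tail_def diff_divide_distrib)
    next
      case False
      then have a: "real_of_int a > real R" by linarith
      have ka: "hilbert_tail R a = 1 / real_of_int a" using False that by (simp add: hilbert_tail_def)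
      show ?thesis
      proof (cases "b \<le> int R")
        case True
        then have b: "real_of_int b \<le> real R" by linarith
        have "1 / real_of_int a \<le> 1 / real R" using a \<open>real R > 0\<close> by (simp add: frac_le)
        also have "\<dots> = real R / (real R)\<^sup>2" using \<open>real R > 0\<close> by (simp add: power2_eq_square)
        also have "\<dots> \<le> real_of_int a / (real R)\<^sup>2" using a by (intro divide_right_mono) auto
        finally show ?thesis using True that ka by (simp add: hilbert_tail_def diff_divide_distrib)
      next
        case False
        then have b: "real_of_int b > real R" by linarith
        have "1 / real_of_int a \<le> 1 / real_of_int b" using b that \<open>real R > 0\<close> by (simp add: frac_le)
        then have "hilbert_tail R a - hilbert_tail R b \<le> 0" using ka False that by (simp add: hilbert_tail_def)
        also have "0 \<le> (real_of_int a - real_of_int b) / (real R)\<^sup>2" using that by simp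
        finally show ?thesis .
      qed
    qed
  qed
  have ge: "hilbert_tail R b - hilbert_tail R a \<le> (real_of_int a - real_of_int b) / (real R)\<^sup>2" if "b \<le> a" "0 \<le> a" "0 \<le> b" for a b
  proof -
    have R0: "real R > 0" using R by simp
    show ?thesis
    proof (cases "a \<le> int R")
      case True
      have "(real_of_int b - real_of_int a) / (real R)\<^sup>2 \<le> (real_of_int a - real_of_int b) / (real R)\<^sup>2"
        using that by (intro divide_right_mono) auto
      then show ?thesis using True that by (simp add: hilbert_tail_def diff_divide_distrib)
    next
      case False
      then have a: "real_of_int a > real R" by linarith
      have ka: "hilbert_tail R a = 1 / real_of_int a" using False that by (simp add: hilbert_tail_def)
      show ?thesis
      proof (cases "b \<le> int R")
        case True
        then have b: "real_of_int b \<le> real R" by linarith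
        \<comment> \<open>The two arguments lie on different sides of the kink at \<open>R\<close>.
          The claim amounts to (2 b - a) a \<le> R^2, which follows from b \<le> R and 2 R a \<le>
          a^2 + R^2.\<close>
        have "2 * real_of_int b * real_of_int a \<le> 2 * real R * real_of_int a" using a b R0 by simp
        also have "\<dots> \<le> real_of_int a * real_of_int a + (real R)\<^sup>2"
          using sum_squares_bound[of "real R" "real_of_int a"] by (simp add: power2_eq_square)
        finally have "(2 * real_of_int b - real_of_int a) * real_of_int a \<le> (real R)\<^sup>2" by (simp add: algebra_simps)
        then have "(2 * real_of_int b - real_of_int a) / (real R)\<^sup>2 \<le> 1 / real_of_int a"
          using a R0 by (simp add: pos_divide_le_eq pos_le_divide_eq)
        then have "real_of_int b / (real R)\<^sup>2 - 1 / real_of_int a \<le> (real_of_int a - real_of_int b) / (real R)\<^sup>2"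
          by (simp add: diff_divide_distrib)
        then show ?thesis using True that ka by (simp add: hilbert_tail_def)
      next
        case False
        then have b: "real_of_int b > real R" by linarith
        have "hilbert_tail R b - hilbert_tail R a = 1 / real_of_int b - 1 / real_of_int a" using ka False that by (simp add: hilbert_tail_def)
        also have "\<dots> = (real_of_int a - real_of_int b) / (real_of_int a * real_of_int b)"
          using a b R0 by (simp add: field_simps)
        also have "\<dots> \<le> (real_of_int a - real_of_int b) / (real R)\<^sup>2"
          using a b R0 that unfolding power2_eq_square
          by (intro divide_left_mono mult_mono mult_pos_pos) auto
        finally show ?thesis .
      qed
    qed
  qed
  have pos: "\<bar>hilbert_tail R a - hilbert_tail R b\<bar> \<le> \<bar>real_of_int a - real_of_int b\<bar> / (real R)\<^sup>2" if "0 \<le> a" "0 \<le> b" for a b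
  proof (cases "b \<le> a")
    case True then show ?thesis using le[of b a] ge[of b a] that by (simp add: abs_le_iff)
  next
    case False then show ?thesis using le[of a b] ge[of a b] that by (simp add: abs_le_iff)
  qed
  show ?thesis
  proof (cases "0 \<le> a"; cases "0 \<le> b")
    assume "0 \<le> a" "0 \<le> b" then show ?thesis by (rule pos)
  next
    assume "\<not> 0 \<le> a" "\<not> 0 \<le> b"
    then show ?thesis using pos[of "-a" "-b"] by (simp add: hilbert_tail_minus abs_minus_commute)
  next
    assume a: "0 \<le> a" "\<not> 0 \<le> b"
    have "hilbert_tail R 0 = 0" by (simp add: hilbert_tail_def)
    then have "\<bar>hilbert_tail R a - hilbert_tail R b\<bar> \<le> \<bar>hilbert_tail R a - hilbert_tail R 0\<bar> + \<bar>hilbert_tail R (-b) - hilbert_tail R 0\<bar>" by (simp add: hilbert_tail_minus)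
    also have "\<dots> \<le> \<bar>real_of_int a\<bar> / (real R)\<^sup>2 + \<bar>real_of_int b\<bar> / (real R)\<^sup>2"
      using pos[of a 0] pos[of "-b" 0] a by (intro add_mono) auto
    also have "\<dots> = \<bar>real_of_int a - real_of_int b\<bar> / (real R)\<^sup>2" using a by (simp add: add_divide_distrib diff_divide_distrib)
    finally show ?thesis .
  next
    assume a: "\<not> 0 \<le> a" "0 \<le> b"
    have "hilbert_tail R 0 = 0" by (simp add: hilbert_tail_def)
    then have "\<bar>hilbert_tail R a - hilbert_tail R b\<bar> \<le> \<bar>hilbert_tail R b - hilbert_tail R 0\<bar> + \<bar>hilbert_tail R (-a) - hilbert_tail R 0\<bar>" by (simp add: hilbert_tail_minus)
    also have "\<dots> \<le> \<bar>real_of_int b\<bar> / (real R)\<^sup>2 + \<bar>real_of_int a\<bar> / (real R)\<^sup>2"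
      using pos[of b 0] pos[of "-a" 0] a by (intro add_mono) auto
    also have "\<dots> = \<bar>real_of_int a - real_of_int b\<bar> / (real R)\<^sup>2" using a by (simp add: add_divide_distrib diff_divide_distrib)
    finally show ?thesis .
  qed
qed

lemma hilbert_kernel_abs_le: 
  assumes "R \<ge> 1" shows "\<bar>hilbert_kernel R n\<bar> \<le> 1 / \<bar>real_of_int n\<bar>"
proof (cases "\<bar>n\<bar> \<le> int R \<and> n \<noteq> 0")
  case True
  have n: "\<bar>real_of_int n\<bar> \<le> real R" "\<bar>real_of_int n\<bar> > 0" using True by auto
  have "hilbert_kernel R n = (1 / real_of_int n) * (1 - (real_of_int n)\<^sup>2 / (real R)\<^sup>2)"
    using True by (simp add: hilbert_kernel_def field_simps power2_eq_square)
  moreover have "(real_of_int n)\<^sup>2 / (real R)\<^sup>2 \<le> 1"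
    using n assms power_mono[OF n(1), of 2] by (simp add: divide_le_eq)
  ultimately have "\<bar>hilbert_kernel R n\<bar> = 1 / \<bar>real_of_int n\<bar> * (1 - (real_of_int n)\<^sup>2 / (real R)\<^sup>2)"
    by (simp add: abs_mult)
  also have "\<dots> \<le> 1 / \<bar>real_of_int n\<bar> * 1" by (intro mult_left_mono) auto
  finally show ?thesis by simp
next
  case False then show ?thesis by (auto simp: hilbert_kernel_def)
qed


section \<open>Correlations of truncated Hilbert kernels\<close>

lemma sum_odd_int:
  fixes k :: "int \<Rightarrow> real"
  assumes "\<And>n. k (- n) = - k n"
  shows "(\<Sum>n\<in>{-a..a}. k n) = 0"
proof -
  have "(\<Sum>n\<in>{-a..a}. k n) = (\<Sum>n\<in>{-a..a}. k (- n))"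
    by (rule sum.reindex_bij_witness[of _ uminus uminus]) auto
  then show ?thesis by (simp add: assms sum_negf)
qed

text \<open>The correction 2 / r makes the induction telescope. At r = 0 it is 0 by the convention
  for division, so the step from 0 to 1 is treated separately.\<close>

lemma sum_inverse_squares_int:
  "(\<Sum>n\<in>{- int r..int r}. 1 / (real_of_int n)\<^sup>2) \<le> 4 - 2 / real r"
proof (induction r)
  case 0 then show ?case by simp
next
  case (Suc r)
  have "{- int (Suc r)..int (Suc r)} = insert (- int (Suc r)) (insert (int (Suc r)) {- int r..int r})" by auto
  then have "(\<Sum>n\<in>{- int (Suc r)..int (Suc r)}. 1 / (real_of_int n)\<^sup>2) = 2 / (real (Suc r))\<^sup>2 + (\<Sum>n\<in>{- int r..int r}. 1 / (real_of_int n)\<^sup>2)"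
    by (simp add: power2_eq_square algebra_simps)
  also have "\<dots> \<le> 4 - 2 / real (Suc r)"
  proof (cases "r = 0")
    case True then show ?thesis by simp
  next
    case False
    have "2 / (real (Suc r))\<^sup>2 + (4 - 2 / real r) \<le> 4 - 2 / real (Suc r)"
    proof -
      have "2 / (real (Suc r))\<^sup>2 \<le> 2 / (real r * real (Suc r))"
        using False unfolding power2_eq_square by (intro divide_left_mono mult_right_mono mult_pos_pos) auto
      also have "\<dots> = 2 / real r - 2 / real (Suc r)" using False by (simp add: field_simps)
      finally show ?thesis by linarith
    qed
    then show ?thesis using Suc by linarith
  qed
  finally show ?case .
qed

text \<open>At h = 0 square summability of 1/n suffices. For 0 < h \<le> 2 r both singularities
  matter and the main term 1 / (n (n + h)) is resolved by partial fractions. For h > 2 r the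
  vanishing mean of the shorter kernel is combined with the smoothness of the longer one near h,
  giving order r / h^2. The term with \<open>poisson_kernel 1\<close> pays for h = 0 and for the two
  singular points.\<close>

lemma hilbert_kernel_corr_pos:
  assumes r: "1 \<le> r" "r \<le> R" and h: "h \<ge> 0"
  shows "\<bar>\<Sum>n\<in>{- int r..int r}. hilbert_kernel r n * hilbert_kernel R (n + h)\<bar> \<le> 120 * poisson_kernel r h + 4 * poisson_kernel 1 h"
proof -
  have R: "1 \<le> R" using r by simp
  have r0: "real r \<ge> 1" "real R \<ge> real r" using r by auto
  consider "h = 0" | "0 < h" "h \<le> 2 * int r" | "2 * int r < h" using h by linarith
  then show ?thesis
  proof cases
    case 1
    have "\<bar>\<Sum>n\<in>{- int r..int r}. hilbert_kernel r n * hilbert_kernel R (n + h)\<bar> \<le> (\<Sum>n\<in>{- int r..int r}. 1 / (real_of_int n)\<^sup>2)"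
    proof (rule sum_abs[THEN order_trans], rule sum_mono)
      fix n
      have "\<bar>hilbert_kernel r n * hilbert_kernel R (n + h)\<bar> \<le> 1 / \<bar>real_of_int n\<bar> * (1 / \<bar>real_of_int n\<bar>)"
        unfolding abs_mult using hilbert_kernel_abs_le[OF r(1), of n] hilbert_kernel_abs_le[OF R, of n] 1
        by (intro mult_mono) auto
      then show "\<bar>hilbert_kernel r n * hilbert_kernel R (n + h)\<bar> \<le> 1 / (real_of_int n)\<^sup>2"
        by (simp add: power2_eq_square flip: abs_mult)
    qed
    also have "\<dots> \<le> 4 - 2 / real r" by (rule sum_inverse_squares_int)
    also have "\<dots> \<le> 4" by simp
    also have "4 \<le> 4 * poisson_kernel 1 h" using 1 by (simp add: poisson_kernel_def)
    finally show ?thesis using poisson_kernel_nonneg[of r h] by linarith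
  next
    case 2
    \<comment> \<open>The window is widened until it is invariant under n \<mapsto> - n - h, so that
      the sums of 1 / n and of 1 / (n + h) over it are opposite. The additional products vanish
      because \<open>hilbert_kernel r\<close> does.\<close>
    define J where "J = {- h - int r..int r}"
    define s where "s = (\<Sum>n\<in>J. 1 / real_of_int n)"
    have h1: "real_of_int h \<ge> 1" "real_of_int h \<le> 2 * real r" using 2 by linarith+
    have "real (card J) = 2 * real r + real_of_int h + 1" using 2 by (simp add: J_def)
    then have cJ: "real (card J) \<le> 5 * real r" using h1 r0 by linarith
    \<comment> \<open>The symmetric middle of \<open>J\<close> cancels by oddness, and each of the h
      remaining terms is at most 1 / r in modulus.\<close>
    have s_h: "\<bar>s\<bar> \<le> real_of_int h / real r"
    proof -
      have "J = {- h - int r..- int r - 1} \<union> {- int r..int r}" using 2 by (auto simp: J_def)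
      then have "s = (\<Sum>n\<in>{- h - int r..- int r - 1}. 1 / real_of_int n) + (\<Sum>n\<in>{- int r..int r}. 1 / real_of_int n)"
        unfolding s_def by (simp only:) (rule sum.union_disjoint, auto)
      also have "(\<Sum>n\<in>{- int r..int r}. 1 / real_of_int n) = 0" by (rule sum_odd_int) simp
      finally have "s = (\<Sum>n\<in>{- h - int r..- int r - 1}. 1 / real_of_int n)" by (simp only: add_0_right)
      then have "\<bar>s\<bar> \<le> (\<Sum>n\<in>{- h - int r..- int r - 1}. \<bar>1 / real_of_int n\<bar>)" by (simp only: sum_abs)
      also have "\<dots> \<le> (\<Sum>n\<in>{- h - int r..- int r - 1}. 1 / real r)"
      proof (rule sum_mono)
        fix n assume "n \<in> {- h - int r..- int r - 1}"
        then have "\<bar>real_of_int n\<bar> \<ge> real r" by auto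
        then show "\<bar>1 / real_of_int n\<bar> \<le> 1 / real r" using r0 by (simp add: frac_le)
      qed
      finally show ?thesis using 2 by simp
    qed
    also have "real_of_int h / real r \<le> 2" using h1 r0 by (simp add: divide_le_eq)
    finally have s_le: "\<bar>s\<bar> \<le> 2" .
    have s': "(\<Sum>n\<in>J. 1 / real_of_int (n + h)) = - s"
    proof -
      have "(\<Sum>n\<in>J. 1 / real_of_int (n + h)) = (\<Sum>n\<in>J. 1 / real_of_int (- n))"
        by (rule sum.reindex_bij_witness[of _ "\<lambda>n. - n - h" "\<lambda>n. - n - h"]) (auto simp: J_def)
      then show ?thesis by (simp add: s_def sum_negf)
    qed
    have "(\<Sum>n\<in>{- int r..int r}. hilbert_kernel r n * hilbert_kernel R (n + h)) = (\<Sum>n\<in>J. hilbert_kernel r n * hilbert_kernel R (n + h))"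
      using 2 by (intro sum.mono_neutral_left) (auto simp: J_def hilbert_kernel_def)
    also have "\<dots> = (\<Sum>n\<in>J. 1 / real_of_int n * (1 / real_of_int (n + h)))
        - (\<Sum>n\<in>J. hilbert_tail r n * (1 / real_of_int (n + h)))
        - (\<Sum>n\<in>J. hilbert_tail R (n + h) * (1 / real_of_int n)) + (\<Sum>n\<in>J. hilbert_tail r n * hilbert_tail R (n + h))"
      unfolding sum_subtractf[symmetric] sum.distrib[symmetric]
      by (intro sum.cong refl) (simp add: hilbert_kernel_kap algebra_simps)
    finally have eq: "(\<Sum>n\<in>{- int r..int r}. hilbert_kernel r n * hilbert_kernel R (n + h)) = (\<Sum>n\<in>J. 1 / real_of_int n * (1 / real_of_int (n + h)))
        - (\<Sum>n\<in>J. hilbert_tail r n * (1 / real_of_int (n + h)))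
        - (\<Sum>n\<in>J. hilbert_tail R (n + h) * (1 / real_of_int n)) + (\<Sum>n\<in>J. hilbert_tail r n * hilbert_tail R (n + h))" .
    have T1: "\<bar>\<Sum>n\<in>J. 1 / real_of_int n * (1 / real_of_int (n + h))\<bar> \<le> 2 / (real_of_int h)\<^sup>2 + 4 / real r"
    proof (cases "h = 0")
      case False
      \<comment> \<open>At n = 0 and at n = - h the product is 0 since 1 / 0 = 0, while the partial
        fraction equals - 1 / h^2; the two conditional terms restore equality and account for 2 /
        h^2.\<close>
      have "(\<Sum>n\<in>J. 1 / real_of_int n * (1 / real_of_int (n + h))) =
        (\<Sum>n\<in>J. (1 / real_of_int n - 1 / real_of_int (n + h)) / real_of_int h + (if n = 0 then 1 / (real_of_int h)\<^sup>2 else 0) + (if n = - h then 1 / (real_of_int h)\<^sup>2 else 0))"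
      proof (intro sum.cong refl)
        fix n
        consider "n = 0" | "n = - h" | "n \<noteq> 0" "real_of_int n + real_of_int h \<noteq> 0" by linarith
        then show "1 / real_of_int n * (1 / real_of_int (n + h)) = (1 / real_of_int n - 1 / real_of_int (n + h)) / real_of_int h + (if n = 0 then 1 / (real_of_int h)\<^sup>2 else 0) + (if n = - h then 1 / (real_of_int h)\<^sup>2 else 0)"
        proof cases
          case 3
          then have "n \<noteq> - h" by auto
          moreover have "1 / real_of_int n - 1 / (real_of_int n + real_of_int h) = real_of_int h / (real_of_int n * (real_of_int n + real_of_int h))"
            using 3 by (simp add: divide_simps)
          ultimately show ?thesis using 3 False by simp
        qed (use False in \<open>auto simp: power2_eq_square\<close>)
      qed
      also have "\<dots> = (s - (- s)) / real_of_int h + 2 / (real_of_int h)\<^sup>2"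
      proof -
        have "finite J" "0 \<in> J" "- h \<in> J" using 2 by (auto simp: J_def)
        then show ?thesis unfolding sum.distrib sum_divide_distrib[symmetric] sum_subtractf s'
          by (simp add: s_def sum.delta)
      qed
      also have "\<bar>\<dots>\<bar> \<le> \<bar>2 * s / real_of_int h\<bar> + 2 / (real_of_int h)\<^sup>2"
        using abs_triangle_ineq[of "2 * s / real_of_int h" "2 / (real_of_int h)\<^sup>2"] by simp
      also have "\<bar>2 * s / real_of_int h\<bar> \<le> 4 / real r"
      proof -
        show ?thesis using s_h h1 r0 by (simp add: abs_mult field_simps)
      qed
      finally show ?thesis by linarith
    qed (use 2 in simp)
    have T2: "\<bar>\<Sum>n\<in>J. hilbert_tail r n * (1 / real_of_int (n + h))\<bar> \<le> 7 / real r"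
    proof -
      \<comment> \<open>Subtracting the value at the singular point n = - h leaves terms of size at
        most 1 / r^2 by the Lipschitz bound; the subtracted constant multiplies the small sum
        \<open>- s\<close>. The next estimate does the same at n = 0.\<close>
      have "(\<Sum>n\<in>J. hilbert_tail r n * (1 / real_of_int (n + h))) = (\<Sum>n\<in>J. (hilbert_tail r n - hilbert_tail r (- h)) * (1 / real_of_int (n + h))) + hilbert_tail r (- h) * (- s)"
        unfolding s'[symmetric] sum_distrib_left sum.distrib[symmetric]
        by (intro sum.cong refl) (simp add: left_diff_distrib diff_divide_distrib)
      also have "\<bar>\<dots>\<bar> \<le> (\<Sum>n\<in>J. 1 / (real r)\<^sup>2) + 1 / real r * 2"
      proof (rule abs_triangle_ineq[THEN order_trans], rule add_mono)
        show "\<bar>\<Sum>n\<in>J. (hilbert_tail r n - hilbert_tail r (- h)) * (1 / real_of_int (n + h))\<bar> \<le> (\<Sum>n\<in>J. 1 / (real r)\<^sup>2)"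
        proof (rule sum_abs[THEN order_trans], rule sum_mono)
          fix n
          have "\<bar>(hilbert_tail r n - hilbert_tail r (- h)) * (1 / real_of_int (n + h))\<bar> \<le> \<bar>real_of_int n - real_of_int (- h)\<bar> / (real r)\<^sup>2 * (1 / \<bar>real_of_int (n + h)\<bar>)"
            unfolding abs_mult by (intro mult_mono hilbert_tail_lipschitz r) auto
          also have "\<dots> \<le> 1 / (real r)\<^sup>2" by (cases "real_of_int n + real_of_int h = 0") auto
          finally show "\<bar>(hilbert_tail r n - hilbert_tail r (- h)) * (1 / real_of_int (n + h))\<bar> \<le> 1 / (real r)\<^sup>2" .
        qed
        show "\<bar>hilbert_tail r (- h) * - s\<bar> \<le> 1 / real r * 2"
          unfolding abs_mult using s_le by (intro mult_mono hilbert_tail_abs_le r) auto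
      qed
      also have "(\<Sum>n\<in>J. 1 / (real r)\<^sup>2) \<le> 5 / real r"
        using cJ r0 by (simp add: field_simps power2_eq_square)
      finally show ?thesis by simp
    qed
    have T3: "\<bar>\<Sum>n\<in>J. hilbert_tail R (n + h) * (1 / real_of_int n)\<bar> \<le> 7 / real r"
    proof -
      have "(\<Sum>n\<in>J. hilbert_tail R (n + h) * (1 / real_of_int n)) = (\<Sum>n\<in>J. (hilbert_tail R (n + h) - hilbert_tail R h) * (1 / real_of_int n)) + hilbert_tail R h * s"
        unfolding s_def sum_distrib_left sum.distrib[symmetric]
        by (intro sum.cong refl) (simp add: left_diff_distrib diff_divide_distrib)
      also have "\<bar>\<dots>\<bar> \<le> (\<Sum>n\<in>J. 1 / (real r)\<^sup>2) + 1 / real r * 2"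
      proof (rule abs_triangle_ineq[THEN order_trans], rule add_mono)
        show "\<bar>\<Sum>n\<in>J. (hilbert_tail R (n + h) - hilbert_tail R h) * (1 / real_of_int n)\<bar> \<le> (\<Sum>n\<in>J. 1 / (real r)\<^sup>2)"
        proof (rule sum_abs[THEN order_trans], rule sum_mono)
          fix n
          have "\<bar>(hilbert_tail R (n + h) - hilbert_tail R h) * (1 / real_of_int n)\<bar> \<le> \<bar>real_of_int (n + h) - real_of_int h\<bar> / (real R)\<^sup>2 * (1 / \<bar>real_of_int n\<bar>)"
            unfolding abs_mult using hilbert_tail_lipschitz[OF R, of "n + h" h] by (intro mult_mono) auto
          also have "\<dots> \<le> 1 / (real R)\<^sup>2" by (cases "n = 0") auto
          also have "\<dots> \<le> 1 / (real r)\<^sup>2" using r0 by (intro divide_left_mono power_mono) auto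
          finally show "\<bar>(hilbert_tail R (n + h) - hilbert_tail R h) * (1 / real_of_int n)\<bar> \<le> 1 / (real r)\<^sup>2" .
        qed
        have "\<bar>hilbert_tail R h\<bar> \<le> 1 / real R" by (rule hilbert_tail_abs_le[OF R])
        also have "\<dots> \<le> 1 / real r" using r0 by (intro divide_left_mono) auto
        finally show "\<bar>hilbert_tail R h * s\<bar> \<le> 1 / real r * 2"
          unfolding abs_mult using s_le by (intro mult_mono) auto
      qed
      also have "(\<Sum>n\<in>J. 1 / (real r)\<^sup>2) \<le> 5 / real r"
        using cJ r0 by (simp add: field_simps power2_eq_square)
      finally show ?thesis by simp
    qed
    have T4: "\<bar>\<Sum>n\<in>J. hilbert_tail r n * hilbert_tail R (n + h)\<bar> \<le> 5 / real r"
    proof -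
      have "\<bar>\<Sum>n\<in>J. hilbert_tail r n * hilbert_tail R (n + h)\<bar> \<le> (\<Sum>n\<in>J. 1 / real r * (1 / real r))"
      proof (rule sum_abs[THEN order_trans], rule sum_mono)
        fix n
        have "\<bar>hilbert_tail R (n + h)\<bar> \<le> 1 / real R" by (rule hilbert_tail_abs_le[OF R])
        also have "\<dots> \<le> 1 / real r" using r0 by (intro divide_left_mono) auto
        finally show "\<bar>hilbert_tail r n * hilbert_tail R (n + h)\<bar> \<le> 1 / real r * (1 / real r)"
          unfolding abs_mult by (intro mult_mono hilbert_tail_abs_le r) auto
      qed
      also have "\<dots> \<le> 5 / real r" using cJ r0 by (simp add: field_simps)
      finally show ?thesis .
    qed
    have "\<bar>\<Sum>n\<in>{- int r..int r}. hilbert_kernel r n * hilbert_kernel R (n + h)\<bar> \<le> 2 / (real_of_int h)\<^sup>2 + 23 / real r"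
    proof -
      have "4 / real r + 7 / real r + 7 / real r + 5 / real r = 23 / real r" by (simp add: add_divide_distrib[symmetric])
      then show ?thesis unfolding eq using T1 T2 T3 T4 by linarith
    qed
    also have "2 / (real_of_int h)\<^sup>2 \<le> 4 * poisson_kernel 1 h"
      using h1 mult_mono[of 1 "real_of_int h" 1 "real_of_int h"] by (simp add: poisson_kernel_def power2_eq_square field_simps)
    \<comment> \<open>Since h \<le> 2 r, the Poisson kernel is at least 1 / (5 r), and 23 * 5 =
      115.\<close>
    also have "23 / real r \<le> 120 * poisson_kernel r h"
    proof -
      have "(real_of_int h)\<^sup>2 \<le> (2 * real r)\<^sup>2" using h1 by (intro power_mono) auto
      then have "real r / (5 * (real r)\<^sup>2) \<le> poisson_kernel r h" unfolding poisson_kernel_def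
        using r0 by (intro divide_left_mono mult_pos_pos add_pos_nonneg) (auto simp: power2_eq_square)
      then have "1 / (5 * real r) \<le> poisson_kernel r h" using r0 by (simp add: power2_eq_square)
      moreover have "23 / real r = 115 * (1 / (5 * real r))" by simp
      ultimately show ?thesis using poisson_kernel_nonneg[of r h] by linarith
    qed
    finally show ?thesis by simp
  next
    case 3
    have h2: "real_of_int h > 2 * real r" using 3 by linarith
    show ?thesis
    proof (cases "h > int r + int R")
      case True
      then have "(\<Sum>n\<in>{- int r..int r}. hilbert_kernel r n * hilbert_kernel R (n + h)) = 0"
        by (intro sum.neutral) (auto simp: hilbert_kernel_def)
      then show ?thesis using poisson_kernel_nonneg[of r h] poisson_kernel_nonneg[of 1 h] by simp
    next
      case False
      then have hR: "real_of_int h \<le> 2 * real R" using r by linarith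
      have z: "(\<Sum>n\<in>{- int r..int r}. hilbert_kernel r n) = 0" by (rule sum_odd_int) (simp add: hilbert_kernel_minus)
      have "(\<Sum>n\<in>{- int r..int r}. hilbert_kernel r n * hilbert_kernel R (n + h)) = (\<Sum>n\<in>{- int r..int r}. hilbert_kernel r n * (hilbert_kernel R (n + h) - hilbert_kernel R h))"
        by (simp add: right_diff_distrib sum_subtractf sum_distrib_right[symmetric] z)
      also have "\<bar>\<dots>\<bar> \<le> (\<Sum>n\<in>{- int r..int r}. 6 / (real_of_int h)\<^sup>2)"
      proof (rule sum_abs[THEN order_trans], rule sum_mono)
        fix n assume n: "n \<in> {- int r..int r}"
        then have n1: "\<bar>real_of_int n\<bar> \<le> real r" by auto
        have nh: "real_of_int (n + h) \<ge> real_of_int h / 2" using n1 h2 by auto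
        have "hilbert_kernel R (n + h) - hilbert_kernel R h = (1 / real_of_int (n + h) - 1 / real_of_int h) - (hilbert_tail R (n + h) - hilbert_tail R h)"
          by (simp add: hilbert_kernel_kap)
        also have "\<bar>\<dots>\<bar> \<le> \<bar>1 / real_of_int (n + h) - 1 / real_of_int h\<bar> + \<bar>hilbert_tail R (n + h) - hilbert_tail R h\<bar>" by simp
        also have "\<bar>1 / real_of_int (n + h) - 1 / real_of_int h\<bar> \<le> 2 * \<bar>real_of_int n\<bar> / (real_of_int h)\<^sup>2"
        proof -
          have p: "real_of_int (n + h) > 0" "real_of_int h > 0" using nh h2 r0 by linarith+
          have "1 / real_of_int (n + h) - 1 / real_of_int h = - real_of_int n / (real_of_int (n + h) * real_of_int h)"
            using p by (simp add: field_simps)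
          then have "\<bar>1 / real_of_int (n + h) - 1 / real_of_int h\<bar> = \<bar>real_of_int n\<bar> / (real_of_int (n + h) * real_of_int h)"
            using p by (simp add: abs_mult)
          also have "\<dots> \<le> \<bar>real_of_int n\<bar> / (real_of_int h / 2 * real_of_int h)"
            using p nh by (intro divide_left_mono mult_right_mono) (auto intro!: mult_pos_pos)
          finally show ?thesis by (simp add: power2_eq_square mult.commute)
        qed
        also have "\<bar>hilbert_tail R (n + h) - hilbert_tail R h\<bar> \<le> 4 * \<bar>real_of_int n\<bar> / (real_of_int h)\<^sup>2"
        proof -
          have "\<bar>hilbert_tail R (n + h) - hilbert_tail R h\<bar> \<le> \<bar>real_of_int n\<bar> / (real R)\<^sup>2"
            using hilbert_tail_lipschitz[OF R, of "n + h" h] by simp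
          also have "\<dots> \<le> \<bar>real_of_int n\<bar> / ((real_of_int h / 2)\<^sup>2)"
            using hR h2 r0 by (intro divide_left_mono power_mono) auto
          finally show ?thesis by (simp add: power_divide mult.commute)
        qed
        finally have "\<bar>hilbert_kernel R (n + h) - hilbert_kernel R h\<bar> \<le> 6 * \<bar>real_of_int n\<bar> / (real_of_int h)\<^sup>2"
          by (simp add: add_divide_distrib[symmetric])
        then have "\<bar>hilbert_kernel r n * (hilbert_kernel R (n + h) - hilbert_kernel R h)\<bar> \<le> 1 / \<bar>real_of_int n\<bar> * (6 * \<bar>real_of_int n\<bar> / (real_of_int h)\<^sup>2)"
          unfolding abs_mult by (intro mult_mono hilbert_kernel_abs_le r) auto
        also have "\<dots> \<le> 6 / (real_of_int h)\<^sup>2" by (cases "n = 0") auto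
        finally show "\<bar>hilbert_kernel r n * (hilbert_kernel R (n + h) - hilbert_kernel R h)\<bar> \<le> 6 / (real_of_int h)\<^sup>2" .
      qed
      also have "\<dots> = (2 * real r + 1) * 6 / (real_of_int h)\<^sup>2" by simp
      also have "\<dots> \<le> 18 * real r / (real_of_int h)\<^sup>2" using r0 by (intro divide_right_mono) auto
      also have "\<dots> \<le> 120 * poisson_kernel r h"
      proof -
        have hp: "real_of_int h > 0" using h2 r0 by linarith
        have "(real r)\<^sup>2 \<le> (real_of_int h)\<^sup>2" using h2 r0 by (intro power_mono) auto
        then have "real r / (2 * (real_of_int h)\<^sup>2) \<le> poisson_kernel r h" unfolding poisson_kernel_def
          using r0 hp by (intro divide_left_mono mult_pos_pos add_pos_nonneg) auto
        then show ?thesis using poisson_kernel_nonneg[of r h] hp by (simp add: field_simps)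
      qed
      finally show ?thesis using poisson_kernel_nonneg[of 1 h] by linarith
    qed
  qed
qed


lemma hilbert_kernel_corr:
  assumes r: "1 \<le> r" "r \<le> R"
  shows "\<bar>\<Sum>n\<in>{- int r..int r}. hilbert_kernel r n * hilbert_kernel R (n + h)\<bar> \<le> 120 * poisson_kernel r h + 4 * poisson_kernel 1 h"
proof (cases "h \<ge> 0")
  case True then show ?thesis using hilbert_kernel_corr_pos[OF r] by blast
next
  case False
  have "(\<Sum>n\<in>{- int r..int r}. hilbert_kernel r n * hilbert_kernel R (n + h)) = (\<Sum>n\<in>{- int r..int r}. hilbert_kernel r (- n) * hilbert_kernel R (- n + h))"
    by (rule sum.reindex_bij_witness[of _ uminus uminus]) auto
  also have "\<dots> = (\<Sum>n\<in>{- int r..int r}. hilbert_kernel r n * hilbert_kernel R (n + (- h)))"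
  proof (intro sum.cong refl)
    fix n
    have "hilbert_kernel R (- n + h) = - hilbert_kernel R (n + (- h))" using hilbert_kernel_minus[of R "n + (- h)"] by simp
    then show "hilbert_kernel r (- n) * hilbert_kernel R (- n + h) = hilbert_kernel r n * hilbert_kernel R (n + (- h))" by (simp only: hilbert_kernel_minus)
  qed
  finally have "\<bar>\<Sum>n\<in>{- int r..int r}. hilbert_kernel r n * hilbert_kernel R (n + h)\<bar> = \<bar>\<Sum>n\<in>{- int r..int r}. hilbert_kernel r n * hilbert_kernel R (n + (- h))\<bar>" by simp
  also have "\<dots> \<le> 120 * poisson_kernel r (- h) + 4 * poisson_kernel 1 (- h)" using False by (intro hilbert_kernel_corr_pos r) simp
  finally show ?thesis by (simp add: poisson_kernel_def)
qed

text \<open>\<open>XS\<close> puts the full support of every kernel centred in \<open>X\<close>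
  inside \<open>S\<close>, so correlations over \<open>S\<close> are complete sums and their
  cancellation is available. The constant comes from (120 + 120 + 4) * 96 = 23424, which is below
  160^2.\<close>

lemma hilbert_maximal:
  fixes f :: "int \<Rightarrow> complex" and R :: "int \<Rightarrow> nat"
  assumes X: "finite X" and S: "finite S" and R: "\<And>x. R x \<ge> 1"
    and XS: "\<And>x n. x \<in> X \<Longrightarrow> \<bar>n\<bar> \<le> int (R x) \<Longrightarrow> x - n \<in> S"
  shows "L2_set (\<lambda>x. norm (\<Sum>m\<in>S. of_real (hilbert_kernel (R x) (x - m)) * f m)) X \<le> 160 * L2_set (\<lambda>m. norm (f m)) S"
proof -
  have correlation: "\<bar>\<Sum>m\<in>S. hilbert_kernel (R x) (x - m) * hilbert_kernel (R y) (y - m)\<bar> \<le> 120 * poisson_kernel (R y) (x - y) + 4 * poisson_kernel 1 (x - y)"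
    if "R y \<le> R x" "y \<in> X" for x y
  proof -
    have "(\<Sum>m\<in>S. hilbert_kernel (R x) (x - m) * hilbert_kernel (R y) (y - m)) = (\<Sum>m\<in>{y - int (R y)..y + int (R y)}. hilbert_kernel (R x) (x - m) * hilbert_kernel (R y) (y - m))"
    proof (rule sum.mono_neutral_right[OF S])
      show "{y - int (R y)..y + int (R y)} \<subseteq> S"
      proof
        fix m assume "m \<in> {y - int (R y)..y + int (R y)}"
        then show "m \<in> S" using XS[OF that(2), of "y - m"] by auto
      qed
    qed (auto simp: hilbert_kernel_def)
    also have "\<dots> = (\<Sum>n\<in>{- int (R y)..int (R y)}. hilbert_kernel (R y) n * hilbert_kernel (R x) (n + (x - y)))"
      by (rule sum.reindex_bij_witness[of _ "\<lambda>n. y - n" "\<lambda>m. y - m"]) (auto simp: mult.commute)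
    finally show ?thesis using hilbert_kernel_corr[OF R that(1)] by simp
  qed
  have "L2_set (\<lambda>x. norm (\<Sum>m\<in>S. of_real (hilbert_kernel (R x) (x - m)) * f m)) X \<le> sqrt 23424 * L2_set (\<lambda>m. norm (f m)) S"
  proof (rule TT_star)
    fix g :: "int \<Rightarrow> real" assume g: "\<And>x. 0 \<le> g x"
    have "(\<Sum>x\<in>X. \<Sum>y\<in>X. norm (\<Sum>m\<in>S. of_real (hilbert_kernel (R x) (x - m)) * cnj (complex_of_real (hilbert_kernel (R y) (y - m)))) * g x * g y)
       \<le> (\<Sum>x\<in>X. \<Sum>y\<in>X. 120 * (poisson_kernel (R x) (x - y) * g x * g y) + 120 * (poisson_kernel (R y) (x - y) * g x * g y) + 4 * (poisson_kernel 1 (x - y) * g x * g y))"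
    proof (intro sum_mono)
      fix x y assume xy: "x \<in> X" "y \<in> X"
      have "(\<Sum>m\<in>S. of_real (hilbert_kernel (R x) (x - m)) * cnj (complex_of_real (hilbert_kernel (R y) (y - m)))) = of_real (\<Sum>m\<in>S. hilbert_kernel (R x) (x - m) * hilbert_kernel (R y) (y - m))" by simp
      then have "norm (\<Sum>m\<in>S. of_real (hilbert_kernel (R x) (x - m)) * cnj (complex_of_real (hilbert_kernel (R y) (y - m)))) = \<bar>\<Sum>m\<in>S. hilbert_kernel (R x) (x - m) * hilbert_kernel (R y) (y - m)\<bar>"
        by (simp only: norm_of_real)
      also have "\<dots> \<le> 120 * poisson_kernel (R x) (x - y) + 120 * poisson_kernel (R y) (x - y) + 4 * poisson_kernel 1 (x - y)"
      proof (cases "R y \<le> R x")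
        case True
        then show ?thesis using correlation[of y x] xy poisson_kernel_nonneg[of "R x" "x - y"] by linarith
      next
        case False
        have "(\<Sum>m\<in>S. hilbert_kernel (R x) (x - m) * hilbert_kernel (R y) (y - m)) = (\<Sum>m\<in>S. hilbert_kernel (R y) (y - m) * hilbert_kernel (R x) (x - m))"
          by (simp add: mult.commute)
        then show ?thesis using False correlation[of x y] xy poisson_kernel_nonneg[of "R y" "x - y"] poisson_kernel_commute[of _ x y] by force
      qed
      finally have "norm (\<Sum>m\<in>S. of_real (hilbert_kernel (R x) (x - m)) * cnj (complex_of_real (hilbert_kernel (R y) (y - m)))) * (g x * g y)
          \<le> (120 * poisson_kernel (R x) (x - y) + 120 * poisson_kernel (R y) (x - y) + 4 * poisson_kernel 1 (x - y)) * (g x * g y)"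
        using g by (intro mult_right_mono) auto
      then show "norm (\<Sum>m\<in>S. of_real (hilbert_kernel (R x) (x - m)) * cnj (complex_of_real (hilbert_kernel (R y) (y - m)))) * g x * g y
         \<le> 120 * (poisson_kernel (R x) (x - y) * g x * g y) + 120 * (poisson_kernel (R y) (x - y) * g x * g y) + 4 * (poisson_kernel 1 (x - y) * g x * g y)"
        by (simp add: algebra_simps)
    qed
    also have "\<dots> = 120 * (\<Sum>x\<in>X. \<Sum>y\<in>X. poisson_kernel (R x) (x - y) * g x * g y) + 120 * (\<Sum>x\<in>X. \<Sum>y\<in>X. poisson_kernel (R y) (x - y) * g x * g y)
        + 4 * (\<Sum>x\<in>X. \<Sum>y\<in>X. poisson_kernel 1 (x - y) * g x * g y)"
      by (simp add: sum.distrib sum_distrib_left)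
    also have "(\<Sum>x\<in>X. \<Sum>y\<in>X. poisson_kernel (R y) (x - y) * g x * g y) = (\<Sum>x\<in>X. \<Sum>y\<in>X. poisson_kernel (R x) (x - y) * g x * g y)"
      by (subst sum.swap) (intro sum.cong refl, simp add: poisson_kernel_commute mult_ac)
    finally show "(\<Sum>x\<in>X. \<Sum>y\<in>X. norm (\<Sum>m\<in>S. of_real (hilbert_kernel (R x) (x - m)) * cnj (complex_of_real (hilbert_kernel (R y) (y - m)))) * g x * g y) \<le> 23424 * (\<Sum>x\<in>X. (g x)\<^sup>2)"
      using poisson_kernel_bilinear[where g = g and r = R, OF X g R] poisson_kernel_bilinear[where g = g and r = "\<lambda>_. 1", OF X g order_refl] by linarith
  qed simp
  also have "sqrt 23424 \<le> 160" by (rule real_le_lsqrt) auto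
  finally show ?thesis by (simp add: mult_right_mono)
qed

section \<open>Exponential sums with monotone differences\<close>

definition ee :: "real \<Rightarrow> complex" where "ee u = cis (2 * pi * u)"

lemma norm_ee [simp]: "norm (ee u) = 1" by (simp add: ee_def)
lemma ee_add: "ee (u + v) = ee u * ee v" by (simp add: ee_def cis_mult distrib_left)
lemma ee_diff: "ee (u - v) = ee u * cnj (ee v)" by (simp add: ee_def cis_mult cis_cnj right_diff_distrib)
lemma ee_minus: "ee (- u) = cnj (ee u)" by (simp add: ee_def cis_cnj)
lemma ee_int [simp]: "ee (of_int k) = 1" by (simp add: ee_def)
lemma ee_0 [simp]: "ee 0 = 1" by (simp add: ee_def)

lemma ee_diff_1: "norm (ee u - 1) = 2 * \<bar>sin (pi * u)\<bar>"
  using dist_exp_i_1[of "2 * pi * u"] by (simp add: ee_def cis_conv_exp)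

lemma ee_lipschitz: "norm (ee u - ee v) \<le> 2 * pi * \<bar>u - v\<bar>"
proof -
  have "ee u - ee v = ee v * (ee (u - v) - 1)" by (simp add: algebra_simps flip: ee_add)
  then have "norm (ee u - ee v) = 2 * \<bar>sin (pi * (u - v))\<bar>" by (simp add: norm_mult ee_diff_1)
  also have "\<dots> \<le> 2 * \<bar>pi * (u - v)\<bar>" using abs_sin_x_le_abs_x by (intro mult_left_mono) auto
  finally show ?thesis by (simp add: abs_mult)
qed

text \<open>Jordan's inequality: by concavity the sine lies above its chord from 0 to pi /
  2.\<close>

lemma sin_ge_jordan:
  assumes "0 \<le> y" "y \<le> pi / 2" shows "sin y \<ge> 2 * y / pi"
proof -
  have "convex_on {0..pi} (\<lambda>x. - sin x)"
  proof (rule f''_ge0_imp_convex)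
    show "((\<lambda>x. - sin x) has_real_derivative - cos x) (at x)" for x by (auto intro!: derivative_eq_intros)
    show "((\<lambda>x. - cos x) has_real_derivative sin x) (at x)" for x by (auto intro!: derivative_eq_intros)
    show "0 \<le> sin x" if "x \<in> {0..pi}" for x using that by (simp add: sin_ge_zero)
  qed simp
  then have "- sin ((1 - 2 * y / pi) * 0 + (2 * y / pi) * (pi / 2)) \<le> (1 - 2 * y / pi) * (- sin 0) + (2 * y / pi) * (- sin (pi / 2))"
    using convex_onD[of "{0..pi}" "\<lambda>x. - sin x" "2 * y / pi" 0 "pi / 2"] assms by (simp add: divide_le_eq)
  then show ?thesis by simp
qed

lemma sin_pi_ge:
  assumes "0 \<le> \<theta>" "\<theta> \<le> x" "x \<le> 1 - \<theta>" shows "sin (pi * x) \<ge> 2 * \<theta>"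
proof (cases "x \<le> 1 / 2")
  case True
  then have "sin (pi * x) \<ge> 2 * (pi * x) / pi" using assms by (intro sin_ge_jordan) auto
  then show ?thesis using assms by simp
next
  case False
  have "sin (pi * (1 - x)) \<ge> 2 * (pi * (1 - x)) / pi" using assms False by (intro sin_ge_jordan) auto
  moreover have "sin (pi * (1 - x)) = sin (pi * x)" by (simp add: right_diff_distrib sin_diff)
  ultimately show ?thesis using assms by simp
qed

text \<open>The closed form of \<open>1 / (1 - ee x)\<close>: its real part is constant and its imaginary part is monotone
  on each unit interval, so its total variation telescopes.\<close>

lemma inverse_one_minus_ee:
  assumes "sin (pi * x) \<noteq> 0"
  shows "(1 - ee x) * Complex (1/2) (cos (pi * x) / sin (pi * x) / 2) = 1"
proof -
  define y where "y = pi * x"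
  have c: "cos (2 * y) = 1 - 2 * (sin y)\<^sup>2" by (rule cos_double_sin)
  have s: "sin (2 * y) = 2 * sin y * cos y" by (rule sin_double)
  have e: "ee x = cis (2 * y)" by (simp add: ee_def y_def mult.assoc)
  have y: "sin y \<noteq> 0" using assms by (simp add: y_def)
  have "Re ((1 - cis (2 * y)) * Complex (1/2) (cos y / sin y / 2)) = (sin y)\<^sup>2 + (cos y)\<^sup>2"
    using y by (simp add: c s power2_eq_square)
  moreover have "Im ((1 - cis (2 * y)) * Complex (1/2) (cos y / sin y / 2)) = 0"
    using y by (simp add: c s power2_eq_square)
  ultimately have "(1 - cis (2 * y)) * Complex (1/2) (cos y / sin y / 2) = 1"
    by (simp add: complex_eq_iff)
  then show ?thesis by (simp add: e flip: y_def)
qed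

text \<open>The Kusmin-Landau inequality. Each term is \<open>w t\<close> times a difference of
  consecutive exponentials, where \<open>w t\<close> is the reciprocal of 1 - ee (g t); partial
  summation leaves boundary terms and the total variation of \<open>w\<close>. The differences up to
  F (M + 1) - F M are involved, one point beyond the sum.\<close>

lemma kusmin_landau:
  fixes F :: "int \<Rightarrow> real" and \<nu> :: int and \<theta> :: real
  assumes mM: "m \<le> M" and \<theta>: "0 < \<theta>"
    and mono: "\<And>t. m \<le> t \<Longrightarrow> t < M \<Longrightarrow> F (t + 1) - F t \<le> F (t + 2) - F (t + 1)"
    and range: "\<And>t. m \<le> t \<Longrightarrow> t \<le> M \<Longrightarrow> \<nu> + \<theta> \<le> F (t + 1) - F t \<and> F (t + 1) - F t \<le> \<nu> + 1 - \<theta>"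
  shows "norm (\<Sum>t\<in>{m..M}. ee (F t)) \<le> 1 / \<theta>"
proof -
  define g where "g t = F (t + 1) - F t - \<nu>" for t
  define c where "c t = cos (pi * g t) / sin (pi * g t) / 2" for t
  define w where "w t = Complex (1/2) (c t)" for t
  have gr: "\<theta> \<le> g t" "g t \<le> 1 - \<theta>" if "m \<le> t" "t \<le> M" for t using range[OF that] by (auto simp: g_def)
  have sn: "sin (pi * g t) \<ge> 2 * \<theta>" if "m \<le> t" "t \<le> M" for t using gr[OF that] \<theta> by (intro sin_pi_ge) auto
  have step: "ee (F t) = w t * (ee (F t) - ee (F (t + 1)))" if "m \<le> t" "t \<le> M" for t
  proof -
    have "(1 - ee (g t)) * w t = 1" unfolding w_def c_def using sn[OF that] \<theta> by (intro inverse_one_minus_ee) auto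
    moreover have "F (t + 1) = F t + g t + of_int \<nu>" by (simp add: g_def)
    then have "ee (F (t + 1)) = ee (F t) * ee (g t)" by (simp add: ee_add)
    then have "ee (F t) - ee (F (t + 1)) = ee (F t) * (1 - ee (g t))" by (simp add: algebra_simps)
    ultimately show ?thesis by (metis mult.assoc mult.commute mult.right_neutral)
  qed
  have nw: "norm (w t) \<le> 1 / (4 * \<theta>)" if "m \<le> t" "t \<le> M" for t
  proof -
    have s0: "sin (pi * g t) > 0" using sn[OF that] \<theta> by simp
    have "(norm (w t))\<^sup>2 = (1 / (2 * sin (pi * g t)))\<^sup>2"
    proof -
      have "(norm (w t))\<^sup>2 = 1/4 + (cos (pi * g t))\<^sup>2 / (4 * (sin (pi * g t))\<^sup>2)"
        unfolding cmod_power2 by (simp add: w_def c_def power_divide power_mult_distrib)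
      also have "\<dots> = ((sin (pi * g t))\<^sup>2 + (cos (pi * g t))\<^sup>2) / (4 * (sin (pi * g t))\<^sup>2)"
        using s0 unfolding add_divide_distrib by simp
      finally show ?thesis by (simp add: power_divide power_mult_distrib)
    qed
    then have "norm (w t) = 1 / (2 * sin (pi * g t))" by (rule power2_eq_imp_eq) (use s0 in simp_all)
    also have "\<dots> \<le> 1 / (2 * (2 * \<theta>))" using sn[OF that] \<theta> by (intro divide_left_mono) auto
    finally show ?thesis by simp
  qed
  have cm: "c (t + 1) \<le> c t" if "m \<le> t" "t < M" for t
  proof -
    have s: "sin (pi * g t) > 0" "sin (pi * g (t + 1)) > 0" using sn[of t] sn[of "t + 1"] that \<theta> by auto
    have gm: "g t \<le> g (t + 1)" using mono[OF that] by (simp add: g_def add.assoc)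
    have "g (t + 1) - g t \<le> 1" using gr[of t] gr[of "t + 1"] that \<theta> by auto
    then have "sin (pi * (g (t + 1) - g t)) \<ge> 0" using gm by (intro sin_ge_zero) (auto simp: mult_left_le)
    then have "cos (pi * g (t + 1)) * sin (pi * g t) \<le> cos (pi * g t) * sin (pi * g (t + 1))"
      by (simp add: right_diff_distrib sin_diff mult.commute)
    then have "cos (pi * g (t + 1)) * sin (pi * g t) / sin (pi * g (t + 1)) \<le> cos (pi * g t)"
      using s by (simp only: pos_divide_le_eq)
    then have "cos (pi * g (t + 1)) / sin (pi * g (t + 1)) * sin (pi * g t) \<le> cos (pi * g t)" by simp
    then have "cos (pi * g (t + 1)) / sin (pi * g (t + 1)) \<le> cos (pi * g t) / sin (pi * g t)"
      using s by (simp only: pos_le_divide_eq)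
    then show ?thesis by (simp add: c_def)
  qed
  \<comment> \<open>Keeping the boundary term inside the norm makes the induction exact: passing to
    k + 1 adds only \<open>w (k + 1) - w k\<close> times a unimodular factor.\<close>
  have main: "norm ((\<Sum>t\<in>{m..k}. ee (F t)) + w k * ee (F (k + 1))) \<le> norm (w m) + (c m - c k)"
    if "m \<le> k" "k \<le> M" for k
    using that
  proof (induction k rule: int_ge_induct)
    case base
    have "ee (F m) + w m * ee (F (m + 1)) = w m * ee (F m)" using step[of m] mM by (simp add: algebra_simps)
    then show ?case by (simp add: norm_mult)
  next
    case (step k)
    have "{m..k + 1} = insert (k + 1) {m..k}" using step.hyps by auto
    then have "(\<Sum>t\<in>{m..k + 1}. ee (F t)) + w (k + 1) * ee (F (k + 1 + 1)) = (\<Sum>t\<in>{m..k}. ee (F t)) + (ee (F (k + 1)) + w (k + 1) * ee (F (k + 1 + 1)))"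
      by simp
    also have "ee (F (k + 1)) + w (k + 1) * ee (F (k + 1 + 1)) = w (k + 1) * ee (F (k + 1))"
      using \<open>\<And>t. m \<le> t \<Longrightarrow> t \<le> M \<Longrightarrow> ee (F t) = w t * (ee (F t) - ee (F (t + 1)))\<close>[of "k + 1"] step by (simp add: algebra_simps)
    also have "(\<Sum>t\<in>{m..k}. ee (F t)) + w (k + 1) * ee (F (k + 1)) = ((\<Sum>t\<in>{m..k}. ee (F t)) + w k * ee (F (k + 1))) + (w (k + 1) - w k) * ee (F (k + 1))"
      by (simp add: algebra_simps)
    also have "norm \<dots> \<le> (norm (w m) + (c m - c k)) + norm (w (k + 1) - w k)"
    proof (rule order_trans[OF norm_triangle_ineq], rule add_mono)
      show "norm ((\<Sum>t\<in>{m..k}. ee (F t)) + w k * ee (F (k + 1))) \<le> norm (w m) + (c m - c k)"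
        using step by simp
      show "norm ((w (k + 1) - w k) * ee (F (k + 1))) \<le> norm (w (k + 1) - w k)" by (simp add: norm_mult)
    qed
    also have "norm (w (k + 1) - w k) = c k - c (k + 1)"
    proof -
      have "w (k + 1) - w k = Complex 0 (c (k + 1) - c k)" by (simp add: w_def complex_eq_iff)
      then show ?thesis using cm[of k] step by (simp add: cmod_def)
    qed
    finally show ?case by simp
  qed
  have cw: "\<bar>c t\<bar> \<le> norm (w t)" for t using abs_Im_le_cmod[of "w t"] by (simp add: w_def)
  have "norm (\<Sum>t\<in>{m..M}. ee (F t)) \<le> norm ((\<Sum>t\<in>{m..M}. ee (F t)) + w M * ee (F (M + 1))) + norm (w M * ee (F (M + 1)))"
    using norm_triangle_ineq4[of "(\<Sum>t\<in>{m..M}. ee (F t)) + w M * ee (F (M + 1))" "w M * ee (F (M + 1))"] by simp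
  also have "\<dots> \<le> (norm (w m) + (c m - c M)) + norm (w M)"
    using main[of M] mM by (simp add: norm_mult)
  \<comment> \<open>Four quantities of size at most 1 / (4 \<theta>): the norms of \<open>w\<close>
    at both ends and the end values of \<open>c\<close> left by telescoping.\<close>
  also have "\<dots> \<le> 1 / (4 * \<theta>) + 1 / (4 * \<theta>) + 1 / (4 * \<theta>) + 1 / (4 * \<theta>)"
    using cw[of m] cw[of M] nw[of m] nw[of M] mM by linarith
  also have "\<dots> = 1 / \<theta>" by simp
  finally show ?thesis .
qed

section \<open>Van der Corput's test for second differences\<close>

lemma convex_int_set:
  fixes A :: "int set"
  assumes "finite A" "A \<noteq> {}" and "\<And>x y z. x \<in> A \<Longrightarrow> y \<in> A \<Longrightarrow> x \<le> z \<Longrightarrow> z \<le> y \<Longrightarrow> z \<in> A"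
  shows "A = {Min A..Max A}"
proof
  show "A \<subseteq> {Min A..Max A}" using assms(1) by auto
  show "{Min A..Max A} \<subseteq> A"
    using assms(3)[OF Min_in[OF assms(1,2)] Max_in[OF assms(1,2)]] by auto
qed

lemma gap_growth:
  fixes g :: "int \<Rightarrow> real"
  assumes "\<And>t. a \<le> t \<Longrightarrow> t < b \<Longrightarrow> g t + \<rho> \<le> g (t + 1)" and "a \<le> b"
  shows "g a + \<rho> * (b - a) \<le> g b"
  using assms(2,1)
proof (induction b rule: int_ge_induct)
  case base then show ?case by simp
next
  case (step b)
  then have "g a + \<rho> * (b - a) \<le> g b" "g b + \<rho> \<le> g (b + 1)" by auto
  then show ?case by (simp add: algebra_simps)
qed

lemma gap_mono:
  fixes g :: "int \<Rightarrow> real"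
  assumes "\<rho> > 0" "\<And>t. m \<le> t \<Longrightarrow> t < M \<Longrightarrow> g t + \<rho> \<le> g (t + 1)"
    and "m \<le> a" "a \<le> b" "b \<le> M"
  shows "g a \<le> g b"
proof -
  have "g a + \<rho> * (b - a) \<le> g b" using assms by (intro gap_growth) auto
  moreover have "\<rho> * (b - a) \<ge> 0" using assms by simp
  ultimately show ?thesis by simp
qed

lemma card_gap_window:
  fixes g :: "int \<Rightarrow> real"
  assumes \<rho>: "\<rho> > 0" and gap: "\<And>t. m \<le> t \<Longrightarrow> t < M \<Longrightarrow> g t + \<rho> \<le> g (t + 1)"
    and A: "A \<subseteq> {m..M}" and win: "\<And>t. t \<in> A \<Longrightarrow> \<alpha> \<le> g t \<and> g t \<le> \<alpha> + d" and d: "d \<ge> 0"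
  shows "real (card A) \<le> d / \<rho> + 1"
proof (cases "A = {}")
  case True then show ?thesis using \<rho> d by simp
next
  case False
  have fin: "finite A" using A finite_subset by blast
  let ?a = "Min A" and ?b = "Max A"
  have in_A: "?a \<in> A" "?b \<in> A" using fin False by auto
  then have "?a \<le> ?b" "m \<le> ?a" "?b \<le> M" using A fin by auto
  then have "g ?a + \<rho> * (?b - ?a) \<le> g ?b" using gap by (intro gap_growth) auto
  then have "\<rho> * (?b - ?a) \<le> d" using win[OF in_A(1)] win[OF in_A(2)] by linarith
  then have *: "real_of_int (?b - ?a) \<le> d / \<rho>" using \<rho> by (simp add: pos_le_divide_eq mult.commute)
  have "A \<subseteq> {?a..?b}" using fin by auto
  then have "card A \<le> card {?a..?b}" by (intro card_mono) auto
  also have "\<dots> = nat (?b - ?a + 1)" by simp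
  finally have "real (card A) \<le> real_of_int (?b - ?a + 1)" using \<open>?a \<le> ?b\<close> by linarith
  then show ?thesis using * by simp
qed

lemma norm_sum_ee_le_card: "norm (\<Sum>t\<in>A. ee (F t)) \<le> real (card A)"
  by (rule order_trans[OF norm_sum]) simp

text \<open>The increments \<open>g t\<close> are grouped by integer part, into at most V + 2
  groups. Within a group, increments close to an integer are few because they grow by at least
  \<rho> at each step; the others belong to an interval of t, to which Kusmin-Landau
  applies.\<close>

lemma second_difference_test:
  fixes F :: "int \<Rightarrow> real"
  assumes \<rho>: "\<rho> > 0" and V: "V \<ge> 0"
    and gap: "\<And>t. m \<le> t \<Longrightarrow> t < M \<Longrightarrow> (F (t + 1) - F t) + \<rho> \<le> F (t + 2) - F (t + 1)"
    and range: "\<And>t. m \<le> t \<Longrightarrow> t \<le> M \<Longrightarrow> \<alpha> \<le> F (t + 1) - F t \<and> F (t + 1) - F t \<le> \<alpha> + V"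
  shows "norm (\<Sum>t\<in>{m..M}. ee (F t)) \<le> (V + 2) * (3 / sqrt \<rho> + 2)"
proof -
  define g where "g t = F (t + 1) - F t" for t
  have gap': "g t + \<rho> \<le> g (t + 1)" if "m \<le> t" "t < M" for t using gap[OF that] by (simp add: g_def add.assoc)
  \<comment> \<open>This choice balances the number \<Delta> / \<rho> of points near an integer
    against the Kusmin-Landau bound 1 / \<Delta>.\<close>
  define \<Delta> where "\<Delta> = sqrt \<rho>"
  have \<Delta>: "\<Delta> > 0" "\<Delta> * \<Delta> = \<rho>" using \<rho> by (auto simp: \<Delta>_def)
  have fibre: "norm (\<Sum>t\<in>{t\<in>{m..M}. \<lfloor>g t\<rfloor> = \<nu>}. ee (F t)) \<le> 3 / \<Delta> + 2" for \<nu>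
  proof -
    define A where "A = {t\<in>{m..M}. \<lfloor>g t\<rfloor> = \<nu>}"
    define A1 where "A1 = {t\<in>A. g t < \<nu> + \<Delta>}"
    \<comment> \<open>The first condition keeps \<open>A3\<close> disjoint from \<open>A1\<close>
      even if \<Delta> > 1/2, in which case \<open>A2\<close> is empty.\<close>
    define A3 where "A3 = {t\<in>A. g t \<ge> \<nu> + \<Delta> \<and> g t > \<nu> + 1 - \<Delta>}"
    define A2 where "A2 = {t\<in>A. g t \<ge> \<nu> + \<Delta> \<and> g t \<le> \<nu> + 1 - \<Delta>}"
    have "finite A" unfolding A_def by (rule finite_subset[of _ "{m..M}"]) auto
    then have fin: "finite A1" "finite A2" "finite A3" by (auto simp: A1_def A2_def A3_def)
    have sub_A: "A \<subseteq> {m..M}" by (auto simp: A_def)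
    have fl: "real_of_int \<nu> \<le> g t \<and> g t < real_of_int \<nu> + 1" if "t \<in> A" for t
    proof -
      have "\<lfloor>g t\<rfloor> = \<nu>" using that by (simp add: A_def)
      then show ?thesis by (simp add: floor_eq_iff)
    qed
    have "real (card A1) \<le> \<Delta> / \<rho> + 1"
    proof (rule card_gap_window[where g = g and m = m and M = M, OF \<rho> gap', where \<alpha> = \<nu> and A = A1 and d = \<Delta>])
      show "A1 \<subseteq> {m..M}" using sub_A by (auto simp: A1_def)
      show "\<nu> \<le> g t \<and> g t \<le> \<nu> + \<Delta>" if "t \<in> A1" for t using fl[of t] that by (simp add: A1_def)
    qed (use \<Delta> in auto)
    moreover have "\<Delta> / \<rho> = 1 / \<Delta>" unfolding \<Delta>(2)[symmetric] using \<Delta>(1) by simp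
    moreover have "real (card A3) \<le> \<Delta> / \<rho> + 1"
    proof (rule card_gap_window[where g = g and m = m and M = M, OF \<rho> gap', where \<alpha> = "\<nu> + 1 - \<Delta>" and A = A3 and d = \<Delta>])
      show "A3 \<subseteq> {m..M}" using sub_A by (auto simp: A3_def)
      show "\<nu> + 1 - \<Delta> \<le> g t \<and> g t \<le> \<nu> + 1 - \<Delta> + \<Delta>" if "t \<in> A3" for t using fl[of t] that by (simp add: A3_def)
    qed (use \<Delta> in auto)
    moreover have "norm (\<Sum>t\<in>A2. ee (F t)) \<le> 1 / \<Delta>"
    proof (cases "A2 = {}")
      case True then show ?thesis using \<Delta> by simp
    next
      case False
      have conv: "A2 = {Min A2..Max A2}"
      proof (rule convex_int_set[OF fin(2) False])
        fix x y z assume xyz: "x \<in> A2" "y \<in> A2" "x \<le> z" "z \<le> y"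
        then have mM: "m \<le> x" "y \<le> M" by (auto simp: A2_def A_def)
        have "g x \<le> g z" "g z \<le> g y" using gap_mono[where g = g and m = m and M = M, OF \<rho> gap', of x z] gap_mono[where g = g and m = m and M = M, OF \<rho> gap', of z y] xyz mM by simp_all
        moreover have "\<nu> + \<Delta> \<le> g x" "g y \<le> \<nu> + 1 - \<Delta>" using xyz by (auto simp: A2_def)
        ultimately have "\<nu> + \<Delta> \<le> g z" "g z \<le> \<nu> + 1 - \<Delta>" by auto
        moreover from this have "\<lfloor>g z\<rfloor> = \<nu>" using \<Delta> by (simp add: floor_eq_iff)
        ultimately show "z \<in> A2" using mM xyz by (simp add: A2_def A_def)
      qed
      have sub: "m \<le> Min A2" "Max A2 \<le> M" using Min_in[OF fin(2) False] Max_in[OF fin(2) False] by (auto simp: A2_def A_def)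
      have "norm (\<Sum>t\<in>{Min A2..Max A2}. ee (F t)) \<le> 1 / \<Delta>"
      proof (rule kusmin_landau[where \<nu> = \<nu>])
        show "Min A2 \<le> Max A2" using fin(2) False by simp
        fix t
        show "F (t + 1) - F t \<le> F (t + 2) - F (t + 1)" if "Min A2 \<le> t" "t < Max A2"
          using gap[of t] that sub \<rho> by linarith
        show "\<nu> + \<Delta> \<le> F (t + 1) - F t \<and> F (t + 1) - F t \<le> \<nu> + 1 - \<Delta>" if "Min A2 \<le> t" "t \<le> Max A2"
        proof -
          have "t \<in> A2" using that conv by (metis atLeastAtMost_iff)
          then show ?thesis by (simp add: A2_def g_def)
        qed
      qed (rule \<Delta>)
      then show ?thesis by (simp only: conv[symmetric])
    qed
    moreover have "(\<Sum>t\<in>A. ee (F t)) = (\<Sum>t\<in>A1. ee (F t)) + (\<Sum>t\<in>A2. ee (F t)) + (\<Sum>t\<in>A3. ee (F t))"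
    proof -
      have "A = A1 \<union> A2 \<union> A3" by (auto simp: A1_def A2_def A3_def)
      moreover have "(A1 \<union> A2) \<inter> A3 = {}" "A1 \<inter> A2 = {}" by (auto simp: A1_def A2_def A3_def)
      ultimately show ?thesis using fin by (simp add: sum.union_disjoint)
    qed
    ultimately have "norm (\<Sum>t\<in>A. ee (F t)) \<le> 1 / \<Delta> + 1 + 1 / \<Delta> + (1 / \<Delta> + 1)"
      using norm_triangle_ineq[of "(\<Sum>t\<in>A1. ee (F t)) + (\<Sum>t\<in>A2. ee (F t))" "\<Sum>t\<in>A3. ee (F t)"]
        norm_triangle_ineq[of "\<Sum>t\<in>A1. ee (F t)" "\<Sum>t\<in>A2. ee (F t)"]
        norm_sum_ee_le_card[of F A1] norm_sum_ee_le_card[of F A3] by simp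
    then show ?thesis by (simp add: A_def)
  qed
  have "(\<Sum>t\<in>{m..M}. ee (F t)) = (\<Sum>\<nu>\<in>(\<lambda>t. \<lfloor>g t\<rfloor>) ` {m..M}. \<Sum>t\<in>{t\<in>{m..M}. \<lfloor>g t\<rfloor> = \<nu>}. ee (F t))"
    by (rule sum.image_gen) simp
  also have "norm \<dots> \<le> (\<Sum>\<nu>\<in>(\<lambda>t. \<lfloor>g t\<rfloor>) ` {m..M}. 3 / \<Delta> + 2)"
    by (intro sum_norm_le fibre)
  also have "\<dots> = real (card ((\<lambda>t. \<lfloor>g t\<rfloor>) ` {m..M})) * (3 / \<Delta> + 2)" by simp
  also have "\<dots> \<le> (V + 2) * (3 / \<Delta> + 2)"
  proof (rule mult_right_mono)
    have "(\<lambda>t. \<lfloor>g t\<rfloor>) ` {m..M} \<subseteq> {\<lfloor>\<alpha>\<rfloor>..\<lfloor>\<alpha> + V\<rfloor>}"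
      using range by (auto simp: g_def intro!: floor_mono)
    then have "card ((\<lambda>t. \<lfloor>g t\<rfloor>) ` {m..M}) \<le> card {\<lfloor>\<alpha>\<rfloor>..\<lfloor>\<alpha> + V\<rfloor>}" by (intro card_mono) auto
    also have "\<dots> = nat (\<lfloor>\<alpha> + V\<rfloor> - \<lfloor>\<alpha>\<rfloor> + 1)" by simp
    finally have "real (card ((\<lambda>t. \<lfloor>g t\<rfloor>) ` {m..M})) \<le> real (nat (\<lfloor>\<alpha> + V\<rfloor> - \<lfloor>\<alpha>\<rfloor> + 1))" by simp
    also have "\<dots> = real_of_int (\<lfloor>\<alpha> + V\<rfloor> - \<lfloor>\<alpha>\<rfloor> + 1)"
      using floor_mono[of \<alpha> "\<alpha> + V"] V by simp
    also have "\<dots> \<le> V + 2" by linarith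
    finally show "real (card ((\<lambda>t. \<lfloor>g t\<rfloor>) ` {m..M})) \<le> V + 2" .
    show "0 \<le> 3 / \<Delta> + 2" using \<Delta> by simp
  qed
  finally show ?thesis by (simp add: \<Delta>_def)
qed

section \<open>Power phases\<close>

text \<open>The mean value theorem, applied once for the range of the increments and twice for their
  growth, reduces this to the difference test. That test looks one point past its last summand, so
  it is used on {m..M - 1} and the term at M is the final 1. A negative second derivative is handled
  by conjugation.\<close>

lemma second_derivative_test:
  fixes F F1 F2 :: "real \<Rightarrow> real" and m M :: int
  assumes \<rho>: "\<rho> > 0" and V: "V \<ge> 0"
    and F1: "\<And>s. real_of_int m \<le> s \<Longrightarrow> s \<le> real_of_int M \<Longrightarrow> (F has_real_derivative F1 s) (at s)"
    and F2: "\<And>s. real_of_int m \<le> s \<Longrightarrow> s \<le> real_of_int M \<Longrightarrow> (F1 has_real_derivative F2 s) (at s)"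
    and F1_le: "\<And>s. real_of_int m \<le> s \<Longrightarrow> s \<le> real_of_int M \<Longrightarrow> \<bar>F1 s\<bar> \<le> V"
    and sgn: "(\<forall>s. real_of_int m \<le> s \<longrightarrow> s \<le> real_of_int M \<longrightarrow> \<rho> \<le> F2 s) \<or> (\<forall>s. real_of_int m \<le> s \<longrightarrow> s \<le> real_of_int M \<longrightarrow> F2 s \<le> - \<rho>)"
  shows "norm (\<Sum>t\<in>{m..M}. ee (F t)) \<le> (2 * V + 2) * (3 / sqrt \<rho> + 2) + 1"
proof (cases "m \<le> M")
  case False
  then show ?thesis using \<rho> V by simp
next
  case mM: True
  have pos: "norm (\<Sum>t\<in>{m..M - 1}. ee (F t)) \<le> (2 * V + 2) * (3 / sqrt \<rho> + 2)"
    if F1: "\<And>s. real_of_int m \<le> s \<Longrightarrow> s \<le> real_of_int M \<Longrightarrow> (F has_real_derivative F1 s) (at s)"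
    and F2: "\<And>s. real_of_int m \<le> s \<Longrightarrow> s \<le> real_of_int M \<Longrightarrow> (F1 has_real_derivative F2 s) (at s)"
    and F1_le: "\<And>s. real_of_int m \<le> s \<Longrightarrow> s \<le> real_of_int M \<Longrightarrow> \<bar>F1 s\<bar> \<le> V"
    and F2_ge: "\<And>s. real_of_int m \<le> s \<Longrightarrow> s \<le> real_of_int M \<Longrightarrow> \<rho> \<le> F2 s" for F F1 F2 :: "real \<Rightarrow> real"
  proof -
    have F1_gap: "F1 s + \<rho> \<le> F1 (s + 1)" if "real_of_int m \<le> s" "s + 1 \<le> real_of_int M" for s
    proof -
      have "\<exists>z>s. z < s + 1 \<and> F1 (s + 1) - F1 s = (s + 1 - s) * F2 z"
        using that by (intro MVT2 F2) auto
      then obtain z where "s < z" "z < s + 1" "F1 (s + 1) - F1 s = F2 z" by auto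
      then show ?thesis using F2_ge[of z] that by simp
    qed
    show ?thesis
    proof (rule second_difference_test[OF \<rho>, where \<alpha> = "- V"])
      show "0 \<le> 2 * V" using V by simp
      fix t
      show "F (real_of_int (t + 1)) - F t + \<rho> \<le> F (real_of_int (t + 2)) - F (real_of_int (t + 1))"
        if t: "m \<le> t" "t < M - 1"
      proof -
        have "\<exists>z>real_of_int t. z < real_of_int t + 1 \<and>
            (F (real_of_int t + 1 + 1) - F (real_of_int t + 1)) - (F (real_of_int t + 1) - F (real_of_int t))
             = (real_of_int t + 1 - real_of_int t) * (F1 (z + 1) - F1 z)"
          using t by (intro MVT2[of _ _ "\<lambda>s. F (s + 1) - F s" "\<lambda>s. F1 (s + 1) - F1 s"])
            (auto intro!: derivative_eq_intros DERIV_chain2[OF F1] F1)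
        then obtain z where z: "real_of_int t < z" "z < real_of_int t + 1" 
           "(F (real_of_int t + 1 + 1) - F (real_of_int t + 1)) - (F (real_of_int t + 1) - F (real_of_int t)) = F1 (z + 1) - F1 z" by auto
        have "z + 1 \<le> M" "m \<le> z" using z t by linarith+
        then have "\<rho> \<le> F1 (z + 1) - F1 z" using F1_gap[of z] by linarith
        moreover have "real_of_int t + 1 + 1 = real_of_int (t + 2)" "real_of_int t + 1 = real_of_int (t + 1)" by simp_all
        ultimately show ?thesis using z(3) by (simp only:)
      qed
      show "- V \<le> F (real_of_int (t + 1)) - F t \<and> F (real_of_int (t + 1)) - F t \<le> - V + 2 * V"
        if t: "m \<le> t" "t \<le> M - 1"
      proof -
        have "\<exists>z>real_of_int t. z < real_of_int (t + 1) \<and> F (real_of_int (t + 1)) - F t = (real_of_int (t + 1) - real_of_int t) * F1 z"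
          using t by (intro MVT2 F1) linarith+
        then obtain z where z: "real_of_int t < z" "z < real_of_int (t + 1)" "F (real_of_int (t + 1)) - F t = F1 z" by auto
        then have "\<bar>F1 z\<bar> \<le> V" using t by (intro F1_le) linarith+
        then show ?thesis using z(3) by linarith
      qed
    qed
  qed
  have "norm (\<Sum>t\<in>{m..M - 1}. ee (F t)) \<le> (2 * V + 2) * (3 / sqrt \<rho> + 2)"
    using sgn
  proof
    assume "\<forall>s. real_of_int m \<le> s \<longrightarrow> s \<le> real_of_int M \<longrightarrow> \<rho> \<le> F2 s"
    then show ?thesis by (intro pos[OF F1 F2 F1_le]) auto
  next
    assume neg: "\<forall>s. real_of_int m \<le> s \<longrightarrow> s \<le> real_of_int M \<longrightarrow> F2 s \<le> - \<rho>"
    have "norm (\<Sum>t\<in>{m..M - 1}. ee (- F t)) \<le> (2 * V + 2) * (3 / sqrt \<rho> + 2)"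
    proof (rule pos[of "\<lambda>s. - F s" "\<lambda>s. - F1 s" "\<lambda>s. - F2 s"])
      fix s assume s: "real_of_int m \<le> s" "s \<le> real_of_int M"
      show "((\<lambda>s. - F s) has_real_derivative - F1 s) (at s)" using F1[OF s] by (rule DERIV_minus)
      show "((\<lambda>s. - F1 s) has_real_derivative - F2 s) (at s)" using F2[OF s] by (rule DERIV_minus)
      show "\<bar>- F1 s\<bar> \<le> V" using F1_le[OF s] by simp
      show "\<rho> \<le> - F2 s" using neg s by fastforce
    qed
    moreover have "(\<Sum>t\<in>{m..M - 1}. ee (- F t)) = cnj (\<Sum>t\<in>{m..M - 1}. ee (F t))" by (simp add: ee_minus)
    ultimately show ?thesis by (metis complex_mod_cnj)
  qed
  moreover have "{m..M} = insert M {m..M - 1}" using mM by auto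
  then have "(\<Sum>t\<in>{m..M}. ee (F t)) = ee (F M) + (\<Sum>t\<in>{m..M - 1}. ee (F t))" by simp
  ultimately show ?thesis
    using norm_triangle_ineq[of "ee (F M)" "\<Sum>t\<in>{m..M - 1}. ee (F t)"] by simp
qed

locale exponent =
  fixes c :: real
  assumes c1: "1 < c" and c2: "c < 2"
begin

text \<open>This is the exponent of the TT* correlation of modulations \<mu> and \<mu>' at two
  points differing by \<open>h\<close>. \<open>phase1\<close> and \<open>phase2\<close> are its
  first two derivatives, and \<open>phase_ratio\<close> is \<open>phase2\<close> divided by c (c -
  1) t^(c - 2).\<close>

definition phase :: "real \<Rightarrow> real \<Rightarrow> real \<Rightarrow> real \<Rightarrow> real" where
  "phase \<mu> \<mu>' h t = \<mu> * (t + h) powr c - \<mu>' * t powr c"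
definition phase1 :: "real \<Rightarrow> real \<Rightarrow> real \<Rightarrow> real \<Rightarrow> real" where
  "phase1 \<mu> \<mu>' h t = c * (\<mu> * (t + h) powr (c - 1) - \<mu>' * t powr (c - 1))"
definition phase2 :: "real \<Rightarrow> real \<Rightarrow> real \<Rightarrow> real \<Rightarrow> real" where
  "phase2 \<mu> \<mu>' h t = c * (c - 1) * (\<mu> * (t + h) powr (c - 2) - \<mu>' * t powr (c - 2))"
definition phase_ratio :: "real \<Rightarrow> real \<Rightarrow> real \<Rightarrow> real \<Rightarrow> real" where
  "phase_ratio \<mu> \<mu>' h t = \<mu> * ((t + h) / t) powr (c - 2) - \<mu>'"

lemma phase_deriv:
  assumes "t > 0" "t + h > 0"
  shows "(phase \<mu> \<mu>' h has_real_derivative phase1 \<mu> \<mu>' h t) (at t)"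
    and "(phase1 \<mu> \<mu>' h has_real_derivative phase2 \<mu> \<mu>' h t) (at t)"
proof -
  have d: "((\<lambda>t. (t + h) powr a) has_real_derivative a * (t + h) powr (a - 1)) (at t)" for a
    using assms by (auto intro!: derivative_eq_intros)
  have d': "((\<lambda>t. t powr a) has_real_derivative a * t powr (a - 1)) (at t)" for a
    using assms by (auto intro!: derivative_eq_intros)
  have e: "c - 1 - 1 = c - 2" by simp
  show "(phase \<mu> \<mu>' h has_real_derivative phase1 \<mu> \<mu>' h t) (at t)"
    unfolding phase_def phase1_def
    using DERIV_diff[OF DERIV_cmult[OF d[of c], of \<mu>] DERIV_cmult[OF d'[of c], of \<mu>']]
    by (simp add: algebra_simps)
  show "(phase1 \<mu> \<mu>' h has_real_derivative phase2 \<mu> \<mu>' h t) (at t)"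
    unfolding phase1_def phase2_def
    using DERIV_cmult[OF DERIV_diff[OF DERIV_cmult[OF d[of "c - 1"], of \<mu>] DERIV_cmult[OF d'[of "c - 1"], of \<mu>']], of c]
    by (simp add: algebra_simps)
qed

lemma phase2_gph:
  assumes "t > 0" "t + h > 0"
  shows "phase2 \<mu> \<mu>' h t = c * (c - 1) * t powr (c - 2) * phase_ratio \<mu> \<mu>' h t"
  using assms by (simp add: phase2_def phase_ratio_def powr_divide field_simps)

lemma phase_ratio_deriv:
  assumes "t > 0" "t + h > 0"
  shows "(phase_ratio \<mu> \<mu>' h has_real_derivative \<mu> * h * (2 - c) * (((t + h) / t) powr (c - 3) / t\<^sup>2)) (at t)"
proof -
  have "((\<lambda>t. (t + h) / t) has_real_derivative - h / t\<^sup>2) (at t)"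
    using assms by (auto intro!: derivative_eq_intros simp: power2_eq_square field_simps)
  moreover have "((\<lambda>z. z powr (c - 2)) has_real_derivative (c - 2) * ((t + h) / t) powr (c - 2 - 1)) (at ((t + h) / t))"
    using assms by (intro has_real_derivative_powr) auto
  ultimately have "((\<lambda>t. ((t + h) / t) powr (c - 2)) has_real_derivative (c - 2) * ((t + h) / t) powr (c - 2 - 1) * (- h / t\<^sup>2)) (at t)"
    by (rule DERIV_chain2[rotated])
  from DERIV_diff[OF DERIV_cmult[OF this, of \<mu>] DERIV_const[of \<mu>']]
  have "((\<lambda>t. \<mu> * ((t + h) / t) powr (c - 2) - \<mu>') has_real_derivative \<mu> * ((c - 2) * ((t + h) / t) powr (c - 3) * (- h / t\<^sup>2))) (at t)"
    by simp
  moreover have "\<mu> * ((c - 2) * ((t + h) / t) powr (c - 3) * (- h / t\<^sup>2)) = \<mu> * h * (2 - c) * (((t + h) / t) powr (c - 3) / t\<^sup>2)"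
  proof -
    have "\<mu> * ((c - 2) * X * (- h / Y)) = \<mu> * h * (2 - c) * (X / Y)" for X Y :: real
      by (simp add: algebra_simps diff_divide_distrib)
    then show ?thesis .
  qed
  ultimately show ?thesis unfolding phase_ratio_def by simp
qed

text \<open>For h \<le> 0 the base is at most 1 and the exponent negative, so the power is at least
  1. For h > 0 the exponent is lowered to - 2, which replaces t^2 by (t + h)^2. Either way a square
  of size at most 4 N^2 remains in the denominator.\<close>

lemma phase_ratio_deriv_ge:
  assumes t: "t > 0" "t + h > 0" and N: "t \<le> 2 * N" "t + h \<le> 2 * N"
  shows "((t + h) / t) powr (c - 3) / t\<^sup>2 \<ge> 1 / (4 * N\<^sup>2)"
proof (cases "h \<le> 0")
  case True
  have "((t + h) / t) powr (c - 3) \<ge> ((t + h) / t) powr 0"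
    using t True c1 c2 by (intro powr_mono') (auto simp: divide_le_eq)
  then have "((t + h) / t) powr (c - 3) \<ge> 1" using t by simp
  then have "1 / t\<^sup>2 \<le> ((t + h) / t) powr (c - 3) / t\<^sup>2" by (intro divide_right_mono) auto
  moreover have "t\<^sup>2 \<le> (2 * N)\<^sup>2" using t N by (intro power_mono) auto
  then have "1 / (4 * N\<^sup>2) \<le> 1 / t\<^sup>2" using t N by (intro divide_left_mono mult_pos_pos) (auto simp: power_mult_distrib)
  ultimately show ?thesis by linarith
next
  case False
  have "((t + h) / t) powr (c - 3) \<ge> ((t + h) / t) powr (- 2)"
    using t False c1 c2 by (intro powr_mono) (auto simp: le_divide_eq)
  moreover have "((t + h) / t) powr (- 2) = t\<^sup>2 / (t + h)\<^sup>2"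
    using t by (simp add: powr_minus powr_numeral power_divide)
  ultimately have "t\<^sup>2 / (t + h)\<^sup>2 / t\<^sup>2 \<le> ((t + h) / t) powr (c - 3) / t\<^sup>2" by (intro divide_right_mono) auto
  moreover have "t\<^sup>2 / (t + h)\<^sup>2 / t\<^sup>2 = 1 / (t + h)\<^sup>2" using t by simp
  moreover have "(t + h)\<^sup>2 \<le> (2 * N)\<^sup>2" using t N by (intro power_mono) auto
  then have "1 / (4 * N\<^sup>2) \<le> 1 / (t + h)\<^sup>2" using t N by (intro divide_left_mono mult_pos_pos) (auto simp: power_mult_distrib)
  ultimately show ?thesis by linarith
qed

lemma powr_pred_le:
  assumes "0 < t" "t \<le> 2 * N" shows "t powr (c - 1) \<le> 2 * N powr (c - 1)"
proof -
  have "t powr (c - 1) \<le> (2 * N) powr (c - 1)" using assms c1 by (intro powr_mono2) auto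
  also have "\<dots> = 2 powr (c - 1) * N powr (c - 1)" using assms by (intro powr_mult)
  also have "\<dots> \<le> 2 powr 1 * N powr (c - 1)" using c2 by (intro mult_right_mono powr_mono) auto
  finally show ?thesis by simp
qed

lemma powr_pred2_ge:
  assumes "0 < t" "t \<le> 2 * N" shows "t powr (c - 2) \<ge> N powr (c - 2) / 2"
proof -
  have "(2 * N) powr (c - 2) \<le> t powr (c - 2)" using assms c2 by (intro powr_mono2') auto
  moreover have "(2 * N) powr (c - 2) = 2 powr (c - 2) * N powr (c - 2)" using assms by (intro powr_mult)
  moreover have "2 powr (- 1) * N powr (c - 2) \<le> 2 powr (c - 2) * N powr (c - 2)" using c1 by (intro mult_right_mono powr_mono) auto
  ultimately show ?thesis by (simp add: powr_minus)
qed

lemma phase1_le: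
  assumes "t > 0" "t + h > 0" "t \<le> 2 * N'" "t + h \<le> 2 * N"
  shows "\<bar>phase1 \<mu> \<mu>' h t\<bar> \<le> 4 * (\<bar>\<mu>\<bar> * N powr (c - 1) + \<bar>\<mu>'\<bar> * N' powr (c - 1))"
proof -
  have "\<bar>phase1 \<mu> \<mu>' h t\<bar> = c * \<bar>\<mu> * (t + h) powr (c - 1) - \<mu>' * t powr (c - 1)\<bar>"
    using c1 by (simp add: phase1_def abs_mult)
  also have "\<dots> \<le> 2 * (\<bar>\<mu>\<bar> * (2 * N powr (c - 1)) + \<bar>\<mu>'\<bar> * (2 * N' powr (c - 1)))"
  proof (rule mult_mono)
    have "\<bar>\<mu> * (t + h) powr (c - 1) - \<mu>' * t powr (c - 1)\<bar> \<le> \<bar>\<mu>\<bar> * (t + h) powr (c - 1) + \<bar>\<mu>'\<bar> * t powr (c - 1)"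
      by (rule order_trans[OF abs_triangle_ineq4]) (simp add: abs_mult)
    also have "\<dots> \<le> \<bar>\<mu>\<bar> * (2 * N powr (c - 1)) + \<bar>\<mu>'\<bar> * (2 * N' powr (c - 1))"
      using assms by (intro add_mono mult_left_mono powr_pred_le) auto
    finally show "\<bar>\<mu> * (t + h) powr (c - 1) - \<mu>' * t powr (c - 1)\<bar> \<le> \<bar>\<mu>\<bar> * (2 * N powr (c - 1)) + \<bar>\<mu>'\<bar> * (2 * N' powr (c - 1))" .
  qed (use c2 in auto)
  finally show ?thesis by (simp add: algebra_simps)
qed

text \<open>Away from the zero of \<open>phase_ratio\<close> the second derivative of the phase is large; the
  monotone function \<open>phase_ratio\<close> moves through \<open>(-\<sigma>, \<sigma>)\<close> quickly.\<close>

lemma exp_sum_near_pos: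
  fixes m M :: int
  assumes N: "0 < N" and h: "\<mu> * h > 0"
    and rng: "\<And>s. real_of_int m \<le> s \<Longrightarrow> s \<le> real_of_int M \<Longrightarrow> 0 < s \<and> s \<le> 2 * N \<and> 0 < s + h \<and> s + h \<le> 2 * N"
    and \<Lambda>: "\<bar>\<mu>\<bar> \<le> \<Lambda>" "\<bar>\<mu>'\<bar> \<le> \<Lambda>" and \<sigma>: "\<sigma> > 0"
  shows "norm (\<Sum>t\<in>{m..M}. ee (phase \<mu> \<mu>' h t)) \<le>
     2 * ((16 * \<Lambda> * N powr (c - 1) + 2) * (3 / sqrt ((c - 1) * \<sigma> * N powr (c - 2) / 2) + 2) + 1)
     + 8 * \<sigma> * N\<^sup>2 / ((2 - c) * (\<mu> * h)) + 1"
proof -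
  define g where "g = phase_ratio \<mu> \<mu>' h"
  define \<rho> where "\<rho> = (c - 1) * \<sigma> * N powr (c - 2) / 2"
  define V where "V = 8 * \<Lambda> * N powr (c - 1)"
  \<comment> \<open>A lower bound for the slope of \<open>phase_ratio\<close>; consecutive integers
    are separated by at least \<open>i\<close> in value, so at most 2 \<sigma> / i + 1 of them fall
    into (- \<sigma>, \<sigma>).\<close>
  define i where "i = (2 - c) * (\<mu> * h) / (4 * N\<^sup>2)"
  have \<rho>: "\<rho> > 0" using c1 \<sigma> N by (simp add: \<rho>_def)
  have V: "V \<ge> 0" using \<Lambda> by (simp add: V_def)
  have i: "i > 0" using c2 h N by (simp add: i_def)
  have g_inc: "g a + i * (b - a) \<le> g b" if "real_of_int m \<le> a" "a < b" "b \<le> real_of_int M" for a b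
  proof -
    have "\<exists>z>a. z < b \<and> g b - g a = (b - a) * (\<mu> * h * (2 - c) * (((z + h) / z) powr (c - 3) / z\<^sup>2))"
      unfolding g_def using that rng by (intro MVT2 phase_ratio_deriv) force+
    then obtain z where z: "a < z" "z < b" "g b - g a = (b - a) * (\<mu> * h * (2 - c) * (((z + h) / z) powr (c - 3) / z\<^sup>2))" by blast
    have "\<mu> * h * (2 - c) * (1 / (4 * N\<^sup>2)) \<le> \<mu> * h * (2 - c) * (((z + h) / z) powr (c - 3) / z\<^sup>2)"
      using rng[of z] z that h c2 by (intro mult_left_mono phase_ratio_deriv_ge) auto
    then have "i \<le> \<mu> * h * (2 - c) * (((z + h) / z) powr (c - 3) / z\<^sup>2)" by (simp add: i_def mult_ac)
    then have "(b - a) * i \<le> g b - g a" unfolding z(3) using that by (intro mult_left_mono) auto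
    then show ?thesis by (simp add: mult.commute)
  qed
  have g_mono: "g a \<le> g b" if "real_of_int m \<le> a" "a \<le> b" "b \<le> real_of_int M" for a b
  proof (cases "a = b")
    case False
    then have "g a + i * (b - a) \<le> g b" "i * (b - a) \<ge> 0" using that i by (auto intro: g_inc)
    then show ?thesis by linarith
  qed simp
  have piece: "norm (\<Sum>t\<in>{a..b}. ee (phase \<mu> \<mu>' h t)) \<le> (2 * V + 2) * (3 / sqrt \<rho> + 2) + 1"
    if ab: "m \<le> a" "a \<le> b" "b \<le> M" and s: "g a \<ge> \<sigma> \<or> g b \<le> - \<sigma>" for a b :: int
  proof (rule second_derivative_test[OF \<rho> V])
    have pr: "real_of_int m \<le> s \<and> s \<le> real_of_int M" if "real_of_int a \<le> s" "s \<le> real_of_int b" for s using that ab by linarith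
    fix s assume s: "real_of_int a \<le> s" "s \<le> real_of_int b"
    show "(phase \<mu> \<mu>' h has_real_derivative phase1 \<mu> \<mu>' h s) (at s)"
      "(phase1 \<mu> \<mu>' h has_real_derivative phase2 \<mu> \<mu>' h s) (at s)"
      using pr[OF s] rng by (auto intro!: phase_deriv)
    have "\<bar>phase1 \<mu> \<mu>' h s\<bar> \<le> 4 * (\<bar>\<mu>\<bar> * N powr (c - 1) + \<bar>\<mu>'\<bar> * N powr (c - 1))"
      using pr[OF s] rng by (intro phase1_le) auto
    also have "\<dots> \<le> 4 * (\<Lambda> * N powr (c - 1) + \<Lambda> * N powr (c - 1))"
      using \<Lambda> by (intro mult_left_mono add_mono mult_right_mono) auto
    finally show "\<bar>phase1 \<mu> \<mu>' h s\<bar> \<le> V" by (simp add: V_def)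
  next
    have pr: "real_of_int m \<le> s \<and> s \<le> real_of_int M" if "real_of_int a \<le> s" "s \<le> real_of_int b" for s using that ab by linarith
    have w: "\<rho> \<le> c * (c - 1) * s powr (c - 2) * \<sigma>" if "real_of_int a \<le> s" "s \<le> real_of_int b" for s
    proof -
      have "1 * (c - 1) * (N powr (c - 2) / 2) * \<sigma> \<le> c * (c - 1) * s powr (c - 2) * \<sigma>"
        using pr[OF that] rng[of s] c1 \<sigma> by (intro mult_mono powr_pred2_ge) auto
      then show ?thesis by (simp add: \<rho>_def mult_ac)
    qed
    have e: "phase2 \<mu> \<mu>' h s = c * (c - 1) * s powr (c - 2) * g s" if "real_of_int a \<le> s" "s \<le> real_of_int b" for s
      unfolding g_def using pr[OF that] rng[of s] by (intro phase2_gph) auto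
    have nn: "c * (c - 1) * s powr (c - 2) \<ge> 0" for s using c1 by simp
    from s show "(\<forall>s. real_of_int a \<le> s \<longrightarrow> s \<le> real_of_int b \<longrightarrow> \<rho> \<le> phase2 \<mu> \<mu>' h s) \<or> (\<forall>s. real_of_int a \<le> s \<longrightarrow> s \<le> real_of_int b \<longrightarrow> phase2 \<mu> \<mu>' h s \<le> - \<rho>)"
    proof
      assume ga: "\<sigma> \<le> g a"
      have "\<rho> \<le> phase2 \<mu> \<mu>' h s" if "real_of_int a \<le> s" "s \<le> real_of_int b" for s
      proof -
        have "\<sigma> \<le> g s" using ga g_mono[of a s] that ab pr[OF that] by linarith
        then have "c * (c - 1) * s powr (c - 2) * \<sigma> \<le> phase2 \<mu> \<mu>' h s" unfolding e[OF that] by (intro mult_left_mono nn)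
        then show ?thesis using w[OF that] by linarith
      qed
      then show ?thesis by blast
    next
      assume gb: "g b \<le> - \<sigma>"
      have "phase2 \<mu> \<mu>' h s \<le> - \<rho>" if "real_of_int a \<le> s" "s \<le> real_of_int b" for s
      proof -
        have "g s \<le> - \<sigma>" using gb g_mono[of s b] that ab pr[OF that] by linarith
        then have "phase2 \<mu> \<mu>' h s \<le> c * (c - 1) * s powr (c - 2) * (- \<sigma>)" unfolding e[OF that] by (intro mult_left_mono nn)
        then show ?thesis using w[OF that] by simp
      qed
      then show ?thesis by blast
    qed
  qed
  have piece0: "0 \<le> (2 * V + 2) * (3 / sqrt \<rho> + 2) + 1" using V \<rho> by simp
  define A1 where "A1 = {t\<in>{m..M}. g t \<ge> \<sigma>}"
  define A2 where "A2 = {t\<in>{m..M}. g t \<le> - \<sigma>}"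
  define A3 where "A3 = {t\<in>{m..M}. - \<sigma> < g t \<and> g t < \<sigma>}"
  have fin: "finite A1" "finite A2" "finite A3"
    unfolding A1_def A2_def A3_def by (auto intro: finite_subset[of _ "{m..M}"])
  have B1: "norm (\<Sum>t\<in>A1. ee (phase \<mu> \<mu>' h t)) \<le> (2 * V + 2) * (3 / sqrt \<rho> + 2) + 1"
  proof (cases "A1 = {}")
    case False
    have "A1 = {Min A1..Max A1}"
    proof (rule convex_int_set[OF fin(1) False])
      fix x y z assume "x \<in> A1" "y \<in> A1" "x \<le> z" "z \<le> y"
      then show "z \<in> A1" using g_mono[of x z] by (auto simp: A1_def)
    qed
    moreover have "norm (\<Sum>t\<in>{Min A1..Max A1}. ee (phase \<mu> \<mu>' h t)) \<le> (2 * V + 2) * (3 / sqrt \<rho> + 2) + 1"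
      using Min_in[OF fin(1) False] Max_in[OF fin(1) False] fin(1) by (intro piece) (auto simp: A1_def)
    ultimately show ?thesis by metis
  qed (use piece0 in simp)
  have B2: "norm (\<Sum>t\<in>A2. ee (phase \<mu> \<mu>' h t)) \<le> (2 * V + 2) * (3 / sqrt \<rho> + 2) + 1"
  proof (cases "A2 = {}")
    case False
    have "A2 = {Min A2..Max A2}"
    proof (rule convex_int_set[OF fin(2) False])
      fix x y z assume "x \<in> A2" "y \<in> A2" "x \<le> z" "z \<le> y"
      then show "z \<in> A2" using g_mono[of z y] by (auto simp: A2_def)
    qed
    moreover have "norm (\<Sum>t\<in>{Min A2..Max A2}. ee (phase \<mu> \<mu>' h t)) \<le> (2 * V + 2) * (3 / sqrt \<rho> + 2) + 1"
      using Min_in[OF fin(2) False] Max_in[OF fin(2) False] fin(2) by (intro piece) (auto simp: A2_def)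
    ultimately show ?thesis by metis
  qed (use piece0 in simp)
  have B3: "norm (\<Sum>t\<in>A3. ee (phase \<mu> \<mu>' h t)) \<le> 2 * \<sigma> / i + 1"
  proof (rule order_trans[OF norm_sum_ee_le_card])
    show "real (card A3) \<le> 2 * \<sigma> / i + 1"
    proof (rule card_gap_window[where g = "\<lambda>t. g (real_of_int t)" and m = m and M = M and \<alpha> = "- \<sigma>", OF i])
      show "g (real_of_int t) + i \<le> g (real_of_int (t + 1))" if "m \<le> t" "t < M" for t
        using g_inc[of t "t + 1"] that by simp
    qed (use \<sigma> in \<open>auto simp: A3_def\<close>)
  qed
  have "{m..M} = A1 \<union> A2 \<union> A3" by (auto simp: A1_def A2_def A3_def)
  moreover have "(A1 \<union> A2) \<inter> A3 = {}" "A1 \<inter> A2 = {}" using \<sigma> by (auto simp: A1_def A2_def A3_def)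
  ultimately have S: "(\<Sum>t\<in>{m..M}. ee (phase \<mu> \<mu>' h t)) = (\<Sum>t\<in>A1. ee (phase \<mu> \<mu>' h t)) + (\<Sum>t\<in>A2. ee (phase \<mu> \<mu>' h t)) + (\<Sum>t\<in>A3. ee (phase \<mu> \<mu>' h t))"
    using fin by (simp add: sum.union_disjoint)
  define E where "E = (2 * V + 2) * (3 / sqrt \<rho> + 2) + 1"
  have "norm (\<Sum>t\<in>{m..M}. ee (phase \<mu> \<mu>' h t)) \<le> 2 * E + 2 * \<sigma> / i + 1"
    unfolding S using B1[folded E_def] B2[folded E_def] B3 norm_triangle_ineq[of "(\<Sum>t\<in>A1. ee (phase \<mu> \<mu>' h t)) + (\<Sum>t\<in>A2. ee (phase \<mu> \<mu>' h t))" "\<Sum>t\<in>A3. ee (phase \<mu> \<mu>' h t)"]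
        norm_triangle_ineq[of "\<Sum>t\<in>A1. ee (phase \<mu> \<mu>' h t)" "\<Sum>t\<in>A2. ee (phase \<mu> \<mu>' h t)"] by linarith
  moreover have "2 * \<sigma> / i = 8 * \<sigma> * N\<^sup>2 / ((2 - c) * (\<mu> * h))" by (simp add: i_def)
  ultimately show ?thesis by (simp add: E_def \<rho>_def V_def mult.assoc)
qed

text \<open>Conjugation reverses \<mu> and \<mu>' together and so makes \<mu> h positive. Only the
  loss at the zero depends on how small |\<mu>| and |h| are, hence the lower bounds
  \<open>m0\<close> and \<open>H\<close> appear in that term alone.\<close>

lemma exp_sum_near:
  fixes m M :: int
  assumes N: "0 < N" and m0: "m0 > 0" "m0 \<le> \<bar>\<mu>\<bar>" and H: "H > 0" "H \<le> \<bar>h\<bar>"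
    and rng: "\<And>s. real_of_int m \<le> s \<Longrightarrow> s \<le> real_of_int M \<Longrightarrow> 0 < s \<and> s \<le> 2 * N \<and> 0 < s + h \<and> s + h \<le> 2 * N"
    and \<Lambda>: "\<bar>\<mu>\<bar> \<le> \<Lambda>" "\<bar>\<mu>'\<bar> \<le> \<Lambda>" and \<sigma>: "\<sigma> > 0"
  shows "norm (\<Sum>t\<in>{m..M}. ee (phase \<mu> \<mu>' h t)) \<le>
     2 * ((16 * \<Lambda> * N powr (c - 1) + 2) * (3 / sqrt ((c - 1) * \<sigma> * N powr (c - 2) / 2) + 2) + 1)
     + 8 * \<sigma> * N\<^sup>2 / ((2 - c) * (m0 * H)) + 1"
proof -
  have le: "8 * \<sigma> * N\<^sup>2 / ((2 - c) * (\<bar>\<mu>\<bar> * \<bar>h\<bar>)) \<le> 8 * \<sigma> * N\<^sup>2 / ((2 - c) * (m0 * H))"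
    using m0 H c2 \<sigma> by (intro divide_left_mono mult_left_mono mult_mono mult_pos_pos) auto
  have nz: "\<mu> * h \<noteq> 0" using m0 H by auto
  show ?thesis
  proof (cases "\<mu> * h > 0")
    case True
    then have "\<bar>\<mu>\<bar> * \<bar>h\<bar> = \<mu> * h" by (simp flip: abs_mult)
    then show ?thesis using exp_sum_near_pos[where m = m and M = M, OF N True rng \<Lambda> \<sigma>] le by simp
  next
    case False
    then have neg: "(- \<mu>) * h > 0" using nz unfolding mult_minus_left by linarith
    then have "\<bar>\<mu>\<bar> * \<bar>h\<bar> = (- \<mu>) * h" by (simp flip: abs_mult)
    moreover have "ee (phase (- \<mu>) (- \<mu>') h t) = cnj (ee (phase \<mu> \<mu>' h t))" for t
      by (simp add: phase_def flip: ee_minus)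
    then have "norm (\<Sum>t\<in>{m..M}. ee (phase (- \<mu>) (- \<mu>') h t)) = norm (\<Sum>t\<in>{m..M}. ee (phase \<mu> \<mu>' h t))"
      by (simp flip: cnj_sum)
    ultimately show ?thesis using exp_sum_near_pos[where m = m and M = M, OF N neg rng, of \<Lambda> "- \<mu>'" \<sigma>] \<Lambda> \<sigma> le by simp
  qed
qed

text \<open>Separated scales produce no zero: with |\<mu>| N^c and |\<mu>'| N'^c both of order Q and
  N \<ge> 4 N', the first term of the second derivative is at most half of the second. Hence neither
  a window \<sigma> nor a lower bound on |h| occurs.\<close>

lemma exp_sum_far:
  fixes m M :: int
  assumes N: "0 < N'" "4 * N' \<le> N" and Q: "Q > 0"
    and \<mu>: "\<bar>\<mu>\<bar> * N powr c \<le> 4 * Q" and \<mu>': "Q \<le> \<bar>\<mu>'\<bar> * N' powr c" "\<bar>\<mu>'\<bar> * N' powr c \<le> 4 * Q"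
    and rng: "\<And>s. real_of_int m \<le> s \<Longrightarrow> s \<le> real_of_int M \<Longrightarrow> N' \<le> s \<and> s \<le> 2 * N' \<and> N \<le> s + h \<and> s + h \<le> 2 * N"
  shows "norm (\<Sum>t\<in>{m..M}. ee (phase \<mu> \<mu>' h t)) \<le> (64 * Q / N' + 2) * (6 * N' / sqrt ((c - 1) * Q) + 2) + 1"
proof -
  define \<rho> where "\<rho> = (c - 1) * Q / (4 * N'\<^sup>2)"
  have N0: "N > 0" using N by simp
  have \<rho>: "\<rho> > 0" using c1 Q N by (simp add: \<rho>_def)
  have split1: "x powr (c - 1) = x powr c / x" and split2: "x powr (c - 2) = x powr c / x\<^sup>2" if "x > 0" for x :: real
    using that by (simp_all add: powr_diff powr_numeral)
  have w: "\<bar>\<mu> * (s + h) powr (c - 2)\<bar> \<le> Q / (4 * N'\<^sup>2) \<and> Q / (2 * N'\<^sup>2) \<le> \<bar>\<mu>' * s powr (c - 2)\<bar>"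
    if "real_of_int m \<le> s" "s \<le> real_of_int M" for s
  proof
    have r: "N' \<le> s" "s \<le> 2 * N'" "N \<le> s + h" using rng[OF that] by auto
    have "\<bar>\<mu> * (s + h) powr (c - 2)\<bar> \<le> \<bar>\<mu>\<bar> * N powr (c - 2)"
      unfolding abs_mult using N0 r c2 by (simp add: mult_left_mono powr_mono2')
    also have "\<dots> = \<bar>\<mu>\<bar> * N powr c / N\<^sup>2" using N0 by (simp add: split2)
    also have "\<dots> \<le> 4 * Q / (4 * N')\<^sup>2" using \<mu> N Q by (intro frac_le power_mono) auto
    finally show "\<bar>\<mu> * (s + h) powr (c - 2)\<bar> \<le> Q / (4 * N'\<^sup>2)" by (simp add: power_mult_distrib)
    have "Q / (2 * N'\<^sup>2) \<le> \<bar>\<mu>'\<bar> * N' powr c / N'\<^sup>2 / 2"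
      using divide_right_mono[OF \<mu>'(1), of "N'\<^sup>2"] by simp
    also have "\<dots> = \<bar>\<mu>'\<bar> * (N' powr (c - 2) / 2)" using N by (simp add: split2)
    also have "\<dots> \<le> \<bar>\<mu>'\<bar> * s powr (c - 2)" using r N by (intro mult_left_mono powr_pred2_ge) auto
    finally show "Q / (2 * N'\<^sup>2) \<le> \<bar>\<mu>' * s powr (c - 2)\<bar>" by (simp add: abs_mult)
  qed
  have "norm (\<Sum>t\<in>{m..M}. ee (phase \<mu> \<mu>' h t)) \<le> (2 * (32 * Q / N') + 2) * (3 / sqrt \<rho> + 2) + 1"
  proof (rule second_derivative_test[OF \<rho>])
    show "0 \<le> 32 * Q / N'" using N Q by simp
    fix s assume s: "real_of_int m \<le> s" "s \<le> real_of_int M"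
    have p: "s > 0" "s + h > 0" using rng[OF s] N by auto
    show "(phase \<mu> \<mu>' h has_real_derivative phase1 \<mu> \<mu>' h s) (at s)"
      "(phase1 \<mu> \<mu>' h has_real_derivative phase2 \<mu> \<mu>' h s) (at s)" by (rule phase_deriv[OF p])+
    have "\<bar>phase1 \<mu> \<mu>' h s\<bar> \<le> 4 * (\<bar>\<mu>\<bar> * N powr (c - 1) + \<bar>\<mu>'\<bar> * N' powr (c - 1))"
      using rng[OF s] p by (intro phase1_le) auto
    also have "\<dots> = 4 * (\<bar>\<mu>\<bar> * N powr c / N + \<bar>\<mu>'\<bar> * N' powr c / N')" using N N0 by (simp add: split1)
    also have "\<dots> \<le> 4 * (4 * Q / N' + 4 * Q / N')" using N Q \<mu> \<mu>' by (intro mult_left_mono add_mono frac_le) auto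
    finally show "\<bar>phase1 \<mu> \<mu>' h s\<bar> \<le> 32 * Q / N'" by simp
  next
    have cc: "\<rho> \<le> c * (c - 1) * (Q / (4 * N'\<^sup>2))"
    proof -
      have "1 * (c - 1) * (Q / (4 * N'\<^sup>2)) \<le> c * (c - 1) * (Q / (4 * N'\<^sup>2))"
        using c1 Q by (intro mult_right_mono) auto
      then show ?thesis by (simp add: \<rho>_def)
    qed
    have c0: "c * (c - 1) \<ge> 0" using c1 by simp
    have dbl: "Q / (2 * N'\<^sup>2) = Q / (4 * N'\<^sup>2) + Q / (4 * N'\<^sup>2)" by simp
    show "(\<forall>s. real_of_int m \<le> s \<longrightarrow> s \<le> real_of_int M \<longrightarrow> \<rho> \<le> phase2 \<mu> \<mu>' h s) \<or> (\<forall>s. real_of_int m \<le> s \<longrightarrow> s \<le> real_of_int M \<longrightarrow> phase2 \<mu> \<mu>' h s \<le> - \<rho>)"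
    proof (cases "\<mu>' \<ge> 0")
      case True
      have "phase2 \<mu> \<mu>' h s \<le> - \<rho>" if s: "real_of_int m \<le> s" "s \<le> real_of_int M" for s
      proof -
        have "\<bar>\<mu>' * s powr (c - 2)\<bar> = \<mu>' * s powr (c - 2)" using True by simp
        then have "\<mu> * (s + h) powr (c - 2) - \<mu>' * s powr (c - 2) \<le> - (Q / (4 * N'\<^sup>2))"
          using w[OF s] dbl by linarith
        then have "c * (c - 1) * (\<mu> * (s + h) powr (c - 2) - \<mu>' * s powr (c - 2)) \<le> c * (c - 1) * (- (Q / (4 * N'\<^sup>2)))"
          by (intro mult_left_mono c0)
        then show ?thesis using cc by (simp add: phase2_def)
      qed
      then show ?thesis by blast
    next
      case False
      have "\<rho> \<le> phase2 \<mu> \<mu>' h s" if s: "real_of_int m \<le> s" "s \<le> real_of_int M" for s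
      proof -
        have "\<bar>\<mu>' * s powr (c - 2)\<bar> = - (\<mu>' * s powr (c - 2))" using False by (simp add: mult_nonpos_nonneg)
        then have "Q / (4 * N'\<^sup>2) \<le> \<mu> * (s + h) powr (c - 2) - \<mu>' * s powr (c - 2)"
          using w[OF s] dbl by linarith
        then have "c * (c - 1) * (Q / (4 * N'\<^sup>2)) \<le> c * (c - 1) * (\<mu> * (s + h) powr (c - 2) - \<mu>' * s powr (c - 2))"
          by (intro mult_left_mono c0)
        then show ?thesis using cc by (simp add: phase2_def)
      qed
      then show ?thesis by blast
    qed
  qed
  also have "3 / sqrt \<rho> = 6 * N' / sqrt ((c - 1) * Q)"
    using N by (simp add: \<rho>_def real_sqrt_divide real_sqrt_mult)
  finally show ?thesis by simp
qed

text \<open>The degenerate phase with \<mu> = 0 and \<mu>' = - l, used for the distribution of n^c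
  modulo 1.\<close>

lemma exp_sum_single:
  fixes m M :: int and l :: real
  assumes N: "0 < N" and l: "1 \<le> \<bar>l\<bar>" "\<bar>l\<bar> \<le> \<Lambda>"
    and rng: "\<And>s. real_of_int m \<le> s \<Longrightarrow> s \<le> real_of_int M \<Longrightarrow> 0 < s \<and> s \<le> 2 * N"
  shows "norm (\<Sum>t\<in>{m..M}. ee (l * t powr c)) \<le> (8 * \<Lambda> * N powr (c - 1) + 2) * (3 / sqrt ((c - 1) * N powr (c - 2) / 2) + 2) + 1"
proof -
  define \<rho> where "\<rho> = (c - 1) * N powr (c - 2) / 2"
  have \<rho>: "\<rho> > 0" using c1 N by (simp add: \<rho>_def)
  have e: "l * t powr c = phase 0 (- l) 0 t" for t by (simp add: phase_def)
  have "norm (\<Sum>t\<in>{m..M}. ee (phase 0 (- l) 0 t)) \<le> (2 * (4 * \<Lambda> * N powr (c - 1)) + 2) * (3 / sqrt \<rho> + 2) + 1"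
  proof (rule second_derivative_test[OF \<rho>])
    show "0 \<le> 4 * \<Lambda> * N powr (c - 1)" using l by simp
    fix s assume s: "real_of_int m \<le> s" "s \<le> real_of_int M"
    show "(phase 0 (- l) 0 has_real_derivative phase1 0 (- l) 0 s) (at s)"
      "(phase1 0 (- l) 0 has_real_derivative phase2 0 (- l) 0 s) (at s)" using rng[OF s] by (auto intro!: phase_deriv)
    have "\<bar>phase1 0 (- l) 0 s\<bar> \<le> 4 * (\<bar>0\<bar> * N powr (c - 1) + \<bar>- l\<bar> * N powr (c - 1))"
      using rng[OF s] by (intro phase1_le) auto
    also have "\<dots> \<le> 4 * \<Lambda> * N powr (c - 1)" using l by (simp add: mult_right_mono)
    finally show "\<bar>phase1 0 (- l) 0 s\<bar> \<le> 4 * \<Lambda> * N powr (c - 1)" .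
  next
    have w: "\<rho> \<le> c * (c - 1) * (\<bar>l\<bar> * s powr (c - 2))" if "real_of_int m \<le> s" "s \<le> real_of_int M" for s
    proof -
      have "1 * (c - 1) * (1 * (N powr (c - 2) / 2)) \<le> c * (c - 1) * (\<bar>l\<bar> * s powr (c - 2))"
        using rng[OF that] c1 l by (intro mult_mono powr_pred2_ge) auto
      then show ?thesis by (simp add: \<rho>_def)
    qed
    show "(\<forall>s. real_of_int m \<le> s \<longrightarrow> s \<le> real_of_int M \<longrightarrow> \<rho> \<le> phase2 0 (- l) 0 s) \<or> (\<forall>s. real_of_int m \<le> s \<longrightarrow> s \<le> real_of_int M \<longrightarrow> phase2 0 (- l) 0 s \<le> - \<rho>)"
    proof (cases "l \<ge> 0")
      case True
      then show ?thesis using w by (simp add: phase2_def)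
    next
      case False
      have "phase2 0 (- l) 0 s \<le> - \<rho>" if "real_of_int m \<le> s" "s \<le> real_of_int M" for s
        using w[OF that] False by (simp add: phase2_def)
      then show ?thesis by blast
    qed
  qed
  then show ?thesis by (simp add: e \<rho>_def mult.assoc)
qed

end

section \<open>TT* for dyadic blocks\<close>

lemma abel_sum_bound:
  fixes w :: "int \<Rightarrow> real" and z :: "int \<Rightarrow> complex"
  assumes mM: "m \<le> M"
    and anti: "\<And>t. m \<le> t \<Longrightarrow> t < M \<Longrightarrow> w (t + 1) \<le> w t" and w0: "w M \<ge> 0"
    and B: "\<And>k. m \<le> k \<Longrightarrow> k \<le> M \<Longrightarrow> norm (\<Sum>t\<in>{m..k}. z t) \<le> B"
  shows "norm (\<Sum>t\<in>{m..M}. of_real (w t) * z t) \<le> w m * B"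
proof -
  define S where "S k = (\<Sum>t\<in>{m..k}. z t)" for k
  have main: "norm ((\<Sum>t\<in>{m..k}. of_real (w t) * z t) - of_real (w k) * S k) \<le> (w m - w k) * B"
    if "m \<le> k" "k \<le> M" for k
    using that
  proof (induction k rule: int_ge_induct)
    case base then show ?case by (simp add: S_def)
  next
    case (step k)
    have i: "{m..k + 1} = insert (k + 1) {m..k}" using step.hyps by auto
    then have "(\<Sum>t\<in>{m..k + 1}. of_real (w t) * z t) - of_real (w (k + 1)) * S (k + 1)
      = ((\<Sum>t\<in>{m..k}. of_real (w t) * z t) - of_real (w k) * S k) + of_real (w k - w (k + 1)) * S k"
      by (simp add: S_def i algebra_simps)
    also have "norm \<dots> \<le> (w m - w k) * B + (w k - w (k + 1)) * B"
    proof (rule order_trans[OF norm_triangle_ineq], rule add_mono)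
      show "norm ((\<Sum>t\<in>{m..k}. of_real (w t) * z t) - of_real (w k) * S k) \<le> (w m - w k) * B" using step by simp
      have "w (k + 1) \<le> w k" "norm (S k) \<le> B" using step anti[of k] B[of k] by (auto simp: S_def)
      then show "norm (of_real (w k - w (k + 1)) * S k) \<le> (w k - w (k + 1)) * B"
        unfolding norm_mult norm_of_real by (simp add: mult_left_mono)
    qed
    finally show ?case by (simp add: algebra_simps)
  qed
  have "norm (\<Sum>t\<in>{m..M}. of_real (w t) * z t) \<le> norm ((\<Sum>t\<in>{m..M}. of_real (w t) * z t) - of_real (w M) * S M) + norm (of_real (w M) * S M)"
    using norm_triangle_ineq[of "(\<Sum>t\<in>{m..M}. of_real (w t) * z t) - of_real (w M) * S M" "of_real (w M) * S M"] by simp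
  also have "\<dots> \<le> (w m - w M) * B + w M * B"
  proof (rule add_mono)
    have "norm (S M) \<le> B" using B[of M] mM by (simp add: S_def)
    then show "norm (of_real (w M) * S M) \<le> w M * B" unfolding norm_mult norm_of_real using w0 by (simp add: mult_left_mono)
  qed (use main[of M] mM in simp)
  finally show ?thesis by (simp add: algebra_simps)
qed

text \<open>Each of the four bilinear forms is at most 4 times the squared norm, whence 8 (a + b).
  Two families of radii leave room for one bound on the whole block and another near the
  diagonal.\<close>

lemma TT_avk:
  fixes K :: "int \<Rightarrow> int \<Rightarrow> complex"
  assumes X: "finite X" and ab: "a \<ge> 0" "b \<ge> 0"
    and L: "\<And>x y. x \<in> X \<Longrightarrow> y \<in> X \<Longrightarrow> norm (\<Sum>m\<in>S. K x m * cnj (K y m))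
      \<le> a * (avg_kernel (r x) (x - y) + avg_kernel (r y) (x - y)) + b * (avg_kernel (s x) (x - y) + avg_kernel (s y) (x - y))"
  shows "L2_set (\<lambda>x. norm (\<Sum>m\<in>S. K x m * f m)) X \<le> sqrt (8 * (a + b)) * L2_set (\<lambda>m. norm (f m)) S"
proof (rule TT_star)
  show "0 \<le> 8 * (a + b)" using ab by simp
  fix g :: "int \<Rightarrow> real" assume g: "\<And>x. 0 \<le> g x"
  let ?A = "\<lambda>r. \<Sum>x\<in>X. \<Sum>y\<in>X. avg_kernel (r x) (x - y) * g x * g y"
  let ?B = "\<lambda>r. \<Sum>x\<in>X. \<Sum>y\<in>X. avg_kernel (r y) (x - y) * g x * g y"
  have "(\<Sum>x\<in>X. \<Sum>y\<in>X. norm (\<Sum>m\<in>S. K x m * cnj (K y m)) * g x * g y)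
      \<le> (\<Sum>x\<in>X. \<Sum>y\<in>X. a * (avg_kernel (r x) (x - y) * g x * g y) + a * (avg_kernel (r y) (x - y) * g x * g y)
           + b * (avg_kernel (s x) (x - y) * g x * g y) + b * (avg_kernel (s y) (x - y) * g x * g y))"
  proof (intro sum_mono)
    fix x y assume "x \<in> X" "y \<in> X"
    then have "norm (\<Sum>m\<in>S. K x m * cnj (K y m)) * (g x * g y) \<le> 
      (a * (avg_kernel (r x) (x - y) + avg_kernel (r y) (x - y)) + b * (avg_kernel (s x) (x - y) + avg_kernel (s y) (x - y))) * (g x * g y)"
      using g by (intro mult_right_mono L) auto
    then show "norm (\<Sum>m\<in>S. K x m * cnj (K y m)) * g x * g y
      \<le> a * (avg_kernel (r x) (x - y) * g x * g y) + a * (avg_kernel (r y) (x - y) * g x * g y)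
           + b * (avg_kernel (s x) (x - y) * g x * g y) + b * (avg_kernel (s y) (x - y) * g x * g y)"
      by (simp add: algebra_simps)
  qed
  also have "\<dots> = a * ?A r + a * ?B r + b * ?A s + b * ?B s"
    by (simp add: sum.distrib sum_distrib_left)
  also have "\<dots> \<le> a * (4 * (\<Sum>x\<in>X. (g x)\<^sup>2)) + a * (4 * (\<Sum>x\<in>X. (g x)\<^sup>2)) + b * (4 * (\<Sum>x\<in>X. (g x)\<^sup>2)) + b * (4 * (\<Sum>x\<in>X. (g x)\<^sup>2))"
    using ab by (intro add_mono mult_left_mono maximal_bilinear[OF X g])
  finally show "(\<Sum>x\<in>X. \<Sum>y\<in>X. norm (\<Sum>m\<in>S. K x m * cnj (K y m)) * g x * g y) \<le> 8 * (a + b) * (\<Sum>x\<in>X. (g x)\<^sup>2)"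
    by (simp add: algebra_simps)
qed

section \<open>Correlations of dyadic blocks without integer part\<close>

context exponent
begin

definition block_kernel :: "nat \<Rightarrow> real \<Rightarrow> int \<Rightarrow> complex" where
  "block_kernel N \<mu> n = (if int N < n \<and> n \<le> 2 * int N then ee (\<mu> * real_of_int n powr c) / of_int n else 0)"

definition correlation :: "int set \<Rightarrow> nat \<Rightarrow> real \<Rightarrow> int \<Rightarrow> nat \<Rightarrow> real \<Rightarrow> int \<Rightarrow> complex" where
  "correlation S N \<mu> x N' \<mu>' y = (\<Sum>m\<in>S. block_kernel N \<mu> (x - m) * cnj (block_kernel N' \<mu>' (y - m)))"

lemma correlation_far: 
  assumes "N' \<le> N" "\<bar>x - y\<bar> > 2 * int N" shows "correlation S N \<mu> x N' \<mu>' y = 0"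
  unfolding correlation_def
proof (intro sum.neutral ballI)
  fix m
  have "\<not> (int N < x - m \<and> x - m \<le> 2 * int N \<and> int N' < y - m \<and> y - m \<le> 2 * int N')" using assms by linarith
  then have "block_kernel N \<mu> (x - m) = 0 \<or> block_kernel N' \<mu>' (y - m) = 0" unfolding block_kernel_def by presburger
  then show "block_kernel N \<mu> (x - m) * cnj (block_kernel N' \<mu>' (y - m)) = 0" by auto
qed

lemma correlation_commute: "norm (correlation S N \<mu> x N' \<mu>' y) = norm (correlation S N' \<mu>' y N \<mu> x)"
proof -
  have "correlation S N \<mu> x N' \<mu>' y = cnj (correlation S N' \<mu>' y N \<mu> x)" by (simp add: correlation_def mult.commute)
  then show ?thesis by simp
qed

text \<open>Substituting t = y - m turns the correlation into a sum over an interval with the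
  decreasing weight 1 / (t (t + h)), which partial summation removes. The hypothesis
  \<open>sum\<close> covers all intervals in range because every initial segment is used.\<close>

lemma correlation_bound:
  assumes S: "finite S" and N: "1 \<le> N" "1 \<le> N'" and B: "B \<ge> 0"
    and sub: "\<And>n. int N' < n \<Longrightarrow> n \<le> 2 * int N' \<Longrightarrow> y - n \<in> S"
    and sum: "\<And>m M. m \<le> M \<Longrightarrow> (\<And>s. real_of_int m \<le> s \<Longrightarrow> s \<le> real_of_int M \<Longrightarrow>
        real N' \<le> s \<and> s \<le> 2 * real N' \<and> real N \<le> s + real_of_int (x - y) \<and> s + real_of_int (x - y) \<le> 2 * real N) \<Longrightarrow>
      norm (\<Sum>t\<in>{m..M}. ee (phase \<mu> \<mu>' (real_of_int (x - y)) (real_of_int t))) \<le> B"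
  shows "norm (correlation S N \<mu> x N' \<mu>' y) \<le> B / (real N * real N')"
proof -
  define h where "h = x - y"
  define m where "m = max (int N' + 1) (int N + 1 - h)"
  define M where "M = min (2 * int N') (2 * int N - h)"
  define w where "w t = 1 / (real_of_int (t + h) * real_of_int t)" for t
  have rg: "int N' < t \<and> t \<le> 2 * int N' \<and> int N < t + h \<and> t + h \<le> 2 * int N" if "m \<le> t" "t \<le> M" for t
    using that by (auto simp: m_def M_def)
  have "correlation S N \<mu> x N' \<mu>' y = (\<Sum>k\<in>{y - M..y - m}. block_kernel N \<mu> (x - k) * cnj (block_kernel N' \<mu>' (y - k)))"
    unfolding correlation_def
  proof (rule sum.mono_neutral_right[OF S])
    show "{y - M..y - m} \<subseteq> S"
    proof
      fix k assume "k \<in> {y - M..y - m}"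
      then show "k \<in> S" using sub[of "y - k"] rg[of "y - k"] by auto
    qed
    show "\<forall>i\<in>S - {y - M..y - m}. block_kernel N \<mu> (x - i) * cnj (block_kernel N' \<mu>' (y - i)) = 0"
      by (auto simp: block_kernel_def m_def M_def h_def)
  qed
  also have "\<dots> = (\<Sum>t\<in>{m..M}. block_kernel N \<mu> (t + h) * cnj (block_kernel N' \<mu>' t))"
    by (rule sum.reindex_bij_witness[of _ "\<lambda>t. y - t" "\<lambda>k. y - k"]) (auto simp: h_def algebra_simps)
  also have "\<dots> = (\<Sum>t\<in>{m..M}. of_real (w t) * ee (phase \<mu> \<mu>' (real_of_int h) (real_of_int t)))"
  proof (intro sum.cong refl)
    fix t assume "t \<in> {m..M}"
    then have r: "int N' < t" "t \<le> 2 * int N'" "int N < t + h" "t + h \<le> 2 * int N" using rg[of t] by auto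
    then have "block_kernel N \<mu> (t + h) * cnj (block_kernel N' \<mu>' t) = (ee (\<mu> * real_of_int (t + h) powr c) * cnj (ee (\<mu>' * real_of_int t powr c))) / (of_int (t + h) * of_int t)"
      by (simp add: block_kernel_def)
    also have "\<dots> = of_real (w t) * ee (phase \<mu> \<mu>' (real_of_int h) (real_of_int t))"
      by (simp add: w_def phase_def flip: ee_diff)
    finally show "block_kernel N \<mu> (t + h) * cnj (block_kernel N' \<mu>' t) = of_real (w t) * ee (phase \<mu> \<mu>' (real_of_int h) (real_of_int t))" .
  qed
  finally have eq: "correlation S N \<mu> x N' \<mu>' y = (\<Sum>t\<in>{m..M}. of_real (w t) * ee (phase \<mu> \<mu>' (real_of_int h) (real_of_int t)))" .
  show ?thesis
  proof (cases "m \<le> M")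
    case False
    then show ?thesis using eq B by simp
  next
    case True
    have pos: "real N' < real_of_int t" "real N < real_of_int (t + h)" if "m \<le> t" "t \<le> M" for t
      using rg[OF that] by linarith+
    have "norm (correlation S N \<mu> x N' \<mu>' y) \<le> w m * B"
      unfolding eq
    proof (rule abel_sum_bound[OF True])
      fix t assume t: "m \<le> t" "t < M"
      show "w (t + 1) \<le> w t" unfolding w_def
        using pos[of t] t N by (intro divide_left_mono mult_mono mult_pos_pos) auto
    next
      show "0 \<le> w M" using pos[of M] True N by (simp add: w_def)
    next
      fix k assume k: "m \<le> k" "k \<le> M"
      show "norm (\<Sum>t\<in>{m..k}. ee (phase \<mu> \<mu>' (real_of_int h) (real_of_int t))) \<le> B"
        unfolding h_def
      proof (rule sum[OF k(1)])
        fix s assume s: "real_of_int m \<le> s" "s \<le> real_of_int k"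
        have "real_of_int k \<le> real_of_int M" using k by simp
        moreover have "real_of_int M \<le> 2 * real N'" "real_of_int M + real_of_int h \<le> 2 * real N" using rg[of M] True by linarith+
        moreover have "real N' < real_of_int m" "real N < real_of_int m + real_of_int h" using pos[of m] True by auto
        ultimately show "real N' \<le> s \<and> s \<le> 2 * real N' \<and> real N \<le> s + real_of_int (x - y) \<and> s + real_of_int (x - y) \<le> 2 * real N"
          unfolding h_def[symmetric] using s by linarith
      qed
    qed
    also have "\<dots> \<le> 1 / (real N * real N') * B"
    proof (rule mult_right_mono[OF _ B])
      show "w m \<le> 1 / (real N * real N')" unfolding w_def
        using pos[of m] True N by (intro divide_left_mono mult_mono mult_pos_pos) auto
    qed
    finally show ?thesis by simp
  qed
qed

lemma correlation_trivial:
  assumes S: "finite S" and N: "1 \<le> N'" "N' \<le> N"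
    and sub: "\<And>n. int N' < n \<Longrightarrow> n \<le> 2 * int N' \<Longrightarrow> y - n \<in> S"
  shows "norm (correlation S N \<mu> x N' \<mu>' y) \<le> 2 / real N"
proof -
  have "norm (correlation S N \<mu> x N' \<mu>' y) \<le> (2 * real N') / (real N * real N')"
  proof (rule correlation_bound[OF S])
    fix m M :: int assume mM: "m \<le> M" and r: "\<And>s. real_of_int m \<le> s \<Longrightarrow> s \<le> real_of_int M \<Longrightarrow>
        real N' \<le> s \<and> s \<le> 2 * real N' \<and> real N \<le> s + real_of_int (x - y) \<and> s + real_of_int (x - y) \<le> 2 * real N"
    have "M - m + 1 \<le> 2 * int N'" using r[of "real_of_int m"] r[of "real_of_int M"] mM N by auto
    then have "real (card {m..M}) \<le> 2 * real N'" using mM by simp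
    then show "norm (\<Sum>t\<in>{m..M}. ee (phase \<mu> \<mu>' (real_of_int (x - y)) (real_of_int t))) \<le> 2 * real N'"
      by (rule order_trans[OF norm_sum_ee_le_card])
  qed (use N sub in auto)
  also have "\<dots> = 2 / real N" using N by simp
  finally show ?thesis .
qed

lemma block_kernel_TT:
  fixes N :: "int \<Rightarrow> nat" and \<mu> :: "int \<Rightarrow> real"
  assumes X: "finite X" and S: "finite S" and \<delta>: "\<delta> > 0" "\<And>x. x \<in> X \<Longrightarrow> 1 \<le> \<delta> * real (N x)"
    and N: "\<And>x. x \<in> X \<Longrightarrow> 1 \<le> N x" and K: "K \<ge> 6"
    and sub: "\<And>x n. x \<in> X \<Longrightarrow> int (N x) < n \<Longrightarrow> n \<le> 2 * int (N x) \<Longrightarrow> x - n \<in> S"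
    and correlation: "\<And>x y. x \<in> X \<Longrightarrow> y \<in> X \<Longrightarrow> N y \<le> N x \<Longrightarrow> \<delta> * real (N x) < \<bar>real_of_int (x - y)\<bar> \<Longrightarrow>
       norm (correlation S (N x) (\<mu> x) x (N y) (\<mu> y) y) \<le> K * \<delta> / real (N x)"
  shows "L2_set (\<lambda>x. norm (\<Sum>m\<in>S. block_kernel (N x) (\<mu> x) (x - m) * f m)) X \<le> sqrt (48 * K * \<delta>) * L2_set (\<lambda>m. norm (f m)) S"
proof -
  define s where "s x = nat \<lfloor>\<delta> * real (N x)\<rfloor>" for x
  have main: "norm (correlation S (N x) (\<mu> x) x (N y) (\<mu> y) y) \<le> 5 * K * \<delta> * avg_kernel (2 * N x) (x - y) + 6 * \<delta> * avg_kernel (s x) (x - y)"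
    if xy: "x \<in> X" "y \<in> X" "N y \<le> N x" for x y
  proof -
    have N1: "real (N x) \<ge> 1" using N[OF xy(1)] by simp
    consider "\<bar>x - y\<bar> > 2 * int (N x)" | "\<bar>x - y\<bar> \<le> 2 * int (N x)" "\<delta> * real (N x) < \<bar>real_of_int (x - y)\<bar>"
      | "\<bar>real_of_int (x - y)\<bar> \<le> \<delta> * real (N x)" by linarith
    then show ?thesis
    proof cases
      case 1
      then show ?thesis using correlation_far[OF xy(3)] K \<delta> by (simp add: avg_kernel_nonneg)
    next
      case 2
      have "1 / real (N x) \<le> 5 * avg_kernel (2 * N x) (x - y)" using 2(1) N1 by (simp add: avg_kernel_def field_simps)
      then have "K * \<delta> * (1 / real (N x)) \<le> K * \<delta> * (5 * avg_kernel (2 * N x) (x - y))" using K \<delta> by (intro mult_left_mono) auto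
      moreover have "0 \<le> 6 * \<delta> * avg_kernel (s x) (x - y)" using \<delta> by (simp add: avg_kernel_nonneg)
      ultimately show ?thesis using correlation[OF xy 2(2)] by (simp add: mult_ac)
    next
      case 3
      have d1: "1 \<le> \<delta> * real (N x)" using \<delta>(2)[OF xy(1)] .
      have s1: "1 \<le> real (s x)" "real (s x) \<le> \<delta> * real (N x)" using d1 by (auto simp: s_def le_nat_floor)
      have "\<bar>x - y\<bar> \<le> \<lfloor>\<delta> * real (N x)\<rfloor>" using 3 by (simp add: le_floor_iff)
      then have a: "avg_kernel (s x) (x - y) = 1 / (2 * real (s x) + 1)" using d1 by (simp add: avg_kernel_def s_def)
      have "1 / (3 * (\<delta> * real (N x))) \<le> 1 / (2 * real (s x) + 1)" using s1 by (intro divide_left_mono) auto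
      then have "6 * \<delta> * (1 / (3 * (\<delta> * real (N x)))) \<le> 6 * \<delta> * avg_kernel (s x) (x - y)" unfolding a using \<delta> by (intro mult_left_mono) auto
      moreover have "6 * \<delta> * (1 / (3 * (\<delta> * real (N x)))) = 2 / real (N x)" using \<delta>(1) by simp
      moreover have "norm (correlation S (N x) (\<mu> x) x (N y) (\<mu> y) y) \<le> 2 / real (N x)"
        using xy N sub by (intro correlation_trivial S) auto
      moreover have "0 \<le> 5 * K * \<delta> * avg_kernel (2 * N x) (x - y)" using \<delta> K by (simp add: avg_kernel_nonneg)
      ultimately show ?thesis by linarith
    qed
  qed
  have "L2_set (\<lambda>x. norm (\<Sum>m\<in>S. block_kernel (N x) (\<mu> x) (x - m) * f m)) X \<le> sqrt (8 * (5 * K * \<delta> + 6 * \<delta>)) * L2_set (\<lambda>m. norm (f m)) S"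
  proof (rule TT_avk[OF X, where r = "\<lambda>x. 2 * N x" and s = s])
    fix x y assume xy: "x \<in> X" "y \<in> X"
    have nn: "0 \<le> 5 * K * \<delta> * avg_kernel (2 * N z) (x - y)" "0 \<le> 6 * \<delta> * avg_kernel (s z) (x - y)" for z using \<delta> K by (auto simp: avg_kernel_nonneg)
    have "norm (correlation S (N x) (\<mu> x) x (N y) (\<mu> y) y) \<le> 5 * K * \<delta> * (avg_kernel (2 * N x) (x - y) + avg_kernel (2 * N y) (x - y)) + 6 * \<delta> * (avg_kernel (s x) (x - y) + avg_kernel (s y) (x - y))"
    proof (cases "N y \<le> N x")
      case True
      then show ?thesis using main[OF xy True] nn[of y] by (simp add: distrib_left)
    next
      case False
      have "avg_kernel r (y - x) = avg_kernel r (x - y)" for r by (simp add: avg_kernel_def abs_minus_commute)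
      then show ?thesis using main[OF xy(2,1)] False nn[of x] correlation_commute[of S "N x" "\<mu> x" x "N y" "\<mu> y" y] by (simp add: distrib_left)
    qed
    then show "norm (\<Sum>m\<in>S. block_kernel (N x) (\<mu> x) (x - m) * cnj (block_kernel (N y) (\<mu> y) (y - m))) \<le> 
      5 * K * \<delta> * (avg_kernel (2 * N x) (x - y) + avg_kernel (2 * N y) (x - y)) + 6 * \<delta> * (avg_kernel (s x) (x - y) + avg_kernel (s y) (x - y))"
      by (simp add: correlation_def)
  qed (use \<delta> K in auto)
  also have "sqrt (8 * (5 * K * \<delta> + 6 * \<delta>)) \<le> sqrt (48 * K * \<delta>)"
    using K \<delta> mult_right_mono[of 6 K \<delta>] by simp
  finally show ?thesis by (simp add: mult_right_mono)
qed

end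

text \<open>Meant for r = sqrt Q and E = Q^((2 - c)/8), with e and g the losses \<open>ec\<close>
  and \<open>gc\<close>. The hypothesis r E^2 \<le> N bounds the main product, of order e r E, by e
  N / E; the other terms are also compared with N / E, the target gain.\<close>

lemma near_algebra:
  fixes r E e g N :: real
  assumes "1 \<le> r" "1 \<le> E" "1 \<le> e" "1 \<le> g" "r * E\<^sup>2 \<le> N" "E\<^sup>2 \<le> r"
  shows "2 * ((256 * r\<^sup>2 / N + 2) * (5 * e * E * N / r + 2) + 1) + 8 * N * g / E + 1 \<le> 3623 * (e * g * (N / E))"
proof -
  have N: "N \<ge> 1" using assms mult_mono[of 1 r 1 "E\<^sup>2"] by (simp add: one_le_power)
  have EE: "E \<le> E\<^sup>2" using assms self_le_power[of E 2] by simp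
  define T where "T = N / E"
  have a: "r * E \<le> T" using assms by (simp add: T_def pos_le_divide_eq power2_eq_square mult.assoc)
  have rT: "r \<le> T" using a assms mult_left_mono[of 1 E r] by linarith
  have T1: "1 \<le> T" using rT assms by simp
  have b: "r\<^sup>2 / N \<le> T"
  proof -
    have "r * 1 \<le> r * E\<^sup>2" using assms by (intro mult_left_mono one_le_power) auto
    then have "r \<le> N" using assms by linarith
    then have "r\<^sup>2 / N \<le> r" using N assms by (simp add: power2_eq_square divide_le_eq mult_left_mono)
    then show ?thesis using rT by simp
  qed
  have d: "E * N / r \<le> T"
  proof -
    have "E * N / r * E \<le> N" using assms N by (simp add: divide_le_eq power2_eq_square mult.commute mult.left_commute mult_left_mono)
    then show ?thesis using assms by (simp add: T_def pos_le_divide_eq)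
  qed
  have eg: "T \<le> e * g * T" "e * T \<le> e * g * T" "g * T \<le> e * g * T"
  proof -
    have "e \<le> e * g" "g \<le> e * g" "1 \<le> e * g" using assms mult_left_mono[of 1 g e] mult_right_mono[of 1 e g] mult_mono[of 1 e 1 g] by auto
    then show "T \<le> e * g * T" "e * T \<le> e * g * T" "g * T \<le> e * g * T"
      using T1 mult_right_mono[of e "e * g" T] mult_right_mono[of g "e * g" T] by auto
  qed
  have "2 * ((256 * r\<^sup>2 / N + 2) * (5 * e * E * N / r + 2) + 1) + 8 * N * g / E + 1
    = 2560 * (e * (r * E)) + 1024 * (r\<^sup>2 / N) + 20 * (e * (E * N / r)) + 11 + 8 * (g * T)"
    using assms N by (simp add: T_def field_simps power2_eq_square)
  also have "\<dots> \<le> 2560 * (e * T) + 1024 * T + 20 * (e * T) + 11 * T + 8 * (g * T)"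
    using a b d T1 assms by (intro add_mono mult_left_mono) auto
  also have "\<dots> \<le> 3623 * (e * g * T)" using eg by linarith
  finally show ?thesis by (simp add: T_def)
qed

lemma far_algebra:
  fixes r E e N :: real
  assumes "1 \<le> r" "1 \<le> E" "1 \<le> e" "r * E\<^sup>2 \<le> N" "E\<^sup>2 \<le> r"
  shows "(64 * r\<^sup>2 / N + 2) * (6 * N * e / r + 2) + 1 \<le> 3623 * (e * (N / E))"
proof -
  have N: "N \<ge> 1" using assms mult_mono[of 1 r 1 "E\<^sup>2"] by (simp add: one_le_power)
  define T where "T = N / E"
  have a: "r * E \<le> T" using assms by (simp add: T_def pos_le_divide_eq power2_eq_square mult.assoc)
  have rT: "r \<le> T" using a assms mult_left_mono[of 1 E r] by linarith
  have T1: "1 \<le> T" using rT assms by simp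
  have b: "r\<^sup>2 / N \<le> T"
  proof -
    have "r * 1 \<le> r * E\<^sup>2" using assms by (intro mult_left_mono one_le_power) auto
    then have "r \<le> N" using assms by linarith
    then have "r\<^sup>2 / N \<le> r" using N assms by (simp add: power2_eq_square divide_le_eq mult_left_mono)
    then show ?thesis using rT by simp
  qed
  have d: "N / r \<le> T"
  proof -
    have "E \<le> r" using assms self_le_power[of E 2] by simp
    then show ?thesis unfolding T_def using assms N by (intro divide_left_mono) auto
  qed
  have eT: "T \<le> e * T" using T1 assms by simp
  have "(64 * r\<^sup>2 / N + 2) * (6 * N * e / r + 2) + 1
    = 384 * (e * r) + 128 * (r\<^sup>2 / N) + 12 * (e * (N / r)) + 5"
    using assms N by (simp add: field_simps power2_eq_square)
  also have "\<dots> \<le> 384 * (e * T) + 128 * T + 12 * (e * T) + 5 * T"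
    using rT b d T1 assms by (intro add_mono mult_left_mono) auto
  also have "\<dots> \<le> 3623 * (e * T)" using eT T1 by linarith
  finally show ?thesis by (simp add: T_def)
qed

text \<open>Meant for F = N^((2 - c)/32), so that F^32 = N^(2 - c). The exponent 22 is (12 + 32) /
  2, from a window \<sigma> = F^(-12) under the square root. The main product is then of order N
  F^(1 - 32 + 22), below the loss N / F^4 at the zero.\<close>

lemma high_algebra:
  fixes F e g N \<Lambda> :: real
  assumes "1 \<le> F" "1 \<le> e" "1 \<le> g" "F ^ 32 \<le> N" "\<Lambda> \<le> 8 * F" "0 \<le> \<Lambda>"
  shows "2 * ((16 * \<Lambda> * (N / F ^ 32) + 2) * (5 * e * F ^ 22 + 2) + 1) + 16 * N * g / F ^ 4 + 1 \<le> 1839 * (e * g * (N / F ^ 4))"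
proof -
  define T where "T = N / F ^ 4"
  have "1 \<le> F ^ 32" using assms by (intro one_le_power)
  then have N: "N \<ge> 1" using assms by linarith
  have T1: "1 \<le> T"
  proof -
    have "F ^ 4 \<le> F ^ 32" using assms by (intro power_increasing) auto
    then show ?thesis unfolding T_def using assms by (simp add: pos_le_divide_eq)
  qed
  have eg: "T \<le> e * g * T" "e * T \<le> e * g * T" "g * T \<le> e * g * T"
  proof -
    have "e \<le> e * g" "g \<le> e * g" "1 \<le> e * g" using assms mult_left_mono[of 1 g e] mult_right_mono[of 1 e g] mult_mono[of 1 e 1 g] by auto
    then show "T \<le> e * g * T" "e * T \<le> e * g * T" "g * T \<le> e * g * T"
      using T1 mult_right_mono[of e "e * g" T] mult_right_mono[of g "e * g" T] by auto
  qed
  have p: "16 * \<Lambda> * (N / F ^ 32) + 2 \<le> 130 * (F * (N / F ^ 32))"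
  proof -
    have "16 * \<Lambda> * (N / F ^ 32) \<le> 16 * (8 * F) * (N / F ^ 32)" using assms N by (intro mult_right_mono) auto
    moreover have "1 * 1 \<le> F * (N / F ^ 32)" using assms by (intro mult_mono) (auto simp: pos_le_divide_eq)
    ultimately show ?thesis by simp
  qed
  have q: "5 * e * F ^ 22 + 2 \<le> 7 * (e * F ^ 22)"
    using mult_mono[of 1 e 1 "F ^ 22"] assms by (simp add: one_le_power)
  have "(16 * \<Lambda> * (N / F ^ 32) + 2) * (5 * e * F ^ 22 + 2) \<le> 130 * (F * (N / F ^ 32)) * (7 * (e * F ^ 22))"
    using assms N by (intro mult_mono p q) auto
  also have "\<dots> = 910 * (e * (N * (F ^ 23 / F ^ 32)))" by (simp add: power_numeral_reduce)
  also have "F ^ 23 / F ^ 32 = 1 / F ^ 9" using assms by (simp add: divide_simps flip: power_add)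
  also have "910 * (e * (N * (1 / F ^ 9))) \<le> 910 * (e * (N * (1 / F ^ 4)))"
    using assms N by (intro mult_left_mono divide_left_mono power_increasing) auto
  finally have "(16 * \<Lambda> * (N / F ^ 32) + 2) * (5 * e * F ^ 22 + 2) \<le> 910 * (e * T)" by (simp add: T_def)
  moreover have "16 * N * g / F ^ 4 = 16 * (g * T)" by (simp add: T_def)
  moreover have "2 * (P + 1) + S + 1 \<le> 1839 * U" if "P \<le> 910 * A" "S = 16 * B" "T \<le> U" "A \<le> U" "B \<le> U" for P S A B U :: real
  proof -
    have "2 * P \<le> 1820 * U" "S \<le> 16 * U" "3 \<le> 3 * U" using that T1 by simp_all
    then have "2 * P + S + 3 \<le> 1820 * U + 16 * U + 3 * U" by (intro add_mono)
    then show ?thesis by simp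
  qed
  note this[OF _ _ eg]
  ultimately show ?thesis unfolding T_def[symmetric] by blast
qed

section \<open>Gains for smooth blocks of medium and high modulation\<close>

context exponent
begin

text \<open>The two losses: \<open>ec\<close> comes from the factor c - 1 of the second derivative,
  \<open>gc\<close> from the slope of \<open>phase_ratio\<close> and from geometric series.\<close>

definition ec :: real where "ec = 1 / sqrt (c - 1)"
definition gc :: real where "gc = 1 / (2 - c)"

lemma ec1: "ec \<ge> 1" using c1 c2 by (simp add: ec_def)
lemma gc1: "gc \<ge> 1" using c1 c2 by (simp add: gc_def)
lemma eg1: "ec * gc \<ge> 1" using mult_mono[of 1 ec 1 gc] ec1 gc1 by simp

lemma ec_sq: "c - 1 = 1 / ec\<^sup>2" using c1 by (simp add: ec_def power_divide)

text \<open>The room left by c < 2. Van der Corput's test yields terms of order sqrt Q, which must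
  stay below n by a power of Q. From Q \<le> n^c one gets Q^(1/c) \<le> n, and 1/2 + (2 - c)/4 \<le>
  1/c because c times the left side is 1 - (2 - c)^2 / 4.\<close>

lemma scale_facts:
  fixes n Q :: real
  assumes Q: "1 \<le> Q" and n: "1 \<le> n" and Qn: "Q \<le> n powr c"
  shows "sqrt Q * (Q powr ((2 - c) / 8))\<^sup>2 \<le> n" and "(Q powr ((2 - c) / 8))\<^sup>2 \<le> sqrt Q"
proof -
  have sq: "sqrt Q = Q powr (1/2)" using Q by (simp add: powr_half_sqrt)
  have E2: "(Q powr ((2 - c) / 8))\<^sup>2 = Q powr ((2 - c) / 4)" by (simp add: power2_eq_square flip: powr_add)
  show "(Q powr ((2 - c) / 8))\<^sup>2 \<le> sqrt Q" unfolding sq E2 using Q c1 by (intro powr_mono) auto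
  have "sqrt Q * (Q powr ((2 - c) / 8))\<^sup>2 = Q powr (1/2 + (2 - c) / 4)" by (simp add: sq E2 powr_add)
  also have "\<dots> \<le> Q powr (1 / c)"
  proof (rule powr_mono)
    have "(1/2 + (2 - c) / 4) * c \<le> 1"
    proof -
      have "(1/2 + (2 - c) / 4) * c = 1 - (2 - c)\<^sup>2 / 4" by (simp add: field_simps power2_eq_square)
      then show ?thesis by simp
    qed
    then show "1/2 + (2 - c) / 4 \<le> 1 / c" using c1 by (simp add: pos_le_divide_eq)
  qed (use Q in simp)
  also have "\<dots> \<le> (n powr c) powr (1 / c)" using Q Qn c1 by (intro powr_mono2) auto
  also have "\<dots> = n" using n c1 by (simp add: powr_powr)
  finally show "sqrt Q * (Q powr ((2 - c) / 8))\<^sup>2 \<le> n" .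
qed

text \<open>The scales \<open>N x\<close> vary, but |\<mu>| N^c has the same order Q at every point,
  so the gain can be a power of Q. By \<open>dyadic\<close> two scales are within a factor 2 or at
  least a factor 4 apart, so \<open>exp_sum_near\<close> and \<open>exp_sum_far\<close> cover all
  pairs.\<close>

lemma block_mid:
  fixes N :: "int \<Rightarrow> nat" and \<mu> :: "int \<Rightarrow> real"
  assumes X: "finite X" and S: "finite S" and N: "\<And>x. x \<in> X \<Longrightarrow> 1 \<le> N x"
    and dyadic: "\<And>x y. x \<in> X \<Longrightarrow> y \<in> X \<Longrightarrow> N y \<le> N x \<Longrightarrow> 4 * N y \<le> N x \<or> N x \<le> 2 * N y"
    and Q: "1 \<le> Q" and \<mu>: "\<And>x. x \<in> X \<Longrightarrow> Q \<le> \<bar>\<mu> x\<bar> * real (N x) powr c \<and> \<bar>\<mu> x\<bar> * real (N x) powr c \<le> 4 * Q"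
    and \<mu>1: "\<And>x. x \<in> X \<Longrightarrow> \<bar>\<mu> x\<bar> \<le> 1"
    and sub: "\<And>x n. x \<in> X \<Longrightarrow> int (N x) < n \<Longrightarrow> n \<le> 2 * int (N x) \<Longrightarrow> x - n \<in> S"
  shows "L2_set (\<lambda>x. norm (\<Sum>m\<in>S. block_kernel (N x) (\<mu> x) (x - m) * f m)) X
    \<le> 590 * sqrt (ec * gc) * Q powr (- (2 - c) / 16) * L2_set (\<lambda>m. norm (f m)) S"
proof -
  define E where "E = Q powr ((2 - c) / 8)"
  define r where "r = sqrt Q"
  have E1: "E \<ge> 1" unfolding E_def using Q c2 by (intro ge_one_powr_ge_zero) auto
  have r1: "r \<ge> 1" "r\<^sup>2 = Q" using Q by (auto simp: r_def)
  have Nx: "real (N x) \<ge> 1" "r * E\<^sup>2 \<le> real (N x)" "E\<^sup>2 \<le> r" if "x \<in> X" for x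
  proof -
    show n1: "real (N x) \<ge> 1" using N[OF that] by simp
    have "Q \<le> \<bar>\<mu> x\<bar> * real (N x) powr c" using \<mu>[OF that] by simp
    also have "\<dots> \<le> 1 * real (N x) powr c" using \<mu>1[OF that] by (intro mult_right_mono) auto
    finally show "r * E\<^sup>2 \<le> real (N x)" "E\<^sup>2 \<le> r" using scale_facts[OF Q n1] by (auto simp: r_def E_def)
  qed
  define K where "K = 7246 * (ec * gc)"
  have K6: "K \<ge> 6" using eg1 by (simp add: K_def)
  have "L2_set (\<lambda>x. norm (\<Sum>m\<in>S. block_kernel (N x) (\<mu> x) (x - m) * f m)) X \<le> sqrt (48 * K * (1 / E)) * L2_set (\<lambda>m. norm (f m)) S"
  proof (rule block_kernel_TT[OF X S])
    show "0 < 1 / E" using E1 by simp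
    show "1 \<le> 1 / E * real (N x)" if "x \<in> X" for x
    proof -
      have "1 * E \<le> r * E\<^sup>2" using E1 r1 self_le_power[of E 2] by (intro mult_mono) auto
      then have "E \<le> real (N x)" using Nx[OF that] by linarith
      then show ?thesis using E1 by (simp add: pos_le_divide_eq)
    qed
    fix x y assume xy: "x \<in> X" "y \<in> X" "N y \<le> N x" and far: "1 / E * real (N x) < \<bar>real_of_int (x - y)\<bar>"
    let ?n = "real (N x)" and ?n' = "real (N y)"
    note nx = Nx[OF xy(1)] and ny = Nx[OF xy(2)]
    consider "4 * N y \<le> N x" | "N x \<le> 2 * N y" using dyadic[OF xy] by blast
    then show "norm (correlation S (N x) (\<mu> x) x (N y) (\<mu> y) y) \<le> K * (1 / E) / ?n"
    proof cases
      case 1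
      have "norm (correlation S (N x) (\<mu> x) x (N y) (\<mu> y) y) \<le> (3623 * (ec * (?n' / E))) / (?n * ?n')"
      proof (rule correlation_bound[OF S])
        fix m M :: int assume rg: "\<And>s. real_of_int m \<le> s \<Longrightarrow> s \<le> real_of_int M \<Longrightarrow>
          ?n' \<le> s \<and> s \<le> 2 * ?n' \<and> ?n \<le> s + real_of_int (x - y) \<and> s + real_of_int (x - y) \<le> 2 * ?n"
        have "norm (\<Sum>t\<in>{m..M}. ee (phase (\<mu> x) (\<mu> y) (real_of_int (x - y)) (real_of_int t)))
           \<le> (64 * Q / ?n' + 2) * (6 * ?n' / sqrt ((c - 1) * Q) + 2) + 1"
          using \<mu>[OF xy(1)] \<mu>[OF xy(2)] ny 1 Q by (intro exp_sum_far[OF _ _ _ _ _ _ rg]) auto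
        also have "6 * ?n' / sqrt ((c - 1) * Q) = 6 * ?n' * ec / r" by (simp add: real_sqrt_mult ec_def r_def)
        also have "(64 * Q / ?n' + 2) * (6 * ?n' * ec / r + 2) + 1 \<le> 3623 * (ec * (?n' / E))"
          using far_algebra[OF r1(1) E1 ec1 ny(2,3)] r1(2) by simp
        finally show "norm (\<Sum>t\<in>{m..M}. ee (phase (\<mu> x) (\<mu> y) (real_of_int (x - y)) (real_of_int t))) \<le> 3623 * (ec * (?n' / E))" .
      qed (use N xy sub ec1 E1 in auto)
      also have "\<dots> = 3623 * ec * (1 / E) / ?n" using ny by simp
      also have "\<dots> \<le> K * (1 / E) / ?n"
      proof (intro divide_right_mono mult_right_mono)
        show "3623 * ec \<le> K" using ec1 gc1 mult_left_mono[of 1 gc ec] by (simp add: K_def)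
      qed (use E1 in auto)
      finally show ?thesis .
    next
      case 2
      have n: "?n > 0" using nx by simp
      define m0 where "m0 = Q * ?n powr (- c)"
      \<comment> \<open>Of order |\<mu> x| / E^2: for |h| \<ge> n / E the window around the zero
        then contains about n / E integers, up to the factor 1 / (2 - c), which matches the desired
        gain.\<close>
      define \<sigma> where "\<sigma> = Q / E\<^sup>2 * ?n powr (- c)"
      have nc: "?n powr (- c) * ?n powr c = 1" using n by (simp flip: powr_add)
      have m0: "m0 > 0" using Q n by (simp add: m0_def)
      have \<mu>x: "m0 \<le> \<bar>\<mu> x\<bar>" "\<bar>\<mu> x\<bar> \<le> 4 * m0"
      proof -
        have "Q * ?n powr (- c) \<le> \<bar>\<mu> x\<bar> * ?n powr c * ?n powr (- c)" "\<bar>\<mu> x\<bar> * ?n powr c * ?n powr (- c) \<le> 4 * Q * ?n powr (- c)"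
          using \<mu>[OF xy(1)] by (auto intro: mult_right_mono)
        then show "m0 \<le> \<bar>\<mu> x\<bar>" "\<bar>\<mu> x\<bar> \<le> 4 * m0" using nc by (auto simp: m0_def mult_ac)
      qed
      have \<mu>y: "\<bar>\<mu> y\<bar> \<le> 16 * m0"
      proof -
        have "?n' powr (- c) \<le> (?n / 2) powr (- c)" using 2 n c1 by (intro powr_mono2') auto
        also have "\<dots> = ?n powr (- c) * 2 powr c" using n by (simp add: powr_divide powr_minus field_simps)
        also have "\<dots> \<le> ?n powr (- c) * 2 powr 2" using c2 by (intro mult_left_mono powr_mono) auto
        finally have w: "?n' powr (- c) \<le> 4 * ?n powr (- c)" by (simp add: powr_numeral)
        have "\<bar>\<mu> y\<bar> = \<bar>\<mu> y\<bar> * ?n' powr c * ?n' powr (- c)" using ny by (simp add: mult.assoc flip: powr_add)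
        also have "\<dots> \<le> 4 * Q * ?n' powr (- c)" using \<mu>[OF xy(2)] by (intro mult_right_mono) auto
        also have "\<dots> \<le> 4 * Q * (4 * ?n powr (- c))" using w Q by (intro mult_left_mono) auto
        finally show ?thesis by (simp add: m0_def)
      qed
      have \<sigma>: "\<sigma> > 0" using Q E1 n by (simp add: \<sigma>_def)
      define B where "B = 3623 * (ec * gc * (?n / E))"
      have "norm (correlation S (N x) (\<mu> x) x (N y) (\<mu> y) y) \<le> B / (?n * ?n')"
      proof (rule correlation_bound[OF S])
        show "0 \<le> B" using eg1 E1 by (simp add: B_def)
        fix m M :: int assume rg: "\<And>s. real_of_int m \<le> s \<Longrightarrow> s \<le> real_of_int M \<Longrightarrow>
          ?n' \<le> s \<and> s \<le> 2 * ?n' \<and> ?n \<le> s + real_of_int (x - y) \<and> s + real_of_int (x - y) \<le> 2 * ?n"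
        have rg': "0 < s \<and> s \<le> 2 * ?n \<and> 0 < s + real_of_int (x - y) \<and> s + real_of_int (x - y) \<le> 2 * ?n"
          if "real_of_int m \<le> s" "s \<le> real_of_int M" for s
          using rg[OF that] xy(3) ny nx by linarith
        have "norm (\<Sum>t\<in>{m..M}. ee (phase (\<mu> x) (\<mu> y) (real_of_int (x - y)) (real_of_int t)))
           \<le> 2 * ((16 * (16 * m0) * ?n powr (c - 1) + 2) * (3 / sqrt ((c - 1) * \<sigma> * ?n powr (c - 2) / 2) + 2) + 1)
             + 8 * \<sigma> * ?n\<^sup>2 / ((2 - c) * (m0 * (?n / E))) + 1"
        proof (rule exp_sum_near[OF n m0 \<mu>x(1) _ _ rg' _ _ \<sigma>])
          show "0 < ?n / E" using n E1 by simp
          show "?n / E \<le> \<bar>real_of_int (x - y)\<bar>" using far by simp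
        qed (use \<mu>x \<mu>y m0 in auto)
        also have "16 * (16 * m0) * ?n powr (c - 1) = 256 * r\<^sup>2 / ?n"
          using n nc by (simp add: m0_def r1 powr_diff)
        also have "8 * \<sigma> * ?n\<^sup>2 / ((2 - c) * (m0 * (?n / E))) = 8 * ?n * gc / E"
          using n Q E1 c2 by (simp add: \<sigma>_def m0_def gc_def field_simps power2_eq_square)
        also have "3 / sqrt ((c - 1) * \<sigma> * ?n powr (c - 2) / 2) \<le> 5 * ec * E * ?n / r"
        proof -
          \<comment> \<open>A lower bound for the square root without irrational constant, by 9/25
            \<le> 1/2.\<close>
          define w where "w = 3 * r / (5 * ec * E * ?n)"
          have w0: "w > 0" using r1 ec1 E1 n by (simp add: w_def)
          have "\<sigma> * ?n powr (c - 2) = r\<^sup>2 / (E\<^sup>2 * ?n\<^sup>2)"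
            using n nc by (simp add: \<sigma>_def r1 powr_diff powr_numeral)
          then have "(c - 1) * \<sigma> * ?n powr (c - 2) / 2 = r\<^sup>2 / (ec\<^sup>2 * E\<^sup>2 * ?n\<^sup>2) / 2"
            unfolding mult.assoc by (simp add: ec_sq)
          moreover have "w\<^sup>2 \<le> r\<^sup>2 / (ec\<^sup>2 * E\<^sup>2 * ?n\<^sup>2) / 2"
          proof -
            define z where "z = r\<^sup>2 / (ec\<^sup>2 * E\<^sup>2 * ?n\<^sup>2)"
            have "w\<^sup>2 = 9/25 * z" by (simp add: w_def z_def power_divide power_mult_distrib)
            moreover have "z \<ge> 0" by (simp add: z_def)
            ultimately show ?thesis unfolding z_def[symmetric] by linarith
          qed
          ultimately have "w \<le> sqrt ((c - 1) * \<sigma> * ?n powr (c - 2) / 2)" by (intro real_le_rsqrt) simp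
          then have "3 / sqrt ((c - 1) * \<sigma> * ?n powr (c - 2) / 2) \<le> 3 / w" using w0 by (intro frac_le) auto
          also have "3 / w = 5 * ec * E * ?n / r" by (simp add: w_def)
          finally show ?thesis .
        qed
        then have "2 * ((256 * r\<^sup>2 / ?n + 2) * (3 / sqrt ((c - 1) * \<sigma> * ?n powr (c - 2) / 2) + 2) + 1) + 8 * ?n * gc / E + 1
          \<le> 2 * ((256 * r\<^sup>2 / ?n + 2) * (5 * ec * E * ?n / r + 2) + 1) + 8 * ?n * gc / E + 1"
          by (intro add_mono mult_left_mono order_refl) auto
        also have "\<dots> \<le> B" unfolding B_def by (rule near_algebra[OF r1(1) E1 ec1 gc1 nx(2,3)])
        finally show "norm (\<Sum>t\<in>{m..M}. ee (phase (\<mu> x) (\<mu> y) (real_of_int (x - y)) (real_of_int t))) \<le> B" .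
      qed (use N xy sub in auto)
      also have "\<dots> \<le> B / (?n * (?n / 2))"
        using 2 n ny eg1 E1 by (intro divide_left_mono mult_left_mono mult_pos_pos) (auto simp: B_def)
      also have "\<dots> = K * (1 / E) / ?n" using n by (simp add: B_def K_def)
      finally show ?thesis .
    qed
  qed (use N sub K6 in auto)
  \<comment> \<open>Numerically 48 * 7246 = 347808 is below 590^2 = 348100; 7246 is twice 3623
    because the shorter scale may be half the longer.\<close>
  also have "sqrt (48 * K * (1 / E)) \<le> 590 * sqrt (ec * gc) * Q powr (- (2 - c) / 16)"
  proof (rule real_le_lsqrt)
    have "(Q powr (- (2 - c) / 16))\<^sup>2 = 1 / E"
    proof -
      have "- (2 - c) / 16 + - (2 - c) / 16 = - ((2 - c) / 8)" by (simp add: field_simps)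
      then have "(Q powr (- (2 - c) / 16))\<^sup>2 = Q powr (- ((2 - c) / 8))"
        unfolding power2_eq_square powr_add[symmetric] by (simp only:)
      then show ?thesis by (simp add: E_def powr_minus_divide)
    qed
    moreover have "(590::real)\<^sup>2 = 348100" by simp
    ultimately have "(590 * sqrt (ec * gc) * Q powr (- (2 - c) / 16))\<^sup>2 = 348100 * (ec * gc) * (1 / E)"
      using eg1 by (simp add: power_mult_distrib)
    then show "48 * K * (1 / E) \<le> (590 * sqrt (ec * gc) * Q powr (- (2 - c) / 16))\<^sup>2"
      using eg1 E1 by (simp add: K_def divide_right_mono)
  qed (use eg1 in auto)
  finally show ?thesis by (simp add: mult_right_mono)
qed

text \<open>Here the scale is common, but |\<mu> x| and |\<mu> y| need not be comparable, so the
  gain is measured in N. The upper bound on |\<mu>| leaves room for the integer shifts that a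
  trigonometric approximation of the floor introduces.\<close>

lemma block_high:
  fixes N :: nat and \<mu> :: "int \<Rightarrow> real"
  assumes X: "finite X" and S: "finite S" and N: "1 \<le> N"
    and \<mu>: "\<And>x. x \<in> X \<Longrightarrow> real N powr (- (2 - c) / 8) / 2 \<le> \<bar>\<mu> x\<bar> \<and> \<bar>\<mu> x\<bar> \<le> \<Lambda>"
    and \<Lambda>: "0 \<le> \<Lambda>" "\<Lambda> \<le> 8 * real N powr ((2 - c) / 32)"
    and sub: "\<And>x n. x \<in> X \<Longrightarrow> int N < n \<Longrightarrow> n \<le> 2 * int N \<Longrightarrow> x - n \<in> S"
  shows "L2_set (\<lambda>x. norm (\<Sum>m\<in>S. block_kernel N (\<mu> x) (x - m) * f m)) X
    \<le> 298 * sqrt (ec * gc) * real N powr (- (2 - c) / 16) * L2_set (\<lambda>m. norm (f m)) S"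
proof -
  let ?n = "real N"
  define F where "F = ?n powr ((2 - c) / 32)"
  have n: "?n \<ge> 1" using N by simp
  have F1: "F \<ge> 1" unfolding F_def using n c2 by (intro ge_one_powr_ge_zero) auto
  have Fp: "F ^ k = ?n powr (real k * (2 - c) / 32)" for k
    using n by (simp add: F_def powr_powr mult.commute flip: powr_realpow)
  have Fm: "1 / F ^ k = ?n powr (- (real k * (2 - c) / 32))" for k by (simp add: Fp powr_minus_divide)
  have Fm4: "1 / F ^ 4 = ?n powr (- (2 - c) / 8)"
  proof -
    have "- (real 4 * (2 - c) / 32) = - (2 - c) / 8" by (simp add: field_simps)
    then show ?thesis unfolding Fm by (simp only:)
  qed
  have Fm32: "1 / F ^ 32 = ?n powr (c - 2)"
  proof -
    have "- (real 32 * (2 - c) / 32) = c - 2" by (simp add: field_simps)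
    then show ?thesis unfolding Fm by (simp only:)
  qed
  have FN: "F ^ 32 \<le> ?n"
  proof -
    have "real 32 * (2 - c) / 32 = 2 - c" by (simp add: field_simps)
    then have "F ^ 32 = ?n powr (2 - c)" unfolding Fp by (simp only:)
    also have "\<dots> \<le> ?n powr 1" using n c1 by (intro powr_mono) auto
    finally show ?thesis using n by simp
  qed
  define K where "K = 1839 * (ec * gc)"
  have K6: "K \<ge> 6" using eg1 by (simp add: K_def)
  have "L2_set (\<lambda>x. norm (\<Sum>m\<in>S. block_kernel ((\<lambda>_. N) x) (\<mu> x) (x - m) * f m)) X \<le> sqrt (48 * K * (1 / F ^ 4)) * L2_set (\<lambda>m. norm (f m)) S"
  proof (rule block_kernel_TT[OF X S])
    show "0 < 1 / F ^ 4" using F1 by simp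
    show "1 \<le> 1 / F ^ 4 * ?n"
    proof -
      have "F ^ 4 \<le> F ^ 32" using F1 by (intro power_increasing) auto
      then show ?thesis using FN F1 by (simp add: pos_le_divide_eq)
    qed
    fix x y assume xy: "x \<in> X" "y \<in> X" and far: "1 / F ^ 4 * ?n < \<bar>real_of_int (x - y)\<bar>"
    define m0 where "m0 = 1 / F ^ 4 / 2"
    \<comment> \<open>With |\<mu>| \<ge> F^(-4) / 2 and |h| > N F^(-4), the window costs of order N
      F^(-12 + 8) = N / F^4 points.\<close>
    define \<sigma> where "\<sigma> = 1 / F ^ 12"
    have m0: "m0 > 0" "\<sigma> > 0" using F1 by (auto simp: m0_def \<sigma>_def)
    have "m0 = ?n powr (- (2 - c) / 8) / 2" by (simp add: m0_def Fm4)
    then have \<mu>x: "m0 \<le> \<bar>\<mu> x\<bar>" "\<bar>\<mu> x\<bar> \<le> \<Lambda>" "\<bar>\<mu> y\<bar> \<le> \<Lambda>"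
      using \<mu>[OF xy(1)] \<mu>[OF xy(2)] by linarith+
    define B where "B = 1839 * (ec * gc * (?n / F ^ 4))"
    have "norm (correlation S N (\<mu> x) x N (\<mu> y) y) \<le> B / (?n * ?n)"
    proof (rule correlation_bound[OF S])
      show "0 \<le> B" using eg1 F1 by (simp add: B_def)
      fix m M :: int assume rg: "\<And>s. real_of_int m \<le> s \<Longrightarrow> s \<le> real_of_int M \<Longrightarrow>
        ?n \<le> s \<and> s \<le> 2 * ?n \<and> ?n \<le> s + real_of_int (x - y) \<and> s + real_of_int (x - y) \<le> 2 * ?n"
      have rg': "0 < s \<and> s \<le> 2 * ?n \<and> 0 < s + real_of_int (x - y) \<and> s + real_of_int (x - y) \<le> 2 * ?n"
        if "real_of_int m \<le> s" "s \<le> real_of_int M" for s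
        using rg[OF that] n by linarith
      have "norm (\<Sum>t\<in>{m..M}. ee (phase (\<mu> x) (\<mu> y) (real_of_int (x - y)) (real_of_int t)))
         \<le> 2 * ((16 * \<Lambda> * ?n powr (c - 1) + 2) * (3 / sqrt ((c - 1) * \<sigma> * ?n powr (c - 2) / 2) + 2) + 1)
           + 8 * \<sigma> * ?n\<^sup>2 / ((2 - c) * (m0 * (?n / F ^ 4))) + 1"
      proof (rule exp_sum_near[OF _ m0(1) \<mu>x(1) _ _ rg' \<mu>x(2,3) m0(2)])
        show "0 < ?n / F ^ 4" using n F1 by simp
        show "?n / F ^ 4 \<le> \<bar>real_of_int (x - y)\<bar>" using far by simp
      qed (use n in auto)
      also have c2': "?n powr (c - 2) = 1 / F ^ 32" by (simp add: Fm32)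
      have "?n powr (c - 1) = ?n powr (c - 2) * ?n powr 1" by (simp only: flip: powr_add) simp
      then have "?n powr (c - 1) = ?n / F ^ 32" using n by (simp add: c2')
      also have "8 * \<sigma> * ?n\<^sup>2 / ((2 - c) * (m0 * (?n / F ^ 4))) = 16 * ?n * gc / F ^ 4"
      proof -
        define G where "G = F ^ 4"
        have "\<sigma> = 1 / (G * G * G)" by (simp add: \<sigma>_def G_def flip: power_add)
        moreover have "G > 0" using F1 by (simp add: G_def)
        ultimately show ?thesis
          using n c2 unfolding m0_def G_def[symmetric] gc_def by (simp add: power2_eq_square)
      qed
      also have "3 / sqrt ((c - 1) * \<sigma> * ?n powr (c - 2) / 2) \<le> 5 * ec * F ^ 22"
      proof -
        define w where "w = 3 / (5 * ec * F ^ 22)"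
        have w0: "w > 0" using ec1 F1 by (simp add: w_def)
        have "F ^ 12 * F ^ 32 = (F ^ 22)\<^sup>2" by (simp flip: power_add power_mult)
        then have "(c - 1) * \<sigma> * ?n powr (c - 2) / 2 = 1 / (ec\<^sup>2 * (F ^ 22)\<^sup>2) / 2"
          by (simp add: ec_sq \<sigma>_def c2' mult.assoc)
        moreover have "w\<^sup>2 \<le> 1 / (ec\<^sup>2 * (F ^ 22)\<^sup>2) / 2"
        proof -
          define z where "z = 1 / (ec\<^sup>2 * (F ^ 22)\<^sup>2)"
          have "w\<^sup>2 = 9/25 * z" by (simp add: w_def z_def power_divide power_mult_distrib)
          moreover have "z \<ge> 0" by (simp add: z_def)
          ultimately show ?thesis unfolding z_def[symmetric] by linarith
        qed
        ultimately have "w \<le> sqrt ((c - 1) * \<sigma> * ?n powr (c - 2) / 2)" by (intro real_le_rsqrt) simp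
        then have "3 / sqrt ((c - 1) * \<sigma> * ?n powr (c - 2) / 2) \<le> 3 / w" using w0 by (intro frac_le) auto
        also have "3 / w = 5 * ec * F ^ 22" by (simp add: w_def)
        finally show ?thesis .
      qed
      then have "2 * ((16 * \<Lambda> * (?n / F ^ 32) + 2) * (3 / sqrt ((c - 1) * \<sigma> * ?n powr (c - 2) / 2) + 2) + 1) + 16 * ?n * gc / F ^ 4 + 1
        \<le> 2 * ((16 * \<Lambda> * (?n / F ^ 32) + 2) * (5 * ec * F ^ 22 + 2) + 1) + 16 * ?n * gc / F ^ 4 + 1"
        using \<Lambda> F1 by (intro add_mono mult_left_mono order_refl) auto
      also have "\<dots> \<le> B" unfolding B_def using \<Lambda> by (intro high_algebra[OF F1 ec1 gc1 FN]) (auto simp: F_def)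
      finally show "norm (\<Sum>t\<in>{m..M}. ee (phase (\<mu> x) (\<mu> y) (real_of_int (x - y)) (real_of_int t))) \<le> B" .
    qed (use N xy sub in auto)
    also have "\<dots> = K * (1 / F ^ 4) / ?n" using n by (simp add: B_def K_def)
    finally show "norm (correlation S N (\<mu> x) x N (\<mu> y) y) \<le> K * (1 / F ^ 4) / ?n" .
  qed (use N sub K6 in auto)
  also have "sqrt (48 * K * (1 / F ^ 4)) \<le> 298 * sqrt (ec * gc) * ?n powr (- (2 - c) / 16)"
  proof (rule real_le_lsqrt)
    have "(?n powr (- (2 - c) / 16))\<^sup>2 = 1 / F ^ 4" unfolding Fm4 by (simp add: power2_eq_square flip: powr_add)
    moreover have "(298::real)\<^sup>2 = 88804" by simp
    ultimately have "(298 * sqrt (ec * gc) * ?n powr (- (2 - c) / 16))\<^sup>2 = 88804 * (ec * gc) * (1 / F ^ 4)"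
      using eg1 by (simp add: power_mult_distrib)
    then show "48 * K * (1 / F ^ 4) \<le> (298 * sqrt (ec * gc) * ?n powr (- (2 - c) / 16))\<^sup>2"
      using eg1 F1 by (simp add: K_def divide_right_mono)
  qed (use eg1 in auto)
  finally show ?thesis by (simp add: mult_right_mono)
qed

end

section \<open>Trigonometric approximation of the fractional part\<close>

definition dirichlet :: "nat \<Rightarrow> real \<Rightarrow> complex" where "dirichlet L u = (\<Sum>r<L. ee (real r * u))"

lemma ee_power: "ee (real r * u) = ee u ^ r"
  by (simp only: ee_def Complex.DeMoivre mult_ac)

lemma ee_neq_1: "sin (pi * u) \<noteq> 0 \<Longrightarrow> ee u \<noteq> 1"
  using ee_diff_1[of u] by auto

lemma dirichlet_le:
  assumes "sin (pi * u) \<noteq> 0" shows "norm (dirichlet L u) \<le> 1 / \<bar>sin (pi * u)\<bar>"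
proof -
  have z: "ee u \<noteq> 1" using assms by (rule ee_neq_1)
  have "dirichlet L u = (ee u ^ L - 1) / (ee u - 1)" unfolding dirichlet_def ee_power using z by (rule geometric_sum)
  then have "norm (dirichlet L u) = norm (ee u ^ L - 1) / (2 * \<bar>sin (pi * u)\<bar>)" by (simp add: norm_divide ee_diff_1)
  also have "\<dots> \<le> 2 / (2 * \<bar>sin (pi * u)\<bar>)"
    using norm_triangle_ineq4[of "ee u ^ L" 1] by (intro divide_right_mono) (auto simp: norm_power)
  finally show ?thesis by simp
qed

lemma dirichlet_le_dist:
  assumes D: "0 < D" "D \<le> \<bar>w\<bar>" "\<bar>w\<bar> \<le> 1 - D"
  shows "(norm (dirichlet L w))\<^sup>2 \<le> 1 / (4 * D\<^sup>2)"
proof -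
  have s: "sin (pi * \<bar>w\<bar>) \<ge> 2 * D" using D by (intro sin_pi_ge) auto
  have "\<bar>sin (pi * w)\<bar> = \<bar>sin (pi * \<bar>w\<bar>)\<bar>" by (cases "w \<ge> 0") auto
  then have s': "\<bar>sin (pi * w)\<bar> \<ge> 2 * D" using s by simp
  then have "norm (dirichlet L w) \<le> 1 / \<bar>sin (pi * w)\<bar>" using D by (intro dirichlet_le) auto
  also have "\<dots> \<le> 1 / (2 * D)" using s' D by (intro frac_le) auto
  finally have "(norm (dirichlet L w))\<^sup>2 \<le> (1 / (2 * D))\<^sup>2" by (intro power_mono) auto
  then show ?thesis by (simp add: power_divide power_mult_distrib)
qed

lemma dirichlet_square: "complex_of_real ((norm (dirichlet L u))\<^sup>2) = (\<Sum>r<L. \<Sum>s<L. ee ((real r - real s) * u))"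
  unfolding complex_norm_square dirichlet_def cnj_sum sum_product
  by (simp add: left_diff_distrib ee_diff)

lemma dirichlet_periodic: "dirichlet L (u + of_int k) = dirichlet L u"
proof -
  have "ee (real r * (u + of_int k)) = ee (real r * u)" for r
  proof -
    have "real r * (u + of_int k) = real r * u + of_int (int r * k)" by (simp add: distrib_left)
    then show ?thesis by (simp only: ee_add ee_int) simp
  qed
  then show ?thesis by (simp add: dirichlet_def)
qed

lemma roots_of_unity_sum:
  assumes L: "r < L" "s < L" "r \<noteq> s"
  shows "(\<Sum>a<L. ee ((real r - real s) * - (real a / real L))) = 0"
proof -
  define x where "x = - (real r - real s) / real L"
  have "\<bar>x\<bar> = \<bar>real r - real s\<bar> / real L" by (simp add: x_def abs_minus_commute)
  moreover have "\<bar>real r - real s\<bar> < real L" using L by linarith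
  ultimately have x: "0 < \<bar>x\<bar>" "\<bar>x\<bar> < 1" using L by auto
  have "sin (pi * \<bar>x\<bar>) > 0" using x by (intro sin_gt_zero) auto
  then have "sin (pi * x) \<noteq> 0" by (cases "x \<ge> 0") auto
  then have z: "ee x \<noteq> 1" by (rule ee_neq_1)
  have "(real r - real s) * - (real a / real L) = real a * x" for a by (simp add: x_def algebra_simps diff_divide_distrib)
  then have "(\<Sum>a<L. ee ((real r - real s) * - (real a / real L))) = (\<Sum>a<L. ee x ^ a)" by (simp add: ee_power)
  also have "\<dots> = (ee x ^ L - 1) / (ee x - 1)" using z by (rule geometric_sum)
  also have "ee x ^ L = 1"
  proof -
    have "ee x ^ L = ee (real L * x)" by (simp add: ee_power)
    also have "real L * x = real_of_int (int s - int r)" using L by (simp add: x_def)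
    finally show ?thesis by (simp only: ee_int)
  qed
  finally show ?thesis by simp
qed

text \<open>Orthogonality of the L-th roots of unity kills all pairs r \<noteq> s. After division by
  L^2 the Fejer kernels at the nodes a / L form a partition of unity.\<close>

lemma fejer_partition:
  assumes L: "L \<ge> 1"
  shows "(\<Sum>a<L. (norm (dirichlet L (u - real a / real L)))\<^sup>2) = (real L)\<^sup>2"
proof -
  have "complex_of_real (\<Sum>a<L. (norm (dirichlet L (u - real a / real L)))\<^sup>2) = (\<Sum>a<L. \<Sum>r<L. \<Sum>s<L. ee ((real r - real s) * (u - real a / real L)))"
    by (simp only: of_real_sum dirichlet_square)
  also have "\<dots> = (\<Sum>r<L. \<Sum>a<L. \<Sum>s<L. ee ((real r - real s) * (u - real a / real L)))" by (rule sum.swap)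
  also have "\<dots> = (\<Sum>r<L. \<Sum>s<L. \<Sum>a<L. ee ((real r - real s) * (u - real a / real L)))" by (intro sum.cong refl sum.swap)
  also have "\<dots> = (\<Sum>r<L. \<Sum>s<L. ee ((real r - real s) * u) * (\<Sum>a<L. ee ((real r - real s) * - (real a / real L))))"
    unfolding sum_distrib_left by (intro sum.cong refl) (simp add: algebra_simps flip: ee_add)
  also have "\<dots> = (\<Sum>r<L. \<Sum>s<L. if s = r then complex_of_real (real L) else 0)"
  proof (intro sum.cong refl)
    fix r s assume "r \<in> {..<L}" "s \<in> {..<L}"
    then show "ee ((real r - real s) * u) * (\<Sum>a<L. ee ((real r - real s) * - (real a / real L))) = (if s = r then complex_of_real (real L) else 0)"
      using roots_of_unity_sum[of r L s] by (cases "s = r") auto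
  qed
  also have "\<dots> = complex_of_real ((real L)\<^sup>2)" by (simp add: power2_eq_square)
  finally show ?thesis by (simp only: of_real_eq_iff)
qed

text \<open>The values of v \<mapsto> ee (- t v) at the nodes a / L are averaged with the weights of
  the Fejer partition, and these are the resulting coefficients. Equal frequencies r - s are not
  collected: there are L^2 coefficients of size at most 1 / L, so the approximation costs a factor
  L.\<close>

definition fejer_coeff :: "nat \<Rightarrow> real \<Rightarrow> nat \<Rightarrow> nat \<Rightarrow> complex" where
  "fejer_coeff L t r s = (\<Sum>a<L. ee (- t * (real a / real L)) * ee ((real r - real s) * - (real a / real L))) / of_real ((real L)\<^sup>2)"

definition fejer_mean :: "nat \<Rightarrow> real \<Rightarrow> real \<Rightarrow> complex" where
  "fejer_mean L t u = (\<Sum>r<L. \<Sum>s<L. fejer_coeff L t r s * ee ((real r - real s) * u))"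

lemma fejer_coeff_le: assumes "L \<ge> 1" shows "norm (fejer_coeff L t r s) \<le> 1 / real L"
proof -
  have "norm (\<Sum>a<L. ee (- t * (real a / real L)) * ee ((real r - real s) * - (real a / real L))) \<le> (\<Sum>a<L. 1)"
    by (rule sum_norm_le) (simp add: norm_mult)
  then show ?thesis using assms unfolding fejer_coeff_def norm_divide norm_of_real
    by (simp add: power2_eq_square divide_le_eq)
qed

lemma fejer_mean_eq: "fejer_mean L t u = (\<Sum>a<L. ee (- t * (real a / real L)) * of_real ((norm (dirichlet L (u - real a / real L)))\<^sup>2)) / of_real ((real L)\<^sup>2)"
proof -
  have "fejer_mean L t u = (\<Sum>r<L. \<Sum>s<L. \<Sum>a<L. ee (- t * (real a / real L)) * ee ((real r - real s) * (u - real a / real L))) / of_real ((real L)\<^sup>2)"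
    unfolding fejer_mean_def fejer_coeff_def times_divide_eq_left sum_distrib_right sum_divide_distrib
    by (intro sum.cong refl) (simp add: algebra_simps flip: ee_add)
  also have "(\<Sum>r<L. \<Sum>s<L. \<Sum>a<L. ee (- t * (real a / real L)) * ee ((real r - real s) * (u - real a / real L)))
    = (\<Sum>r<L. \<Sum>a<L. \<Sum>s<L. ee (- t * (real a / real L)) * ee ((real r - real s) * (u - real a / real L)))"
    by (intro sum.cong refl sum.swap)
  also have "\<dots> = (\<Sum>a<L. \<Sum>r<L. \<Sum>s<L. ee (- t * (real a / real L)) * ee ((real r - real s) * (u - real a / real L)))"
    by (rule sum.swap)
  also have "\<dots> = (\<Sum>a<L. ee (- t * (real a / real L)) * of_real ((norm (dirichlet L (u - real a / real L)))\<^sup>2))"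
    by (simp only: dirichlet_square sum_distrib_left)
  finally show ?thesis .
qed

text \<open>Nodes closer than D cost pi D by the Lipschitz bound, as |t| \<le> 1/2; every other node
  has weight at most 1 / (4 D^2) before division by L^2. Distance from both ends of the unit
  interval prevents a far node from being close modulo 1, where the approximated function
  jumps.\<close>

lemma fejer_error:
  assumes L: "L \<ge> 1" and t: "\<bar>t\<bar> \<le> 1 / 2"
  shows "norm (ee (- t * frac u) - fejer_mean L t u) \<le> 2"
    and "0 < D \<Longrightarrow> D \<le> frac u \<Longrightarrow> frac u \<le> 1 - D \<Longrightarrow> norm (ee (- t * frac u) - fejer_mean L t u) \<le> pi * D + 1 / (2 * D\<^sup>2 * real L)"
proof -
  define v where "v = frac u"
  define q where "q a = real a / real L" for a
  define W where "W a = (norm (dirichlet L (v - q a)))\<^sup>2" for a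
  have v: "0 \<le> v" "v < 1" by (auto simp: v_def frac_lt_1)
  have per: "dirichlet L (u - q a) = dirichlet L (v - q a)" for a
  proof -
    have "u - q a = (v - q a) + of_int \<lfloor>u\<rfloor>" by (simp add: v_def frac_def)
    then show ?thesis by (simp only: dirichlet_periodic)
  qed
  have part: "(\<Sum>a<L. W a) = (real L)\<^sup>2" unfolding W_def q_def by (rule fejer_partition[OF L])
  have L0: "real L > 0" using L by simp
  have fe: "fejer_mean L t u = (\<Sum>a<L. ee (- t * q a) * of_real (W a)) / of_real ((real L)\<^sup>2)"
    unfolding fejer_mean_eq using per by (simp add: W_def q_def)
  have "ee (- t * v) = (\<Sum>a<L. ee (- t * v) * of_real (W a)) / of_real ((real L)\<^sup>2)"
    unfolding sum_distrib_left[symmetric] of_real_sum[symmetric] part using L0 by simp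
  then have diff: "ee (- t * v) - fejer_mean L t u = (\<Sum>a<L. (ee (- t * v) - ee (- t * q a)) * of_real (W a)) / of_real ((real L)\<^sup>2)"
    unfolding fe by (simp add: left_diff_distrib sum_subtractf diff_divide_distrib)
  have W0: "W a \<ge> 0" for a by (simp add: W_def)
  \<comment> \<open>A bound b W + b' at each node sums to b L^2 + b' L, that is b + b' / L after
    normalisation.\<close>
  have main: "norm (ee (- t * v) - fejer_mean L t u) \<le> B" if B: "\<And>a. a < L \<Longrightarrow> norm (ee (- t * v) - ee (- t * q a)) * W a \<le> b * W a + b'"
      "b + b' / real L \<le> B" for b b' B
  proof -
    have "norm (ee (- t * v) - fejer_mean L t u) = norm (\<Sum>a<L. (ee (- t * v) - ee (- t * q a)) * of_real (W a)) / (real L)\<^sup>2"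
      unfolding diff norm_divide norm_of_real by simp
    also have "\<dots> \<le> (\<Sum>a<L. b * W a + b') / (real L)\<^sup>2"
    proof (intro divide_right_mono sum_norm_le)
      fix a assume "a \<in> {..<L}"
      then show "norm ((ee (- t * v) - ee (- t * q a)) * of_real (W a)) \<le> b * W a + b'"
        using B(1)[of a] W0[of a] unfolding norm_mult norm_of_real by simp
    qed simp
    also have "\<dots> = b + b' / real L"
      unfolding sum.distrib sum_distrib_left[symmetric] part using L0 by (simp add: field_simps power2_eq_square)
    finally show ?thesis using B(2) by simp
  qed
  have two: "norm (ee (- t * v) - ee (- t * q a)) \<le> 2" for a
    using norm_triangle_ineq4[of "ee (- t * v)" "ee (- t * q a)"] by simp
  show "norm (ee (- t * frac u) - fejer_mean L t u) \<le> 2"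
    unfolding v_def[symmetric]
  proof (rule main[of 2 0])
    fix a show "norm (ee (- t * v) - ee (- t * q a)) * W a \<le> 2 * W a + 0"
      using mult_right_mono[OF two W0] by simp
  qed simp
  show "norm (ee (- t * frac u) - fejer_mean L t u) \<le> pi * D + 1 / (2 * D\<^sup>2 * real L)" if D: "0 < D" "D \<le> frac u" "frac u \<le> 1 - D"
    unfolding v_def[symmetric]
  proof (rule main[of "pi * D" "2 * (1 / (4 * D\<^sup>2))"])
    fix a assume a: "a < L"
    have qa: "0 \<le> q a" "q a < 1" using a by (auto simp: q_def)
    show "norm (ee (- t * v) - ee (- t * q a)) * W a \<le> pi * D * W a + 2 * (1 / (4 * D\<^sup>2))"
    proof (cases "\<bar>v - q a\<bar> < D")
      case True
      have "norm (ee (- t * v) - ee (- t * q a)) \<le> 2 * pi * \<bar>- t * v - - t * q a\<bar>" by (rule ee_lipschitz)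
      also have "\<bar>- t * v - - t * q a\<bar> = \<bar>t\<bar> * \<bar>v - q a\<bar>" by (simp flip: abs_mult) (simp add: algebra_simps abs_minus_commute)
      also have "\<dots> \<le> 1 / 2 * D" using t True by (intro mult_mono) auto
      finally have "norm (ee (- t * v) - ee (- t * q a)) \<le> pi * D" by simp
      then have "norm (ee (- t * v) - ee (- t * q a)) * W a \<le> pi * D * W a" using W0 by (intro mult_right_mono)
      moreover have "0 \<le> 2 * (1 / (4 * D\<^sup>2))" by simp
      ultimately show ?thesis by linarith
    next
      case False
      have "W a \<le> 1 / (4 * D\<^sup>2)" unfolding W_def
        using D False qa by (intro dirichlet_le_dist) (auto simp: v_def abs_le_iff)
      then have "norm (ee (- t * v) - ee (- t * q a)) * W a \<le> 2 * (1 / (4 * D\<^sup>2))"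
        using two W0 by (intro mult_mono) auto
      moreover have "0 \<le> pi * D * W a" using D W0 by simp
      ultimately show ?thesis by linarith
    qed
  qed (use L0 D in \<open>simp add: field_simps\<close>)
qed

text \<open>All M angles are at most pi / 4 in modulus modulo 2 pi, hence at most pi / 3, so every
  term has real part at least 1/2.\<close>

lemma dirichlet_ge_near_int:
  assumes M: "M \<ge> 1" and u: "frac u < 1 / (8 * real M) \<or> frac u > 1 - 1 / (8 * real M)"
  shows "(norm (dirichlet M u))\<^sup>2 \<ge> (real M)\<^sup>2 / 4"
proof -
  obtain x k where x: "u = x + of_int k" "\<bar>x\<bar> \<le> 1 / (8 * real M)"
    using u
  proof
    assume "frac u < 1 / (8 * real M)"
    then show thesis by (intro that[of "frac u" "\<lfloor>u\<rfloor>"]) (auto simp: frac_def)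
  next
    assume "frac u > 1 - 1 / (8 * real M)"
    moreover have "frac u < 1" by (rule frac_lt_1)
    ultimately show thesis by (intro that[of "frac u - 1" "\<lfloor>u\<rfloor> + 1"]) (auto simp: frac_def abs_if)
  qed
  have "Re (ee (real r * x)) \<ge> 1 / 2" if "r < M" for r
  proof -
    have "\<bar>2 * pi * (real r * x)\<bar> = 2 * pi * (real r * \<bar>x\<bar>)" by (simp add: abs_mult)
    also have "\<dots> \<le> 2 * pi * (real M * (1 / (8 * real M)))" using x that by (intro mult_left_mono mult_mono) auto
    also have "\<dots> \<le> pi / 3" using M by simp
    finally have "cos (pi / 3) \<le> cos \<bar>2 * pi * (real r * x)\<bar>" by (intro cos_monotone_0_pi_le) auto
    then show ?thesis by (simp add: ee_def cos_60)
  qed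
  then have "(\<Sum>r<M. 1 / 2) \<le> (\<Sum>r<M. Re (ee (real r * x)))" by (intro sum_mono) auto
  also have "\<dots> = Re (dirichlet M x)" by (simp add: dirichlet_def)
  also have "\<dots> \<le> norm (dirichlet M u)" unfolding x(1) dirichlet_periodic by (rule complex_Re_le_cmod)
  finally have "(real M / 2)\<^sup>2 \<le> (norm (dirichlet M u))\<^sup>2" by (intro power_mono) auto
  then show ?thesis by (simp add: power_divide)
qed

text \<open>The function 4 |D_M|^2 / M^2, with D_M the Dirichlet kernel, majorises the indicator of
  the neighbourhood of the integers. Expanding the square leaves the zero frequency, M times, and
  fewer than M^2 exponential sums of frequency below M.\<close>

lemma count_near_int:
  fixes u :: "int \<Rightarrow> real"
  assumes M: "M \<ge> 1" and I: "finite I" and B0: "B \<ge> 0"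
    and B: "\<And>l. l \<noteq> 0 \<Longrightarrow> \<bar>l\<bar> < int M \<Longrightarrow> norm (\<Sum>n\<in>I. ee (real_of_int l * u n)) \<le> B"
  shows "real (card {n\<in>I. frac (u n) < 1 / (8 * real M) \<or> frac (u n) > 1 - 1 / (8 * real M)}) \<le> 4 * real (card I) / real M + 4 * B"
proof -
  define A where "A = {n\<in>I. frac (u n) < 1 / (8 * real M) \<or> frac (u n) > 1 - 1 / (8 * real M)}"
  have fin: "finite A" using I by (simp add: A_def)
  have M0: "real M > 0" using M by simp
  have "real (card A) * ((real M)\<^sup>2 / 4) = (\<Sum>n\<in>A. (real M)\<^sup>2 / 4)" by simp
  also have "\<dots> \<le> (\<Sum>n\<in>A. (norm (dirichlet M (u n)))\<^sup>2)"
    by (intro sum_mono dirichlet_ge_near_int M) (auto simp: A_def)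
  also have "\<dots> \<le> (\<Sum>n\<in>I. (norm (dirichlet M (u n)))\<^sup>2)" using I by (intro sum_mono2) (auto simp: A_def)
  also have "\<dots> = norm (complex_of_real (\<Sum>n\<in>I. (norm (dirichlet M (u n)))\<^sup>2))"
    by (simp only: norm_of_real) (simp add: sum_nonneg)
  also have "complex_of_real (\<Sum>n\<in>I. (norm (dirichlet M (u n)))\<^sup>2) = (\<Sum>n\<in>I. \<Sum>r<M. \<Sum>s<M. ee ((real r - real s) * u n))"
    by (simp only: of_real_sum dirichlet_square)
  also have "\<dots> = (\<Sum>r<M. \<Sum>n\<in>I. \<Sum>s<M. ee ((real r - real s) * u n))" by (rule sum.swap)
  also have "\<dots> = (\<Sum>r<M. \<Sum>s<M. \<Sum>n\<in>I. ee ((real r - real s) * u n))" by (intro sum.cong refl sum.swap)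
  also have "norm \<dots> \<le> (\<Sum>r<M. \<Sum>s<M. (if s = r then real (card I) else B))"
  proof (intro sum_norm_le)
    fix r s assume rs: "r \<in> {..<M}" "s \<in> {..<M}"
    show "norm (\<Sum>n\<in>I. ee ((real r - real s) * u n)) \<le> (if s = r then real (card I) else B)"
    proof (cases "s = r")
      case False
      then have "norm (\<Sum>n\<in>I. ee (real_of_int (int r - int s) * u n)) \<le> B" using rs by (intro B) auto
      then show ?thesis using False by simp
    qed simp
  qed
  also have "\<dots> \<le> (\<Sum>r<M. real (card I) + real M * B)"
  proof (rule sum_mono)
    fix r assume r: "r \<in> {..<M}"
    have "(\<Sum>s<M. (if s = r then real (card I) else B)) = real (card I) + (real M - 1) * B"
    proof -
      have "(\<Sum>s<M. (if s = r then real (card I) else B)) = (\<Sum>s<M. B + (if s = r then real (card I) - B else 0))"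
        by (intro sum.cong refl) auto
      also have "\<dots> = real M * B + (real (card I) - B)" using r by (simp add: sum.distrib)
      finally show ?thesis by (simp add: algebra_simps)
    qed
    also have "\<dots> \<le> real (card I) + real M * B" using B0 by (simp add: left_diff_distrib)
    finally show "(\<Sum>s<M. (if s = r then real (card I) else B)) \<le> real (card I) + real M * B" .
  qed
  also have "\<dots> = real M * (real (card I) + real M * B)" by simp
  finally have "real (card A) \<le> real M * (real (card I) + real M * B) / ((real M)\<^sup>2 / 4)"
    using M0 by (simp add: pos_le_divide_eq)
  also have "\<dots> = 4 * real (card I) / real M + 4 * B" using M0 by (simp add: field_simps power2_eq_square)
  finally show ?thesis by (simp add: A_def)
qed

text \<open>Young's inequality: after extension of \<open>g\<close> by zero, every translate has
  norm at most that of \<open>g\<close>.\<close>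

lemma convolution_bound:
  fixes k :: "int \<Rightarrow> real" and g :: "int \<Rightarrow> real"
  assumes X: "finite X" and S: "finite S" and I: "finite I" and k0: "\<And>n. k n \<ge> 0" and kI: "\<And>n. n \<notin> I \<Longrightarrow> k n = 0"
    and g0: "\<And>m. g m \<ge> 0"
  shows "L2_set (\<lambda>x. \<Sum>m\<in>S. k (x - m) * g m) X \<le> (\<Sum>n\<in>I. k n) * L2_set g S"
proof -
  define g' where "g' m = (if m \<in> S then g m else 0)" for m
  have "(\<Sum>m\<in>S. k (x - m) * g m) = (\<Sum>n\<in>I. k n * g' (x - n))" for x
  proof -
    have "(\<Sum>m\<in>S. k (x - m) * g m) = (\<Sum>m\<in>S \<union> (\<lambda>n. x - n) ` I. k (x - m) * g' m)"
      using S I by (intro sum.mono_neutral_cong_left) (auto simp: g'_def)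
    also have "\<dots> = (\<Sum>m\<in>(\<lambda>n. x - n) ` I. k (x - m) * g' m)"
    proof (rule sum.mono_neutral_right)
      show "\<forall>i\<in>S \<union> (\<lambda>n. x - n) ` I - (\<lambda>n. x - n) ` I. k (x - i) * g' i = 0"
      proof
        fix i assume "i \<in> S \<union> (\<lambda>n. x - n) ` I - (\<lambda>n. x - n) ` I"
        then have "x - i \<notin> I" by (metis Diff_iff diff_diff_eq2 add_diff_cancel_left' image_eqI)
        then show "k (x - i) * g' i = 0" using kI by simp
      qed
    qed (use S I in auto)
    also have "\<dots> = (\<Sum>n\<in>I. k n * g' (x - n))" by (subst sum.reindex) (auto simp: inj_on_def)
    finally show ?thesis .
  qed
  then have "L2_set (\<lambda>x. \<Sum>m\<in>S. k (x - m) * g m) X = L2_set (\<lambda>x. \<Sum>n\<in>I. k n * g' (x - n)) X" by simp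
  also have "\<dots> \<le> (\<Sum>n\<in>I. L2_set (\<lambda>x. k n * g' (x - n)) X)" by (rule L2_set_sum_le[OF I])
  also have "\<dots> \<le> (\<Sum>n\<in>I. k n * L2_set g S)"
  proof (rule sum_mono)
    fix n
    have "(\<Sum>x\<in>X. (g' (x - n))\<^sup>2) = (\<Sum>m\<in>(\<lambda>x. x - n) ` X. (g' m)\<^sup>2)"
      by (subst sum.reindex) (auto simp: inj_on_def)
    also have "\<dots> \<le> (\<Sum>m\<in>(\<lambda>x. x - n) ` X \<union> S. (g' m)\<^sup>2)" using X S by (intro sum_mono2) auto
    also have "\<dots> = (\<Sum>m\<in>S. (g m)\<^sup>2)" using X S by (intro sum.mono_neutral_cong_right) (auto simp: g'_def)
    finally have "L2_set (\<lambda>x. g' (x - n)) X \<le> L2_set g S" unfolding L2_set_def by (rule real_sqrt_le_mono)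
    moreover have "L2_set (\<lambda>x. k n * g' (x - n)) X = k n * L2_set (\<lambda>x. g' (x - n)) X"
      using k0 by (simp add: L2_set_right_distrib)
    ultimately show "L2_set (\<lambda>x. k n * g' (x - n)) X \<le> k n * L2_set g S" using k0 by (simp add: mult_left_mono)
  qed
  finally show ?thesis by (simp add: sum_distrib_right)
qed

section \<open>Blocks with large modulation\<close>

text \<open>Meant for G^100 = n^(2 - c). The main product is of order e n G^(1 - 100 + 50) = e n /
  G^49, far below e n / G.\<close>

lemma count_algebra:
  fixes G e n M :: real
  assumes "1 \<le> G" "1 \<le> e" "G ^ 100 \<le> n" "0 \<le> M" "M \<le> 2 * G"
  shows "(8 * M * (n / G ^ 100) + 2) * (5 * e * G ^ 50 + 2) + 1 \<le> 127 * (e * (n / G))"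
proof -
  have "1 \<le> G ^ 100" using assms by (intro one_le_power)
  then have n: "n \<ge> 1" using assms by linarith
  have p: "8 * M * (n / G ^ 100) + 2 \<le> 18 * (G * (n / G ^ 100))"
  proof -
    have "8 * M * (n / G ^ 100) \<le> 8 * (2 * G) * (n / G ^ 100)" using assms n by (intro mult_right_mono) auto
    moreover have "1 * 1 \<le> G * (n / G ^ 100)" using assms by (intro mult_mono) (auto simp: pos_le_divide_eq)
    ultimately show ?thesis by simp
  qed
  have q: "5 * e * G ^ 50 + 2 \<le> 7 * (e * G ^ 50)"
    using mult_mono[of 1 e 1 "G ^ 50"] assms by (simp add: one_le_power)
  have "(8 * M * (n / G ^ 100) + 2) * (5 * e * G ^ 50 + 2) \<le> 18 * (G * (n / G ^ 100)) * (7 * (e * G ^ 50))"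
    using assms n by (intro mult_mono p q) auto
  also have "\<dots> = 126 * (e * (n * (G ^ 51 / G ^ 100)))" by (simp add: power_numeral_reduce)
  also have "G ^ 51 / G ^ 100 = 1 / G ^ 49" using assms by (simp add: divide_simps flip: power_add)
  also have "126 * (e * (n * (1 / G ^ 49))) \<le> 126 * (e * (n * (1 / G ^ 1)))"
    using assms n by (intro mult_left_mono divide_left_mono power_increasing) auto
  finally have "(8 * M * (n / G ^ 100) + 2) * (5 * e * G ^ 50 + 2) \<le> 126 * (e * (n / G))" by simp
  moreover have "1 \<le> e * (n / G)"
  proof -
    have "G ^ 1 \<le> G ^ 100" using assms by (intro power_increasing) auto
    then have "1 \<le> n / G" using assms by (simp add: pos_le_divide_eq)
    then show ?thesis using assms mult_mono[of 1 e 1 "n / G"] by simp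
  qed
  ultimately show ?thesis by linarith
qed

context exponent
begin

definition floor_block_kernel :: "nat \<Rightarrow> real \<Rightarrow> int \<Rightarrow> complex" where
  "floor_block_kernel N t n = (if int N < n \<and> n \<le> 2 * int N then ee (t * of_int \<lfloor>real_of_int n powr c\<rfloor>) / of_int n else 0)"

text \<open>The neighbourhood has width of order 1 / G, so the bound is the expected count up to
  constants. The constant is 4 + 4 * 127. The loss is \<open>ec\<close> and not its square root,
  because no TT* argument intervenes.\<close>

lemma near_int_count:
  fixes N :: nat
  assumes N: "1 \<le> N"
  defines "G \<equiv> real N powr ((2 - c) / 100)"
  defines "M \<equiv> nat \<lceil>G\<rceil>"
  shows "real (card {n\<in>{int N + 1..2 * int N}. frac (real_of_int n powr c) < 1 / (8 * real M) \<or> frac (real_of_int n powr c) > 1 - 1 / (8 * real M)})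
    \<le> 512 * ec * real N / G"
proof -
  let ?n = "real N"
  have n: "?n \<ge> 1" using N by simp
  have G1: "G \<ge> 1" unfolding G_def using n c2 by (intro ge_one_powr_ge_zero) auto
  have M: "G \<le> real M" "real M \<le> 2 * G" "M \<ge> 1" using G1 by (auto simp: M_def) linarith+
  have Gk: "G ^ 100 = ?n powr (2 - c)"
  proof -
    have "G ^ 100 = G powr real 100" using G1 by (subst powr_realpow) auto
    also have "\<dots> = ?n powr ((2 - c) / 100 * real 100)" by (simp only: G_def powr_powr)
    also have "(2 - c) / 100 * real 100 = 2 - c" by (simp add: field_simps)
    finally show ?thesis .
  qed
  have Gn: "G ^ 100 \<le> ?n" unfolding Gk using n c1 powr_mono[of "2 - c" 1 ?n] by simp
  have c2': "?n powr (c - 2) = 1 / G ^ 100"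
  proof -
    have "?n powr (c - 2) = ?n powr (- (2 - c))" by simp
    then show ?thesis unfolding Gk by (simp only: powr_minus_divide)
  qed
  have c1': "?n powr (c - 1) = ?n / G ^ 100"
  proof -
    have "?n powr (c - 1) = ?n powr (c - 2) * ?n powr 1" by (simp only: flip: powr_add) simp
    then show ?thesis using n by (simp add: c2')
  qed
  define B where "B = 127 * (ec * (?n / G))"
  have B0: "B \<ge> 0" using ec1 G1 by (simp add: B_def)
  have "real (card {n\<in>{int N + 1..2 * int N}. frac (real_of_int n powr c) < 1 / (8 * real M) \<or> frac (real_of_int n powr c) > 1 - 1 / (8 * real M)})
    \<le> 4 * real (card {int N + 1..2 * int N}) / real M + 4 * B"
  proof (rule count_near_int[OF M(3) _ B0])
    fix l :: int assume l: "l \<noteq> 0" "\<bar>l\<bar> < int M"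
    have l': "1 \<le> \<bar>real_of_int l\<bar>" "\<bar>real_of_int l\<bar> \<le> real M" using l by linarith+
    have "norm (\<Sum>n\<in>{int N + 1..2 * int N}. ee (real_of_int l * real_of_int n powr c))
      \<le> (8 * real M * ?n powr (c - 1) + 2) * (3 / sqrt ((c - 1) * ?n powr (c - 2) / 2) + 2) + 1"
      using n by (intro exp_sum_single l') auto
    also have "\<dots> \<le> (8 * real M * (?n / G ^ 100) + 2) * (5 * ec * G ^ 50 + 2) + 1"
    proof -
      define w where "w = 3 / (5 * ec * G ^ 50)"
      have w0: "w > 0" using ec1 G1 by (simp add: w_def)
      define z where "z = 1 / (ec\<^sup>2 * G ^ 100)"
      have "(G ^ 50)\<^sup>2 = G ^ 100" by (simp flip: power_mult)
      then have "w\<^sup>2 = 9/25 * z" by (simp add: w_def z_def power_divide power_mult_distrib)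
      moreover have "z \<ge> 0" using G1 by (simp add: z_def)
      moreover have "(c - 1) * ?n powr (c - 2) / 2 = z / 2" by (simp add: ec_sq c2' z_def)
      ultimately have "w \<le> sqrt ((c - 1) * ?n powr (c - 2) / 2)" by (intro real_le_rsqrt) simp
      then have "3 / sqrt ((c - 1) * ?n powr (c - 2) / 2) \<le> 3 / w" using w0 by (intro frac_le) auto
      also have "3 / w = 5 * ec * G ^ 50" by (simp add: w_def)
      finally show ?thesis unfolding c1' using n G1
        by (intro add_mono mult_left_mono order_refl) auto
    qed
    also have "\<dots> \<le> B" unfolding B_def using M by (intro count_algebra G1 ec1 Gn) auto
    finally show "norm (\<Sum>n\<in>{int N + 1..2 * int N}. ee (real_of_int l * real_of_int n powr c)) \<le> B" .
  qed simp
  also have "real (card {int N + 1..2 * int N}) = ?n" by simp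
  also have "4 * ?n / real M \<le> 4 * (ec * (?n / G))"
  proof -
    have "4 * ?n / real M \<le> 4 * ?n / G" using M G1 by (intro divide_left_mono) auto
    also have "\<dots> \<le> ec * (4 * ?n / G)" using ec1 G1 mult_right_mono[of 1 ec "4 * ?n / G"] by simp
    also have "ec * (4 * ?n / G) = 4 * (ec * (?n / G))" by (simp add: mult_ac)
    finally show ?thesis by simp
  qed
  finally show ?thesis by (simp add: B_def mult_ac)
qed

text \<open>The Fejer mean of the fractional part turns the kernel into a combination of L^2 smooth
  kernels with modulations t + r - k, each covered by \<open>block_high\<close>. Their total weight
  L is a small power of N and is paid from the exponent 1/16, of which 1/100 is kept. The error has
  a majorant independent of x, so Young's inequality handles it.\<close>

lemma floor_high:
  fixes N :: nat and t :: "int \<Rightarrow> real"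
  assumes X: "finite X" and S: "finite S" and N: "1 \<le> N"
    and t: "\<And>x. x \<in> X \<Longrightarrow> real N powr (- (2 - c) / 8) \<le> \<bar>t x\<bar> \<and> \<bar>t x\<bar> \<le> 1 / 2"
    and sub: "\<And>x n. x \<in> X \<Longrightarrow> int N < n \<Longrightarrow> n \<le> 2 * int N \<Longrightarrow> x - n \<in> S"
  shows "L2_set (\<lambda>x. norm (\<Sum>m\<in>S. floor_block_kernel N (t x) (x - m) * f m)) X
    \<le> 3441 * (ec * gc) * real N powr (- (2 - c) / 100) * L2_set (\<lambda>m. norm (f m)) S"
proof -
  let ?n = "real N" and ?F = "L2_set (\<lambda>m. norm (f m)) S"
  define G where "G = ?n powr ((2 - c) / 100)"
  define M where "M = nat \<lceil>G\<rceil>"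
  \<comment> \<open>With D = 1 / (8 M), the far-node error 1 / (2 D^2 L) equals 32 M^2 / L; the cube
    makes it 32 / M, of the same order as pi D.\<close>
  define L where "L = M ^ 3"
  define D where "D = 1 / (8 * real M)"
  have n: "?n \<ge> 1" using N by simp
  have G1: "G \<ge> 1" unfolding G_def using n c2 by (intro ge_one_powr_ge_zero) auto
  have M: "G \<le> real M" "real M \<le> 2 * G" "M \<ge> 1" using G1 by (auto simp: M_def) linarith+
  have L1: "L \<ge> 1" using M by (simp add: L_def)
  have L_le: "real L \<le> 8 * G ^ 3"
  proof -
    have "real L = real M ^ 3" by (simp add: L_def)
    also have "\<dots> \<le> (2 * G) ^ 3" using M by (intro power_mono) auto
    finally show ?thesis by (simp add: power_mult_distrib)
  qed
  have G3: "G ^ 3 = ?n powr (3 * (2 - c) / 100)" using n by (simp add: G_def powr_powr mult.commute flip: powr_realpow)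
  define bad where "bad n \<longleftrightarrow> frac (real_of_int n powr c) < D \<or> frac (real_of_int n powr c) > 1 - D" for n
  define blk where "blk = {int N + 1..2 * int N}"
  define Er where "Er n = (if n \<in> blk then (33 / real M + (if bad n then 2 else 0)) / ?n else 0)" for n
  have Er0: "Er n \<ge> 0" for n by (simp add: Er_def)
  have ptw: "norm (floor_block_kernel N s n - (\<Sum>r<L. \<Sum>k<L. fejer_coeff L s r k * block_kernel N (s + (real r - real k)) n)) \<le> Er n" if s: "\<bar>s\<bar> \<le> 1/2" for s n
  proof (cases "n \<in> blk")
    case False
    then show ?thesis by (auto simp: Er_def floor_block_kernel_def block_kernel_def blk_def)
  next
    case True
    define u where "u = real_of_int n powr c"
    have nb: "int N < n \<and> n \<le> 2 * int N" using True by (auto simp: blk_def)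
    have n0: "real_of_int n \<ge> ?n" using nb by linarith
    have "(\<Sum>r<L. \<Sum>k<L. fejer_coeff L s r k * block_kernel N (s + (real r - real k)) n) = ee (s * u) * fejer_mean L s u / of_int n"
      unfolding fejer_mean_def sum_distrib_left sum_divide_distrib
      using nb by (intro sum.cong refl) (simp add: block_kernel_def u_def distrib_right ee_add)
    moreover have "floor_block_kernel N s n = ee (s * u) * ee (- s * frac u) / of_int n"
    proof -
      have "s * of_int \<lfloor>u\<rfloor> = s * u + (- s * frac u)" by (simp add: frac_def algebra_simps)
      then show ?thesis using nb by (simp add: floor_block_kernel_def u_def[symmetric] flip: ee_add)
    qed
    ultimately have "floor_block_kernel N s n - (\<Sum>r<L. \<Sum>k<L. fejer_coeff L s r k * block_kernel N (s + (real r - real k)) n) = ee (s * u) * (ee (- s * frac u) - fejer_mean L s u) / of_int n"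
      by (simp add: diff_divide_distrib right_diff_distrib)
    then have "norm (floor_block_kernel N s n - (\<Sum>r<L. \<Sum>k<L. fejer_coeff L s r k * block_kernel N (s + (real r - real k)) n)) = norm (ee (- s * frac u) - fejer_mean L s u) / \<bar>real_of_int n\<bar>"
      by (simp add: norm_mult norm_divide)
    also have "\<dots> \<le> (33 / real M + (if bad n then 2 else 0)) / ?n"
    proof (rule frac_le)
      show "norm (ee (- s * frac u) - fejer_mean L s u) \<le> 33 / real M + (if bad n then 2 else 0)"
      proof (cases "bad n")
        case True
        have "norm (ee (- s * frac u) - fejer_mean L s u) \<le> 2" by (rule fejer_error(1)[OF L1 s])
        moreover have "0 \<le> 33 / real M" by simp
        ultimately show ?thesis unfolding if_P[OF True] by linarith
      next
        case False
        then have "D \<le> frac u" "frac u \<le> 1 - D" by (auto simp: bad_def u_def)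
        moreover have "D > 0" using M by (simp add: D_def)
        ultimately have "norm (ee (- s * frac u) - fejer_mean L s u) \<le> pi * D + 1 / (2 * D\<^sup>2 * real L)"
          by (intro fejer_error(2)[OF L1 s])
        also have "1 / (2 * D\<^sup>2 * real L) = 32 / real M"
          using M by (simp add: D_def L_def power2_eq_square power3_eq_cube field_simps)
        also have "pi * D \<le> 1 / real M" using pi_less_4 M by (simp add: D_def field_simps)
        finally show ?thesis using False by simp
      qed
    qed (use n n0 in auto)
    finally show ?thesis using True by (simp add: Er_def)
  qed
  have Ersum: "(\<Sum>n\<in>blk. Er n) \<le> 1057 * ec / G"
  proof -
    have "(\<Sum>n\<in>blk. Er n) = (\<Sum>n\<in>blk. 33 / real M / ?n) + (\<Sum>n\<in>blk. if bad n then 2 / ?n else 0)"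
      unfolding sum.distrib[symmetric] by (intro sum.cong refl) (simp add: Er_def add_divide_distrib)
    also have "(\<Sum>n\<in>blk. 33 / real M / ?n) = 33 / real M" using n by (simp add: blk_def)
    also have "(\<Sum>n\<in>blk. if bad n then 2 / ?n else 0) = real (card {n\<in>blk. bad n}) * (2 / ?n)"
      by (simp add: sum.If_cases blk_def Int_def)
    also have "real (card {n\<in>blk. bad n}) \<le> 512 * ec * ?n / G"
      using near_int_count[OF N] unfolding bad_def blk_def D_def M_def G_def by blast
    then have "real (card {n\<in>blk. bad n}) * (2 / ?n) \<le> 512 * ec * ?n / G * (2 / ?n)" by (intro mult_right_mono) auto
    also have "512 * ec * ?n / G * (2 / ?n) = 1024 * ec / G" using n by simp
    also have "33 / real M \<le> 33 * ec / G"
    proof -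
      have "33 / real M \<le> 33 / G" using M G1 by (intro divide_left_mono) auto
      also have "\<dots> \<le> ec * (33 / G)" using ec1 G1 mult_right_mono[of 1 ec "33 / G"] by simp
      also have "ec * (33 / G) = 33 * ec / G" by (simp add: mult.commute)
      finally show ?thesis by simp
    qed
    finally show ?thesis by (simp add: add_divide_distrib[symmetric])
  qed
  define T where "T r k x = (\<Sum>m\<in>S. block_kernel N (t x + (real r - real k)) (x - m) * f m)" for r k x
  have bkb: "L2_set (\<lambda>x. norm (T r k x)) X \<le> 298 * sqrt (ec * gc) * ?n powr (- (2 - c) / 16) * ?F"
    if rk: "r < L" "k < L" for r k
    unfolding T_def
  proof (rule block_high[OF X S N, where \<Lambda> = "real L"])
    have p1: "?n powr (- (2 - c) / 8) \<le> 1" using n c2 powr_mono[of "- (2 - c) / 8" 0 ?n] by simp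
    have p0: "?n powr (- (2 - c) / 8) \<ge> 0" by simp
    fix x assume x: "x \<in> X"
    show "?n powr (- (2 - c) / 8) / 2 \<le> \<bar>t x + (real r - real k)\<bar> \<and> \<bar>t x + (real r - real k)\<bar> \<le> real L"
    proof
      show "?n powr (- (2 - c) / 8) / 2 \<le> \<bar>t x + (real r - real k)\<bar>"
      \<comment> \<open>For r \<noteq> k the integer shift keeps the modulation at least 1/2 away
        from 0, as |t| \<le> 1/2; only r = k uses the lower bound on |t|.\<close>
      proof (cases "r = k")
        case True
        then have "t x + (real r - real k) = t x" by simp
        then show ?thesis using t[OF x] p0 by (simp only:) linarith
      next
        case False
        then have "\<bar>real r - real k\<bar> \<ge> 1" by linarith
        then show ?thesis using t[OF x] p1 by linarith
      qed
      show "\<bar>t x + (real r - real k)\<bar> \<le> real L" using rk t[OF x] by linarith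
    qed
  next
    have "real L \<le> 8 * G ^ 3" by (rule L_le)
    also have "\<dots> \<le> 8 * ?n powr ((2 - c) / 32)" unfolding G3 using n c2 by (intro mult_left_mono powr_mono) auto
    finally show "real L \<le> 8 * ?n powr ((2 - c) / 32)" .
  qed (use sub in auto)
  have "L2_set (\<lambda>x. norm (\<Sum>m\<in>S. floor_block_kernel N (t x) (x - m) * f m)) X
    \<le> L2_set (\<lambda>x. (\<Sum>r<L. \<Sum>k<L. 1 / real L * norm (T r k x)) + (\<Sum>m\<in>S. Er (x - m) * norm (f m))) X"
  proof (rule L2_set_mono)
    fix x assume x: "x \<in> X"
    have t2: "\<bar>t x\<bar> \<le> 1/2" using t[OF x] by simp
    have "(\<Sum>m\<in>S. floor_block_kernel N (t x) (x - m) * f m) = (\<Sum>m\<in>S. (\<Sum>r<L. \<Sum>k<L. fejer_coeff L (t x) r k * block_kernel N (t x + (real r - real k)) (x - m)) * f m)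
       + (\<Sum>m\<in>S. (floor_block_kernel N (t x) (x - m) - (\<Sum>r<L. \<Sum>k<L. fejer_coeff L (t x) r k * block_kernel N (t x + (real r - real k)) (x - m))) * f m)"
      unfolding sum.distrib[symmetric] by (intro sum.cong refl) (simp add: algebra_simps)
    also have "(\<Sum>m\<in>S. (\<Sum>r<L. \<Sum>k<L. fejer_coeff L (t x) r k * block_kernel N (t x + (real r - real k)) (x - m)) * f m)
       = (\<Sum>r<L. \<Sum>k<L. fejer_coeff L (t x) r k * T r k x)"
    proof -
      have "(\<Sum>m\<in>S. (\<Sum>r<L. \<Sum>k<L. fejer_coeff L (t x) r k * block_kernel N (t x + (real r - real k)) (x - m)) * f m)
        = (\<Sum>m\<in>S. \<Sum>r<L. \<Sum>k<L. fejer_coeff L (t x) r k * (block_kernel N (t x + (real r - real k)) (x - m) * f m))"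
        by (simp add: sum_distrib_right mult.assoc)
      also have "\<dots> = (\<Sum>r<L. \<Sum>m\<in>S. \<Sum>k<L. fejer_coeff L (t x) r k * (block_kernel N (t x + (real r - real k)) (x - m) * f m))" by (rule sum.swap)
      also have "\<dots> = (\<Sum>r<L. \<Sum>k<L. \<Sum>m\<in>S. fejer_coeff L (t x) r k * (block_kernel N (t x + (real r - real k)) (x - m) * f m))"
        by (intro sum.cong refl sum.swap)
      finally show ?thesis by (simp add: T_def sum_distrib_left)
    qed
    also have "norm ((\<Sum>r<L. \<Sum>k<L. fejer_coeff L (t x) r k * T r k x) + (\<Sum>m\<in>S. (floor_block_kernel N (t x) (x - m) - (\<Sum>r<L. \<Sum>k<L. fejer_coeff L (t x) r k * block_kernel N (t x + (real r - real k)) (x - m))) * f m))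
      \<le> (\<Sum>r<L. \<Sum>k<L. 1 / real L * norm (T r k x)) + (\<Sum>m\<in>S. Er (x - m) * norm (f m))"
    proof (rule order_trans[OF norm_triangle_ineq], rule add_mono)
      show "norm (\<Sum>r<L. \<Sum>k<L. fejer_coeff L (t x) r k * T r k x) \<le> (\<Sum>r<L. \<Sum>k<L. 1 / real L * norm (T r k x))"
        unfolding norm_mult by (intro sum_norm_le) (simp only: norm_mult, intro mult_right_mono fejer_coeff_le L1 norm_ge_zero)
      show "norm (\<Sum>m\<in>S. (floor_block_kernel N (t x) (x - m) - (\<Sum>r<L. \<Sum>k<L. fejer_coeff L (t x) r k * block_kernel N (t x + (real r - real k)) (x - m))) * f m) \<le> (\<Sum>m\<in>S. Er (x - m) * norm (f m))"
        by (intro sum_norm_le) (simp only: norm_mult, intro mult_right_mono ptw t2 norm_ge_zero)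
    qed
    finally show "norm (\<Sum>m\<in>S. floor_block_kernel N (t x) (x - m) * f m) \<le> (\<Sum>r<L. \<Sum>k<L. 1 / real L * norm (T r k x)) + (\<Sum>m\<in>S. Er (x - m) * norm (f m))" .
  qed simp
  also have "\<dots> \<le> L2_set (\<lambda>x. \<Sum>r<L. \<Sum>k<L. 1 / real L * norm (T r k x)) X + L2_set (\<lambda>x. \<Sum>m\<in>S. Er (x - m) * norm (f m)) X"
    by (rule L2_set_triangle_ineq)
  also have "L2_set (\<lambda>x. \<Sum>m\<in>S. Er (x - m) * norm (f m)) X \<le> (\<Sum>n\<in>blk. Er n) * ?F"
  proof (rule convolution_bound[OF X S])
    show "finite blk" by (simp add: blk_def)
    show "Er n = 0" if "n \<notin> blk" for n using that by (simp add: Er_def)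
  qed (auto simp: Er0)
  also have "\<dots> \<le> 1057 * ec / G * ?F" by (intro mult_right_mono Ersum) simp
  also have "L2_set (\<lambda>x. \<Sum>r<L. \<Sum>k<L. 1 / real L * norm (T r k x)) X \<le> (\<Sum>r<L. \<Sum>k<L. L2_set (\<lambda>x. 1 / real L * norm (T r k x)) X)"
    by (rule order_trans[OF L2_set_sum_le]) (auto intro!: sum_mono L2_set_sum_le)
  also have "\<dots> \<le> (\<Sum>r<L. \<Sum>k<L. 1 / real L * (298 * sqrt (ec * gc) * ?n powr (- (2 - c) / 16) * ?F))"
  proof (intro sum_mono)
    fix r k assume "r \<in> {..<L}" "k \<in> {..<L}"
    then have "1 / real L * L2_set (\<lambda>x. norm (T r k x)) X \<le> 1 / real L * (298 * sqrt (ec * gc) * ?n powr (- (2 - c) / 16) * ?F)"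
      by (intro mult_left_mono bkb) auto
    then show "L2_set (\<lambda>x. 1 / real L * norm (T r k x)) X \<le> 1 / real L * (298 * sqrt (ec * gc) * ?n powr (- (2 - c) / 16) * ?F)"
      by (subst (asm) L2_set_right_distrib) auto
  qed
  also have "\<dots> = real L * (298 * sqrt (ec * gc) * ?n powr (- (2 - c) / 16) * ?F)" using L1 by simp
  also have "\<dots> \<le> 2384 * (ec * gc) / G * ?F"
  proof -
    have "real L * (298 * sqrt (ec * gc) * ?n powr (- (2 - c) / 16)) \<le> 8 * G ^ 3 * (298 * (ec * gc) * ?n powr (- (2 - c) / 16))"
    proof (intro mult_mono L_le mult_right_mono mult_left_mono)
      have "sqrt (ec * gc) \<le> sqrt ((ec * gc)\<^sup>2)" using eg1 mult_left_mono[of 1 "ec * gc" "ec * gc"]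
        by (intro real_sqrt_le_mono) (simp add: power2_eq_square)
      then show "sqrt (ec * gc) \<le> ec * gc" using eg1 by simp
    qed (use eg1 G1 in auto)
    also have "\<dots> = 2384 * (ec * gc) * (G ^ 3 * ?n powr (- (2 - c) / 16))" by simp
    also have "G ^ 3 * ?n powr (- (2 - c) / 16) \<le> 1 / G"
    proof -
      have "G ^ 3 * ?n powr (- (2 - c) / 16) = ?n powr (3 * (2 - c) / 100 + - (2 - c) / 16)" unfolding G3 by (simp only: powr_add)
      \<comment> \<open>The exponents fit because 3/100 - 1/16 \<le> - 1/100.\<close>
      also have "\<dots> \<le> ?n powr (- ((2 - c) / 100))" using n c2 by (intro powr_mono) (auto simp: field_simps)
      finally show ?thesis by (simp add: G_def powr_minus_divide)
    qed
    then have "2384 * (ec * gc) * (G ^ 3 * ?n powr (- (2 - c) / 16)) \<le> 2384 * (ec * gc) * (1 / G)" using eg1 by (intro mult_left_mono) auto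
    finally have "real L * (298 * sqrt (ec * gc) * ?n powr (- (2 - c) / 16)) \<le> 2384 * (ec * gc) / G" by simp
    then have "real L * (298 * sqrt (ec * gc) * ?n powr (- (2 - c) / 16)) * ?F \<le> 2384 * (ec * gc) / G * ?F" by (intro mult_right_mono) auto
    then show ?thesis by (simp add: mult.assoc)
  qed
  also have "2384 * (ec * gc) / G * ?F + 1057 * ec / G * ?F \<le> 3441 * (ec * gc) / G * ?F"
  proof -
    have "ec \<le> ec * gc" using ec1 gc1 mult_left_mono[of 1 gc ec] by simp
    then have "1057 * ec / G * ?F \<le> 1057 * (ec * gc) / G * ?F" using G1 by (intro mult_right_mono divide_right_mono) auto
    moreover have "3441 * (ec * gc) / G * ?F = 2384 * (ec * gc) / G * ?F + 1057 * (ec * gc) / G * ?F"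
      by (simp add: add_divide_distrib[symmetric] distrib_right[symmetric])
    ultimately show ?thesis by linarith
  qed
  also have "3441 * (ec * gc) / G * ?F = 3441 * (ec * gc) * ?n powr (- (2 - c) / 100) * ?F"
  proof -
    have "- (2 - c) / 100 = - ((2 - c) / 100)" by (rule minus_divide_left[symmetric])
    then have "?n powr (- (2 - c) / 100) = 1 / G" unfolding G_def by (simp only: powr_minus_divide)
    then show ?thesis by simp
  qed
  finally show ?thesis by simp
qed

end

section \<open>Summation over scales\<close>

lemma L2_set_If:
  assumes "finite X"
  shows "L2_set (\<lambda>x. if P x then u x else 0) X = L2_set u {x\<in>X. P x}"
proof -
  have "(\<Sum>x\<in>X. (if P x then u x else 0)\<^sup>2) = (\<Sum>x\<in>{x\<in>X. P x}. (u x)\<^sup>2)"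
    using assms by (intro sum.mono_neutral_cong_right) auto
  then show ?thesis by (simp add: L2_set_def)
qed

context exponent
begin

definition one_sided_kernel :: "nat \<Rightarrow> nat \<Rightarrow> real \<Rightarrow> int \<Rightarrow> complex" where
  "one_sided_kernel J W t n = (if 2 ^ J < n \<and> n \<le> 2 ^ W then ee (t * of_int \<lfloor>real_of_int n powr c\<rfloor>) / of_int n else 0)"

lemma one_sided_kernel_dyadic:
  assumes "J \<le> W" shows "one_sided_kernel J W t n = (\<Sum>j\<in>{J..<W}. floor_block_kernel (2 ^ j) t n)"
  using assms
proof (induction W rule: dec_induct)
  case base then show ?case by (auto simp: one_sided_kernel_def)
next
  case (step W)
  have le: "(2::int) ^ J \<le> 2 ^ W" using step by (intro power_increasing) auto
  have "2 ^ J < n" if "2 ^ W < n" using le that by linarith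
  moreover have "n \<le> 2 * 2 ^ W" if "n \<le> 2 ^ W"
  proof -
    have "(0::int) < 2 ^ W" by simp
    then show ?thesis using that by linarith
  qed
  ultimately have "one_sided_kernel J (Suc W) t n = one_sided_kernel J W t n + floor_block_kernel (2 ^ W) t n" by (auto simp: one_sided_kernel_def floor_block_kernel_def)
  moreover have "{J..<Suc W} = insert W {J..<W}" using step by auto
  ultimately show ?case using step by simp
qed

text \<open>The ratio is 2^(-y) with y = (2 - c) / 100, and 1 - 2^(-y) \<ge> y / 4. This is where
  the second factor 1 / (2 - c) arises.\<close>

lemma geometric_decay:
  "(\<Sum>j<W. (2 ^ j) powr (- (2 - c) / 100)) \<le> 400 * gc"
proof -
  define y where "y = (2 - c) / 100"
  have y: "y > 0" "y \<le> 1" using c1 c2 by (auto simp: y_def)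
  define q where "q = 2 powr (- y)"
  have q: "q > 0" "q < 1" using y by (auto simp: q_def powr_less_one)
  have "(2 ^ j) powr (- (2 - c) / 100) = q ^ j" for j
  proof -
    have "((2::real) ^ j) powr (- (2 - c) / 100) = (2 powr real j) powr (- (2 - c) / 100)" by (simp add: powr_realpow)
    also have "\<dots> = 2 powr (real j * (- (2 - c) / 100))" by (rule powr_powr)
    also have "real j * (- (2 - c) / 100) = - y * real j" by (simp add: y_def field_simps)
    also have "2 powr (- y * real j) = q powr real j" by (simp only: q_def powr_powr)
    also have "\<dots> = q ^ j" using q by (simp add: powr_realpow)
    finally show ?thesis .
  qed
  then have "(\<Sum>j<W. (2 ^ j) powr (- (2 - c) / 100)) = (\<Sum>j<W. q ^ j)" by simp
  also have "\<dots> = (1 - q ^ W) / (1 - q)" using q by (simp add: sum_gp_strict)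
  also have "\<dots> \<le> 1 / (1 - q)" using q by (intro divide_right_mono) auto
  also have "\<dots> \<le> 4 / y"
  proof -
    define z where "z = y * ln 2"
    have z: "z \<ge> y / 2" "z \<le> 1" "z > 0"
    proof -
      have "ln 2 \<ge> (1/2::real)" using ln2_ge_two_thirds by linarith
      then show "z \<ge> y / 2" using y mult_left_mono[of "1/2" "ln 2" y] by (simp add: z_def)
      then show "z > 0" using y by linarith
      have "ln 2 \<le> (1::real)" using ln_le_minus_one[of 2] by simp
      then show "z \<le> 1" using y mult_mono[of y 1 "ln 2" 1] by (simp add: z_def)
    qed
    have "q = exp (- z)" by (simp add: q_def z_def powr_def)
    also have "\<dots> = 1 / exp z" by (simp add: exp_minus inverse_eq_divide)
    also have "\<dots> \<le> 1 / (1 + z)" using z exp_ge_add_one_self[of z] by (intro frac_le) auto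
    finally have "1 - q \<ge> 1 - 1 / (1 + z)" by simp
    also have "1 - 1 / (1 + z) = z / (1 + z)" using z by (simp add: field_simps)
    also have "z / (1 + z) \<ge> z / 2" using z by (intro divide_left_mono) auto
    finally have "1 - q \<ge> y / 4" using z by linarith
    then have "1 / (1 - q) \<le> 1 / (y / 4)" using y by (intro frac_le) auto
    then show ?thesis by simp
  qed
  also have "\<dots> = 400 * gc" by (simp add: y_def gc_def)
  finally show ?thesis .
qed

text \<open>Three series with different sources of decay. Large modulations decay in the scale j.
  Removing the floor costs |t|, which for the other modulations is a negative power of 2^j. The
  smooth blocks that remain are indexed by i = j - J x, so that |t| N^c is of order 2^(i c) at every
  x and \<open>block_mid\<close> applies for each fixed i. Each series costs 400 \<open>gc\<close>,
  and 400 * (3441 + 8 + 590) = 1615600.\<close>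

lemma one_sided:
  fixes t :: "int \<Rightarrow> real" and J :: "int \<Rightarrow> nat"
  assumes X: "finite X" and S: "finite S"
    and t: "\<And>x. x \<in> X \<Longrightarrow> \<bar>t x\<bar> \<le> 1 / 2"
    and J: "\<And>x. x \<in> X \<Longrightarrow> 1 \<le> J x \<and> J x \<le> W"
    and J1: "\<And>x. x \<in> X \<Longrightarrow> J x < W \<Longrightarrow> 1 \<le> \<bar>t x\<bar> * (2 ^ J x) powr c"
    and J2: "\<And>x. x \<in> X \<Longrightarrow> \<bar>t x\<bar> * (2 ^ (J x - 1)) powr c < 1"
    and sub: "\<And>x n. x \<in> X \<Longrightarrow> 0 < n \<Longrightarrow> n \<le> 2 ^ W \<Longrightarrow> x - n \<in> S"
  shows "L2_set (\<lambda>x. norm (\<Sum>m\<in>S. one_sided_kernel (J x) W (t x) (x - m) * f m)) X \<le> 1615600 * (ec * gc\<^sup>2) * L2_set (\<lambda>m. norm (f m)) S"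
proof -
  let ?F = "L2_set (\<lambda>m. norm (f m)) S"
  define d where "d j = (2 ^ j) powr (- (2 - c) / 100)" for j :: nat
  define A where "A j x = (\<Sum>m\<in>S. floor_block_kernel (2 ^ j) (t x) (x - m) * f m)" for j x
  define B where "B j x = (\<Sum>m\<in>S. block_kernel (2 ^ j) (t x) (x - m) * f m)" for j x
  define hi where "hi j x \<longleftrightarrow> (2 ^ j) powr (- (2 - c) / 8) \<le> \<bar>t x\<bar>" for j :: nat and x
  have d0: "d j \<ge> 0" for j by (simp add: d_def)
  have pw: "(2::int) ^ j * 2 \<le> 2 ^ W" if "j < W" for j
    using power_increasing[of "Suc j" W "2::int"] that by simp
  have subj: "x - n \<in> S" if "x \<in> X" "j < W" "int (2 ^ j) < n" "n \<le> 2 * int (2 ^ j)" for x n j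
  proof -
    have "(0::int) < 2 ^ j" by simp
    then show ?thesis using that pw[OF that(2)] by (intro sub[OF that(1)]) auto
  qed
  have split: "(\<Sum>m\<in>S. one_sided_kernel (J x) W (t x) (x - m) * f m)
      = (\<Sum>j<W. if J x \<le> j \<and> hi j x then A j x else 0)
      + (\<Sum>j<W. if J x \<le> j \<and> \<not> hi j x then A j x - B j x else 0)
      + (\<Sum>i<W. if J x + i < W \<and> \<not> hi (J x + i) x then B (J x + i) x else 0)" if x: "x \<in> X" for x
  proof -
    have "(\<Sum>m\<in>S. one_sided_kernel (J x) W (t x) (x - m) * f m) = (\<Sum>m\<in>S. \<Sum>j\<in>{J x..<W}. floor_block_kernel (2 ^ j) (t x) (x - m) * f m)"
      using J[OF x] by (simp add: one_sided_kernel_dyadic sum_distrib_right)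
    also have "\<dots> = (\<Sum>j\<in>{J x..<W}. A j x)" unfolding A_def by (rule sum.swap)
    also have "\<dots> = (\<Sum>j<W. if J x \<le> j then A j x else 0)"
      by (intro sum.mono_neutral_cong_left) auto
    also have "\<dots> = (\<Sum>j<W. (if J x \<le> j \<and> hi j x then A j x else 0) + (if J x \<le> j \<and> \<not> hi j x then A j x - B j x else 0)
        + (if J x \<le> j \<and> \<not> hi j x then B j x else 0))"
      by (intro sum.cong refl) auto
    also have "\<dots> = (\<Sum>j<W. if J x \<le> j \<and> hi j x then A j x else 0)
      + (\<Sum>j<W. if J x \<le> j \<and> \<not> hi j x then A j x - B j x else 0)
      + (\<Sum>j<W. if J x \<le> j \<and> \<not> hi j x then B j x else 0)" by (simp add: sum.distrib)
    also have "(\<Sum>j<W. if J x \<le> j \<and> \<not> hi j x then B j x else 0) = (\<Sum>j\<in>{J x..<W}. if \<not> hi j x then B j x else 0)"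
      by (intro sum.mono_neutral_cong_right) auto
    also have "\<dots> = (\<Sum>i\<in>{i. J x + i < W}. if \<not> hi (J x + i) x then B (J x + i) x else 0)"
      by (rule sum.reindex_bij_witness[of _ "\<lambda>i. J x + i" "\<lambda>j. j - J x"]) auto
    also have "\<dots> = (\<Sum>i<W. if J x + i < W \<and> \<not> hi (J x + i) x then B (J x + i) x else 0)"
      by (intro sum.mono_neutral_cong_left) auto
    finally show ?thesis .
  qed
  have high: "L2_set (\<lambda>x. norm (if J x \<le> j \<and> hi j x then A j x else 0)) X \<le> 3441 * (ec * gc) * d j * ?F" if j: "j < W" for j
  proof -
    have "L2_set (\<lambda>x. norm (if J x \<le> j \<and> hi j x then A j x else 0)) X = L2_set (\<lambda>x. if J x \<le> j \<and> hi j x then norm (A j x) else 0) X"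
      by (intro arg_cong2[of _ _ _ _ L2_set]) auto
    also have "\<dots> = L2_set (\<lambda>x. norm (A j x)) {x\<in>X. J x \<le> j \<and> hi j x}" by (rule L2_set_If[OF X])
    also have "\<dots> \<le> 3441 * (ec * gc) * real (2 ^ j) powr (- (2 - c) / 100) * ?F"
      unfolding A_def
    proof (rule floor_high)
      show "finite {x\<in>X. J x \<le> j \<and> hi j x}" using X by simp
      show "real (2 ^ j) powr (- (2 - c) / 8) \<le> \<bar>t x\<bar> \<and> \<bar>t x\<bar> \<le> 1 / 2" if "x \<in> {x\<in>X. J x \<le> j \<and> hi j x}" for x
        using that t[of x] by (simp add: hi_def)
    qed (use S subj j in auto)
    finally show ?thesis by (simp add: d_def)
  qed
  have mid: "L2_set (\<lambda>x. norm (if J x \<le> j \<and> \<not> hi j x then A j x - B j x else 0)) X \<le> 8 * (ec * gc) * d j * ?F" if j: "j < W" for j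
  proof -
    \<comment> \<open>A majorant independent of x: the floor changes the phase by at most |t|, which
      is below 2^(- j (2 - c) / 8) when \<open>hi\<close> fails, and 8 bounds 2 pi.\<close>
    define k where "k n = (if n \<in> {2 ^ j + 1..2 * 2 ^ j} then 8 * (2 ^ j) powr (- (2 - c) / 8) / 2 ^ j else 0)" for n :: int
    have k0: "k n \<ge> 0" for n by (simp add: k_def)
    have "L2_set (\<lambda>x. norm (if J x \<le> j \<and> \<not> hi j x then A j x - B j x else 0)) X \<le> L2_set (\<lambda>x. \<Sum>m\<in>S. k (x - m) * norm (f m)) X"
    proof (rule L2_set_mono)
      fix x
      show "norm (if J x \<le> j \<and> \<not> hi j x then A j x - B j x else 0) \<le> (\<Sum>m\<in>S. k (x - m) * norm (f m))"
      proof (cases "J x \<le> j \<and> \<not> hi j x")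
        case False
        show ?thesis unfolding if_not_P[OF False] using k0 by (simp add: sum_nonneg)
      next
        case True
        have "A j x - B j x = (\<Sum>m\<in>S. (floor_block_kernel (2 ^ j) (t x) (x - m) - block_kernel (2 ^ j) (t x) (x - m)) * f m)"
          by (simp add: A_def B_def left_diff_distrib sum_subtractf)
        also have "norm \<dots> \<le> (\<Sum>m\<in>S. k (x - m) * norm (f m))"
        proof (rule sum_norm_le)
          fix m
          have "norm (floor_block_kernel (2 ^ j) (t x) n - block_kernel (2 ^ j) (t x) n) \<le> k n" for n
          proof (cases "n \<in> {2 ^ j + 1..2 * 2 ^ j}")
            case False
            then show ?thesis using k0 by (auto simp: floor_block_kernel_def block_kernel_def)
          next
            case n: True
            define u where "u = real_of_int n powr c"
            have nr: "(2::real) ^ j \<le> real_of_int n"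
            proof -
              have "real_of_int (2 ^ j) \<le> real_of_int n" using n by (intro of_int_le_iff[THEN iffD2]) auto
              then show ?thesis by simp
            qed
            have "floor_block_kernel (2 ^ j) (t x) n - block_kernel (2 ^ j) (t x) n = (ee (t x * of_int \<lfloor>u\<rfloor>) - ee (t x * u)) / of_int n"
              using n by (simp add: floor_block_kernel_def block_kernel_def u_def diff_divide_distrib)
            then have "norm (floor_block_kernel (2 ^ j) (t x) n - block_kernel (2 ^ j) (t x) n) = norm (ee (t x * of_int \<lfloor>u\<rfloor>) - ee (t x * u)) / \<bar>real_of_int n\<bar>"
              by (simp add: norm_divide)
            also have "\<dots> \<le> 8 * (2 ^ j) powr (- (2 - c) / 8) / 2 ^ j"
            proof (rule frac_le)
              have "norm (ee (t x * of_int \<lfloor>u\<rfloor>) - ee (t x * u)) \<le> 2 * pi * \<bar>t x * of_int \<lfloor>u\<rfloor> - t x * u\<bar>" by (rule ee_lipschitz)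
              also have "\<bar>t x * of_int \<lfloor>u\<rfloor> - t x * u\<bar> = \<bar>t x\<bar> * \<bar>of_int \<lfloor>u\<rfloor> - u\<bar>" by (simp only: abs_mult flip: right_diff_distrib)
              also have "\<dots> \<le> (2 ^ j) powr (- (2 - c) / 8) * 1"
              proof (intro mult_mono)
                show "\<bar>t x\<bar> \<le> (2 ^ j) powr (- (2 - c) / 8)" using True by (simp add: hi_def)
                show "\<bar>of_int \<lfloor>u\<rfloor> - u\<bar> \<le> 1" by linarith
              qed auto
              also have "2 * pi * ((2 ^ j) powr (- (2 - c) / 8) * 1) \<le> 8 * (2 ^ j) powr (- (2 - c) / 8)"
                using pi_less_4 by (simp add: mult_right_mono)
              finally show "norm (ee (t x * of_int \<lfloor>u\<rfloor>) - ee (t x * u)) \<le> 8 * (2 ^ j) powr (- (2 - c) / 8)" by simp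
              show "(2::real) ^ j \<le> \<bar>real_of_int n\<bar>" using nr by linarith
            qed auto
            finally show ?thesis using n by (simp add: k_def)
          qed
          then show "norm ((floor_block_kernel (2 ^ j) (t x) (x - m) - block_kernel (2 ^ j) (t x) (x - m)) * f m) \<le> k (x - m) * norm (f m)"
            unfolding norm_mult by (intro mult_right_mono) auto
        qed
        finally show ?thesis using True by simp
      qed
    qed simp
    also have "\<dots> \<le> (\<Sum>n\<in>{2 ^ j + 1..2 * 2 ^ j}. k n) * ?F"
      by (rule convolution_bound[OF X S]) (use k0 in \<open>auto simp: k_def\<close>)
    also have "(\<Sum>n\<in>{2 ^ j + 1..2 * 2 ^ j}. k n) = 8 * (2 ^ j) powr (- (2 - c) / 8)"
      by (simp add: k_def nat_diff_distrib nat_power_eq)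
    also have "8 * (2 ^ j) powr (- (2 - c) / 8) * ?F \<le> 8 * (ec * gc) * d j * ?F"
    proof (rule mult_right_mono)
      have "((2::real) ^ j) powr (- (2 - c) / 8) \<le> d j" unfolding d_def using c2 by (intro powr_mono) auto
      then have "8 * (2 ^ j) powr (- (2 - c) / 8) \<le> 8 * 1 * d j" using d0[of j] by linarith
      also have "\<dots> \<le> 8 * (ec * gc) * d j" using eg1 d0 by (intro mult_right_mono mult_left_mono) auto
      finally show "8 * (2 ^ j) powr (- (2 - c) / 8) \<le> 8 * (ec * gc) * d j" .
    qed simp
    finally show ?thesis .
  qed
  have low: "L2_set (\<lambda>x. norm (if J x + i < W \<and> \<not> hi (J x + i) x then B (J x + i) x else 0)) X \<le> 590 * (ec * gc) * d i * ?F" for i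
  proof -
    define Q where "Q = (2 ^ i) powr c"
    define X' where "X' = {x\<in>X. J x + i < W \<and> \<not> hi (J x + i) x}"
    have Q1: "Q \<ge> 1" unfolding Q_def using c1 by (intro ge_one_powr_ge_zero) auto
    have "L2_set (\<lambda>x. norm (if J x + i < W \<and> \<not> hi (J x + i) x then B (J x + i) x else 0)) X
      = L2_set (\<lambda>x. if J x + i < W \<and> \<not> hi (J x + i) x then norm (B (J x + i) x) else 0) X"
      by (intro arg_cong2[of _ _ _ _ L2_set]) auto
    also have "\<dots> = L2_set (\<lambda>x. norm (B (J x + i) x)) X'" unfolding X'_def by (rule L2_set_If[OF X])
    also have "\<dots> \<le> 590 * sqrt (ec * gc) * Q powr (- (2 - c) / 16) * ?F"
      unfolding B_def
    proof (rule block_mid[where N = "\<lambda>x. 2 ^ (J x + i)", OF _ S _ _ Q1])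
      show "finite X'" using X by (simp add: X'_def)
      show "4 * 2 ^ (J y + i) \<le> (2::nat) ^ (J x + i) \<or> (2::nat) ^ (J x + i) \<le> 2 * 2 ^ (J y + i)" for x y
      proof (cases "J x + i \<le> Suc (J y + i)")
        case True
        then show ?thesis using power_increasing[OF True, of "2::nat"] by simp
      next
        case False
        then have "Suc (Suc (J y + i)) \<le> J x + i" by simp
        then show ?thesis using power_increasing[of "Suc (Suc (J y + i))" "J x + i" "2::nat"] by simp
      qed
      fix x assume "x \<in> X'"
      then have x: "x \<in> X" "J x + i < W" by (auto simp: X'_def)
      \<comment> \<open>\<open>J1\<close> and \<open>J2\<close> place |t| 2^(c J) between 1 and 4,
        since one doubling of the scale multiplies the power by 2^c \<le> 4; multiplication by Q
        gives the range for the block.\<close>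
      have e: "real (2 ^ (J x + i)) powr c = (2 ^ J x) powr c * Q" by (simp add: Q_def power_add powr_mult)
      have "1 * Q \<le> \<bar>t x\<bar> * (2 ^ J x) powr c * Q" using J1[OF x(1)] x Q1 by (intro mult_right_mono) auto
      moreover have "\<bar>t x\<bar> * (2 ^ J x) powr c * Q \<le> 4 * Q"
      proof (rule mult_right_mono)
        have "(2::real) ^ J x = 2 * 2 ^ (J x - 1)" using J[OF x(1)] by (cases "J x") auto
        then have "((2::real) ^ J x) powr c = 2 powr c * (2 ^ (J x - 1)) powr c" by (simp add: powr_mult)
        also have "\<dots> \<le> 2 powr 2 * (2 ^ (J x - 1)) powr c" using c2 by (intro mult_right_mono powr_mono) auto
        finally have "((2::real) ^ J x) powr c \<le> 4 * (2 ^ (J x - 1)) powr c" by simp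
        then have "\<bar>t x\<bar> * (2 ^ J x) powr c \<le> \<bar>t x\<bar> * (4 * (2 ^ (J x - 1)) powr c)" by (intro mult_left_mono) auto
        then show "\<bar>t x\<bar> * (2 ^ J x) powr c \<le> 4" using J2[OF x(1)] by simp
      qed (use Q1 in simp)
      ultimately show "Q \<le> \<bar>t x\<bar> * real (2 ^ (J x + i)) powr c \<and> \<bar>t x\<bar> * real (2 ^ (J x + i)) powr c \<le> 4 * Q"
        unfolding e by (simp add: mult.assoc)
      show "\<bar>t x\<bar> \<le> 1" using t[OF x(1)] by simp
      show "x - n \<in> S" if "int (2 ^ (J x + i)) < n" "n \<le> 2 * int (2 ^ (J x + i))" for n
        using subj[OF x] that by simp
    qed simp
    also have "\<dots> \<le> 590 * (ec * gc) * d i * ?F"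
    proof (intro mult_right_mono mult_mono)
      have "sqrt (ec * gc) \<le> sqrt ((ec * gc)\<^sup>2)" using eg1 mult_left_mono[of 1 "ec * gc" "ec * gc"]
        by (intro real_sqrt_le_mono) (simp add: power2_eq_square)
      then show "sqrt (ec * gc) \<le> ec * gc" using eg1 by simp
      have "Q powr (- (2 - c) / 16) \<le> (2 ^ i) powr (- (2 - c) / 16)"
      proof (rule powr_mono2')
        show "(2::real) ^ i \<le> Q" unfolding Q_def using c1 powr_mono[of 1 c "2 ^ i :: real"] by simp
      qed (use c2 in auto)
      also have "\<dots> \<le> d i" unfolding d_def using c2 by (intro powr_mono) auto
      finally show "Q powr (- (2 - c) / 16) \<le> d i" .
    qed (use eg1 in auto)
    finally show ?thesis .
  qed
  have sumd: "(\<Sum>j<W. a * (ec * gc) * d j * ?F) \<le> a * 400 * (ec * gc\<^sup>2) * ?F" if "a \<ge> 0" for a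
  proof -
    have "(\<Sum>j<W. a * (ec * gc) * d j * ?F) = a * (ec * gc) * ?F * (\<Sum>j<W. d j)"
      unfolding sum_distrib_left by (intro sum.cong refl) (simp add: mult_ac)
    also have "\<dots> \<le> a * (ec * gc) * ?F * (400 * gc)"
      unfolding d_def using geometric_decay that eg1 by (intro mult_left_mono) auto
    finally show ?thesis by (simp add: power2_eq_square mult_ac)
  qed
  have "L2_set (\<lambda>x. norm (\<Sum>m\<in>S. one_sided_kernel (J x) W (t x) (x - m) * f m)) X
    \<le> L2_set (\<lambda>x. ((\<Sum>j<W. norm (if J x \<le> j \<and> hi j x then A j x else 0))
      + (\<Sum>j<W. norm (if J x \<le> j \<and> \<not> hi j x then A j x - B j x else 0)))
      + (\<Sum>i<W. norm (if J x + i < W \<and> \<not> hi (J x + i) x then B (J x + i) x else 0))) X"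
  proof (rule L2_set_mono)
    fix x assume x: "x \<in> X"
    show "norm (\<Sum>m\<in>S. one_sided_kernel (J x) W (t x) (x - m) * f m) \<le> ((\<Sum>j<W. norm (if J x \<le> j \<and> hi j x then A j x else 0))
      + (\<Sum>j<W. norm (if J x \<le> j \<and> \<not> hi j x then A j x - B j x else 0)))
      + (\<Sum>i<W. norm (if J x + i < W \<and> \<not> hi (J x + i) x then B (J x + i) x else 0))"
      unfolding split[OF x] by (intro order_trans[OF norm_triangle_ineq] add_mono norm_sum)
  qed simp
  also have "\<dots> \<le> (L2_set (\<lambda>x. \<Sum>j<W. norm (if J x \<le> j \<and> hi j x then A j x else 0)) X
      + L2_set (\<lambda>x. \<Sum>j<W. norm (if J x \<le> j \<and> \<not> hi j x then A j x - B j x else 0)) X)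
      + L2_set (\<lambda>x. \<Sum>i<W. norm (if J x + i < W \<and> \<not> hi (J x + i) x then B (J x + i) x else 0)) X"
    by (intro order_trans[OF L2_set_triangle_ineq] add_mono order_refl L2_set_triangle_ineq)
  also have "\<dots> \<le> ((\<Sum>j<W. 3441 * (ec * gc) * d j * ?F) + (\<Sum>j<W. 8 * (ec * gc) * d j * ?F)) + (\<Sum>j<W. 590 * (ec * gc) * d j * ?F)"
    by (intro add_mono order_trans[OF L2_set_sum_le] sum_mono high mid low) auto
  also have "\<dots> \<le> (3441 * 400 * (ec * gc\<^sup>2) * ?F + 8 * 400 * (ec * gc\<^sup>2) * ?F) + 590 * 400 * (ec * gc\<^sup>2) * ?F"
    by (intro add_mono sumd) auto
  also have "\<dots> = 1615600 * (ec * gc\<^sup>2) * ?F" by simp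
  finally show ?thesis .
qed

end

section \<open>The modulated Carleson operators\<close>

context exponent
begin

text \<open>The parameter \<open>s\<close> is the sign of the phase at negative integers: \<open>s = 1\<close> gives the operator
  \<open>carleson\<close> and \<open>s = -1\<close> gives \<open>carleson_sgn\<close>.\<close>

definition carleson_kernel :: "real \<Rightarrow> real \<Rightarrow> int \<Rightarrow> complex" where
  "carleson_kernel s t n = ee (t * (if n > 0 then 1 else s) * of_int \<lfloor>real_of_int \<bar>n\<bar> powr c\<rfloor>) / of_int n"

text \<open>Put R = 2^J. For |n| \<le> R / 2 the phase is at most (2 |n| / R)^c, and c > 1 lowers
  this to 2 |n| / R, which cancels the denominator n. Between R / 2 and R the trivial bound 2 / |n|
  is already of order 1 / R, and so is the term n / R^2 of the truncation.\<close>

lemma low_error: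
  assumes s: "\<bar>s\<bar> = 1" and J: "1 \<le> J" and t: "\<bar>t\<bar> * (2 ^ (J - 1)) powr c < 1" and n: "\<bar>n\<bar> \<le> 2 ^ J"
  shows "norm (carleson_kernel s t n - of_real (hilbert_kernel (2 ^ J) n)) \<le> 51 * avg_kernel (2 ^ J) n"
proof (cases "n = 0")
  case True
  then show ?thesis by (simp add: carleson_kernel_def hilbert_kernel_def avg_kernel_nonneg)
next
  case False
  define R :: real where "R = 2 ^ J"
  have R: "R \<ge> 2" "R = 2 * 2 ^ (J - 1)" using J by (cases J; simp add: R_def)+
  define a where "a = \<bar>real_of_int n\<bar>"
  have a: "a \<ge> 1" using False by (simp add: a_def)
  have aR: "a \<le> R"
  proof -
    have "real_of_int \<bar>n\<bar> \<le> real_of_int (2 ^ J)" using n by (simp only: of_int_le_iff)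
    then show ?thesis by (simp add: a_def R_def)
  qed
  define \<theta> where "\<theta> = t * (if n > 0 then 1 else s) * of_int \<lfloor>real_of_int \<bar>n\<bar> powr c\<rfloor>"
  have th: "\<bar>\<theta>\<bar> \<le> \<bar>t\<bar> * a powr c"
  proof -
    have "\<bar>\<theta>\<bar> = \<bar>t\<bar> * \<bar>of_int \<lfloor>real_of_int \<bar>n\<bar> powr c\<rfloor>\<bar>" using s by (simp add: \<theta>_def abs_mult)
    also have "\<bar>real_of_int \<lfloor>real_of_int \<bar>n\<bar> powr c\<rfloor>\<bar> = real_of_int \<lfloor>real_of_int \<bar>n\<bar> powr c\<rfloor>" by simp
    also have "\<dots> \<le> a powr c" by (simp add: a_def)
    finally show ?thesis by (simp add: mult_left_mono)
  qed
  have phase: "norm (ee \<theta> - 1) / a \<le> 16 / R"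
  proof (cases "a \<le> R / 2")
    case True
    have "\<bar>t\<bar> * a powr c \<le> 2 * a / R"
    proof -
      have b: "0 < 2 * a / R" "2 * a / R \<le> 1" using a True R by (auto simp: divide_le_eq)
      have "a = (2 * a / R) * 2 ^ (J - 1)" using R by simp
      then have "a powr c = (2 * a / R) powr c * (2 ^ (J - 1)) powr c" using b by (metis powr_mult)
      then have "\<bar>t\<bar> * a powr c = (2 * a / R) powr c * (\<bar>t\<bar> * (2 ^ (J - 1)) powr c)" by simp
      also have "\<dots> \<le> (2 * a / R) powr c * 1" using t by (intro mult_left_mono) auto
      also have "\<dots> \<le> (2 * a / R) powr 1" using b c1 powr_mono'[of 1 c "2 * a / R"] by simp
      finally show ?thesis using b by simp
    qed
    then have "\<bar>\<theta>\<bar> \<le> 2 * a / R" using th by linarith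
    moreover have "norm (ee \<theta> - 1) \<le> 2 * pi * \<bar>\<theta>\<bar>" using ee_lipschitz[of \<theta> 0] by simp
    moreover have "2 * pi * \<bar>\<theta>\<bar> \<le> 8 * \<bar>\<theta>\<bar>" using pi_less_4 by (intro mult_right_mono) auto
    ultimately have "norm (ee \<theta> - 1) \<le> 8 * (2 * a / R)" by linarith
    then show ?thesis using a by (simp add: divide_le_eq)
  next
    case False
    have "norm (ee \<theta> - 1) \<le> 2" using norm_triangle_ineq4[of "ee \<theta>" 1] by simp
    then have "norm (ee \<theta> - 1) / a \<le> 2 / (R / 2)" using False R by (intro frac_le) auto
    also have "\<dots> \<le> 16 / R" using R by (simp add: divide_right_mono)
    finally show ?thesis .
  qed
  have "carleson_kernel s t n - of_real (hilbert_kernel (2 ^ J) n) = (ee \<theta> - 1) / of_int n + of_real (real_of_int n / R\<^sup>2)"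
    using n by (simp add: carleson_kernel_def \<theta>_def hilbert_kernel_def R_def diff_divide_distrib)
  then have "norm (carleson_kernel s t n - of_real (hilbert_kernel (2 ^ J) n)) \<le> norm ((ee \<theta> - 1) / of_int n) + norm (complex_of_real (real_of_int n / R\<^sup>2))"
    using norm_triangle_ineq by simp
  also have "norm ((ee \<theta> - 1) / of_int n) = norm (ee \<theta> - 1) / a" by (simp add: norm_divide a_def)
  also have "norm (complex_of_real (real_of_int n / R\<^sup>2)) = a / R\<^sup>2" by (simp only: norm_of_real) (simp add: a_def)
  also have "a / R\<^sup>2 \<le> R / R\<^sup>2" using aR by (intro divide_right_mono) auto
  also have "R / R\<^sup>2 = 1 / R" using R by (simp add: power2_eq_square)
  finally have "norm (carleson_kernel s t n - of_real (hilbert_kernel (2 ^ J) n)) \<le> 17 / R" using phase by (simp add: add_divide_distrib[symmetric])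
  also have "\<dots> \<le> 51 * avg_kernel (2 ^ J) n"
  proof -
    have "17 / R \<le> 51 * (1 / (2 * R + 1))" using R(1) by (simp add: field_simps)
    then show ?thesis using n by (simp add: avg_kernel_def R_def)
  qed
  finally show ?thesis .
qed

text \<open>The kernel is cut at 2^J into a truncated Hilbert kernel, an error dominated by
  averages, and two tails. On the negative side 1 / n = - 1 / (- n), so that tail enters with a
  minus sign and with modulation s t; it is bounded by reflecting points and function.\<close>

lemma linearised_bound:
  fixes f :: "int \<Rightarrow> complex"
  assumes X: "finite X" and f: "finite {m. f m \<noteq> 0}" and s: "s = 1 \<or> s = - 1"
    and t: "\<And>x. \<bar>t x\<bar> \<le> 1 / 2"
  shows "L2_set (\<lambda>x. norm (\<Sum>m\<in>{m. f m \<noteq> 0}. carleson_kernel s (t x) (x - m) * f m)) X \<le> 4000000 * (ec * gc\<^sup>2) * L2_set (\<lambda>m. norm (f m)) {m. f m \<noteq> 0}"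
proof -
  \<comment> \<open>Any exponent works for which 2^w bounds all points of \<open>X\<close> and of
    the support; then 2^W bounds their differences.\<close>
  define w where "w = nat (\<Sum>x\<in>X \<union> {m. f m \<noteq> 0}. \<bar>x\<bar>)"
  define W where "W = Suc w"
  have small: "\<bar>x\<bar> \<le> 2 ^ w" if "x \<in> X \<union> {m. f m \<noteq> 0}" for x :: int
  proof -
    have "\<bar>x\<bar> \<le> (\<Sum>x\<in>X \<union> {m. f m \<noteq> 0}. \<bar>x\<bar>)" using X f that by (intro member_le_sum) auto
    then have "\<bar>x\<bar> \<le> int w" by (simp add: w_def)
    also have "int w \<le> 2 ^ w" using less_exp[of w] by (metis less_imp_le of_nat_le_iff of_nat_numeral of_nat_power)
    finally show ?thesis .
  qed
  have W2: "(2::int) ^ W = 2 * 2 ^ w" by (simp add: W_def)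
  \<comment> \<open>The window is symmetric, so reflection maps it to itself, and wide enough to
    contain every shift by |n| \<le> 2^W.\<close>
  define S :: "int set" where "S = {- (2 * 2 ^ W)..2 * 2 ^ W}"
  have S: "finite S" by (simp add: S_def)
  have wpos: "(0::int) < 2 ^ w" by simp
  have sub: "x - n \<in> S" if "x \<in> X" "\<bar>n\<bar> \<le> 2 ^ W" for x n
    using small[of x] that wpos unfolding S_def atLeastAtMost_iff W2 by (auto simp: abs_le_iff)
  have fS: "{m. f m \<noteq> 0} \<subseteq> S"
  proof
    fix m assume "m \<in> {m. f m \<noteq> 0}"
    then show "m \<in> S" using small[of m] wpos unfolding S_def atLeastAtMost_iff W2 by (auto simp: abs_le_iff)
  qed
  have supp: "\<bar>x - m\<bar> \<le> 2 ^ W" if "x \<in> X" "f m \<noteq> 0" for x m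
    using small[of x] small[of m] that unfolding W2 by auto
  define F where "F = L2_set (\<lambda>m. norm (f m)) S"
  have F_eq: "F = L2_set (\<lambda>m. norm (f m)) {m. f m \<noteq> 0}"
    unfolding F_def L2_set_def using S fS by (intro arg_cong[of _ _ sqrt] sum.mono_neutral_right) auto
  have F0: "F \<ge> 0" by (simp add: F_def)
  \<comment> \<open>The alternative \<open>W \<le> j\<close> gives a least element even if t x = 0
    and caps \<open>J x\<close> at \<open>W\<close>.\<close>
  define J where "J x = (LEAST j. W \<le> j \<or> 1 \<le> \<bar>t x\<bar> * (2 ^ j) powr c)" for x
  have J_le: "J x \<le> W" for x unfolding J_def by (rule Least_le) simp
  have J_I: "W \<le> J x \<or> 1 \<le> \<bar>t x\<bar> * (2 ^ J x) powr c" for x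
    unfolding J_def by (rule LeastI[of _ W]) simp
  \<comment> \<open>At j = 0 the threshold would read 1 \<le> |t x|, contrary to |t x| \<le> 1/2;
    hence \<open>J x - 1\<close> is a true predecessor.\<close>
  have J_ge: "1 \<le> J x" for x
  proof (rule ccontr)
    assume "\<not> 1 \<le> J x"
    then have "J x = 0" by simp
    then show False using J_I[of x] t[of x] by (simp add: W_def)
  qed
  have J2: "\<bar>t x\<bar> * (2 ^ (J x - 1)) powr c < 1" for x
  proof -
    have "J x - 1 < J x" using J_ge[of x] by simp
    then show ?thesis unfolding J_def using not_less_Least[of "J x - 1" "\<lambda>j. W \<le> j \<or> 1 \<le> \<bar>t x\<bar> * (2 ^ j) powr c"]
      by (simp add: J_def not_le)
  qed
  define er where "er x n = (if \<bar>n\<bar> \<le> 2 ^ J x then carleson_kernel s (t x) n - of_real (hilbert_kernel (2 ^ J x) n) else 0)" for x n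
  have s1: "\<bar>s\<bar> = 1" using s by auto
  have dec: "carleson_kernel s (t x) n = of_real (hilbert_kernel (2 ^ J x) n) + er x n + one_sided_kernel (J x) W (t x) n - one_sided_kernel (J x) W (s * t x) (- n)"
    if n: "\<bar>n\<bar> \<le> 2 ^ W" for x n
  proof -
    have p: "(0::int) < 2 ^ J x" by simp
    consider "\<bar>n\<bar> \<le> 2 ^ J x" | "2 ^ J x < n" | "n < - (2 ^ J x)" by linarith
    then show ?thesis
    proof cases
      case 1
      then show ?thesis by (auto simp: er_def one_sided_kernel_def)
    next
      case 2
      then have "n > 0" "\<not> 2 ^ J x < - n" "\<not> \<bar>n\<bar> \<le> 2 ^ J x" "n \<le> 2 ^ W" using p n by linarith+
      then show ?thesis using 2 by (simp add: er_def one_sided_kernel_def carleson_kernel_def hilbert_kernel_def)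
    next
      case 3
      then have "\<not> n > 0" "\<not> 2 ^ J x < n" "\<not> \<bar>n\<bar> \<le> 2 ^ J x" "- n \<le> 2 ^ W" "2 ^ J x < - n" "\<bar>n\<bar> = - n"
        using p n by linarith+
      then show ?thesis by (simp add: er_def one_sided_kernel_def carleson_kernel_def hilbert_kernel_def mult.commute)
    qed
  qed
  let ?H = "\<lambda>x. \<Sum>m\<in>S. of_real (hilbert_kernel (2 ^ J x) (x - m)) * f m"
  let ?E = "\<lambda>x. \<Sum>m\<in>S. er x (x - m) * f m"
  let ?P = "\<lambda>x. \<Sum>m\<in>S. one_sided_kernel (J x) W (t x) (x - m) * f m"
  let ?N = "\<lambda>x. \<Sum>m\<in>S. one_sided_kernel (J x) W (s * t x) (- (x - m)) * f m"
  have split: "(\<Sum>m\<in>{m. f m \<noteq> 0}. carleson_kernel s (t x) (x - m) * f m) = ?H x + ?E x + ?P x - ?N x" if x: "x \<in> X" for x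
  proof -
    have "(\<Sum>m\<in>{m. f m \<noteq> 0}. carleson_kernel s (t x) (x - m) * f m) = (\<Sum>m\<in>S. carleson_kernel s (t x) (x - m) * f m)"
      using S fS by (intro sum.mono_neutral_left) auto
    also have "\<dots> = (\<Sum>m\<in>S. of_real (hilbert_kernel (2 ^ J x) (x - m)) * f m + er x (x - m) * f m + one_sided_kernel (J x) W (t x) (x - m) * f m
      - one_sided_kernel (J x) W (s * t x) (- (x - m)) * f m)"
    proof (intro sum.cong refl)
      fix m
      show "carleson_kernel s (t x) (x - m) * f m = of_real (hilbert_kernel (2 ^ J x) (x - m)) * f m + er x (x - m) * f m + one_sided_kernel (J x) W (t x) (x - m) * f m
        - one_sided_kernel (J x) W (s * t x) (- (x - m)) * f m"
      proof (cases "f m = 0")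
        case False
        then show ?thesis using dec[OF supp[OF x False]] by (simp only: distrib_right left_diff_distrib)
      qed simp
    qed
    finally show ?thesis by (simp only: sum.distrib sum_subtractf)
  qed
  have J_W: "(2::int) ^ J x \<le> 2 ^ W" for x using J_le[of x] by (intro power_increasing) auto
  have bH: "L2_set (\<lambda>x. norm (?H x)) X \<le> 160 * F"
    unfolding F_def
  proof (rule hilbert_maximal[OF X S])
    show "x - n \<in> S" if "x \<in> X" "\<bar>n\<bar> \<le> int (2 ^ J x)" for x n
    proof -
      have "\<bar>n\<bar> \<le> 2 ^ J x" using that by simp
      then show ?thesis by (rule sub[OF that(1) order_trans[OF _ J_W]])
    qed
  qed simp
  have bE: "L2_set (\<lambda>x. norm (?E x)) X \<le> 204 * F"
  proof -
    have "L2_set (\<lambda>x. norm (?E x)) X \<le> L2_set (\<lambda>x. 51 * (\<Sum>m\<in>S. avg_kernel (2 ^ J x) (x - m) * norm (f m))) X"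
    proof (rule L2_set_mono)
      fix x
      have "norm (er x n) \<le> 51 * avg_kernel (2 ^ J x) n" for n
        using low_error[OF s1 J_ge J2, of n x] avg_kernel_nonneg[of "2 ^ J x" n] by (auto simp: er_def)
      then show "norm (?E x) \<le> 51 * (\<Sum>m\<in>S. avg_kernel (2 ^ J x) (x - m) * norm (f m))"
        unfolding sum_distrib_left mult.assoc[symmetric]
        by (intro sum_norm_le) (simp only: norm_mult, intro mult_right_mono, auto)
    qed simp
    also have "\<dots> = 51 * L2_set (\<lambda>x. \<Sum>m\<in>S. avg_kernel (2 ^ J x) (x - m) * norm (f m)) X"
      by (simp add: L2_set_right_distrib)
    also have "\<dots> \<le> 51 * (4 * F)" unfolding F_def by (intro mult_left_mono maximal_real X S) auto
    finally show ?thesis by simp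
  qed
  have bP: "L2_set (\<lambda>x. norm (?P x)) X \<le> 1615600 * (ec * gc\<^sup>2) * F"
    unfolding F_def
  proof (rule one_sided[OF X S])
    fix x assume x: "x \<in> X"
    show "\<bar>t x\<bar> \<le> 1 / 2" by (rule t)
    show "1 \<le> J x \<and> J x \<le> W" using J_ge J_le by simp
    show "1 \<le> \<bar>t x\<bar> * (2 ^ J x) powr c" if "J x < W" using J_I[of x] that by simp
    show "\<bar>t x\<bar> * (2 ^ (J x - 1)) powr c < 1" by (rule J2)
    show "x - n \<in> S" if "0 < n" "n \<le> 2 ^ W" for n using that by (intro sub x) simp
  qed
  have bN: "L2_set (\<lambda>x. norm (?N x)) X \<le> 1615600 * (ec * gc\<^sup>2) * F"
  proof -
    define f' where "f' m = f (- m)" for m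
    have "L2_set (\<lambda>y. norm (\<Sum>m\<in>S. one_sided_kernel (J (- y)) W (s * t (- y)) (y - m) * f' m)) (uminus ` X) \<le> 1615600 * (ec * gc\<^sup>2) * L2_set (\<lambda>m. norm (f' m)) S"
    proof (rule one_sided[OF _ S])
      show "finite (uminus ` X)" using X by simp
      fix y assume y: "y \<in> uminus ` X"
      show "\<bar>s * t (- y)\<bar> \<le> 1 / 2" using t[of "- y"] s1 by (simp add: abs_mult)
      show "1 \<le> J (- y) \<and> J (- y) \<le> W" using J_ge J_le by simp
      show "1 \<le> \<bar>s * t (- y)\<bar> * (2 ^ J (- y)) powr c" if "J (- y) < W" using J_I[of "- y"] that s1 by (simp add: abs_mult)
      show "\<bar>s * t (- y)\<bar> * (2 ^ (J (- y) - 1)) powr c < 1" using J2[of "- y"] s1 by (simp add: abs_mult)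
      fix n :: int assume n: "0 < n" "n \<le> 2 ^ W"
      obtain x where x: "x \<in> X" "y = - x" using y by auto
      have "x - (- n) \<in> S" using n by (intro sub x) auto
      then show "y - n \<in> S" using x by (simp add: S_def)
    qed
    also have "L2_set (\<lambda>m. norm (f' m)) S = F"
      unfolding F_def L2_set_def
      by (intro arg_cong[of _ _ sqrt] sum.reindex_bij_witness[of _ uminus uminus]) (auto simp: S_def f'_def)
    also have "L2_set (\<lambda>y. norm (\<Sum>m\<in>S. one_sided_kernel (J (- y)) W (s * t (- y)) (y - m) * f' m)) (uminus ` X)
      = L2_set (\<lambda>x. norm (\<Sum>m\<in>S. one_sided_kernel (J x) W (s * t x) (- x - m) * f' m)) X"
      unfolding L2_set_def by (subst sum.reindex) (auto simp: inj_on_def)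
    also have "(\<lambda>x. norm (\<Sum>m\<in>S. one_sided_kernel (J x) W (s * t x) (- x - m) * f' m)) = (\<lambda>x. norm (?N x))"
    proof
      fix x
      have "(\<Sum>m\<in>S. one_sided_kernel (J x) W (s * t x) (- x - m) * f' m) = ?N x"
        by (rule sum.reindex_bij_witness[of _ uminus uminus]) (auto simp: S_def f'_def)
      then show "norm (\<Sum>m\<in>S. one_sided_kernel (J x) W (s * t x) (- x - m) * f' m) = norm (?N x)" by simp
    qed
    finally show ?thesis .
  qed
  have "L2_set (\<lambda>x. norm (\<Sum>m\<in>{m. f m \<noteq> 0}. carleson_kernel s (t x) (x - m) * f m)) X
    \<le> L2_set (\<lambda>x. ((norm (?H x) + norm (?E x)) + norm (?P x)) + norm (?N x)) X"
  proof (rule L2_set_mono)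
    fix x assume x: "x \<in> X"
    have tri: "norm (a + b + d - e) \<le> ((norm a + norm b) + norm d) + norm e" for a b d e :: complex
      by (intro order_trans[OF norm_triangle_ineq4] order_trans[OF norm_triangle_ineq] add_mono order_refl)
    show "norm (\<Sum>m\<in>{m. f m \<noteq> 0}. carleson_kernel s (t x) (x - m) * f m) \<le> ((norm (?H x) + norm (?E x)) + norm (?P x)) + norm (?N x)"
      unfolding split[OF x] by (rule tri)
  qed simp
  also have "\<dots> \<le> ((L2_set (\<lambda>x. norm (?H x)) X + L2_set (\<lambda>x. norm (?E x)) X) + L2_set (\<lambda>x. norm (?P x)) X) + L2_set (\<lambda>x. norm (?N x)) X"
    by (intro order_trans[OF L2_set_triangle_ineq] add_mono order_refl)
  also have "\<dots> \<le> ((160 * F + 204 * F) + 1615600 * (ec * gc\<^sup>2) * F) + 1615600 * (ec * gc\<^sup>2) * F"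
    by (intro add_mono bH bE bP bN)
  also have "\<dots> \<le> 4000000 * (ec * gc\<^sup>2) * F"
  proof -
    have "1 \<le> gc\<^sup>2" using gc1 by (intro one_le_power)
    then have "1 \<le> ec * gc\<^sup>2" using ec1 mult_mono[of 1 ec 1 "gc\<^sup>2"] by simp
    then have "F \<le> ec * gc\<^sup>2 * F" using F0 mult_right_mono[of 1 "ec * gc\<^sup>2" F] by simp
    moreover have "((160 * F + 204 * F) + 1615600 * (ec * gc\<^sup>2) * F) + 1615600 * (ec * gc\<^sup>2) * F = 364 * F + 3231200 * (ec * gc\<^sup>2 * F)"
      "4000000 * (ec * gc\<^sup>2) * F = 4000000 * (ec * gc\<^sup>2 * F)" by (simp_all add: mult.assoc)
    moreover have "0 \<le> ec * gc\<^sup>2 * F" using ec1 F0 by simp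
    ultimately show ?thesis by linarith
  qed
  finally show ?thesis unfolding F_eq .
qed

end

section \<open>From finite sets and chosen modulations to norms of suprema\<close>

lemma ell2_norm_finite_support:
  assumes "finite {m. f m \<noteq> 0}"
  shows "ell2_norm f = L2_set (\<lambda>m. norm (f m)) {m. f m \<noteq> 0}"
proof -
  have "(\<Sum>\<^sub>\<infinity>x. (norm (f x))\<^sup>2) = (\<Sum>\<^sub>\<infinity>x\<in>{m. f m \<noteq> 0}. (norm (f x))\<^sup>2)"
    by (rule infsum_cong_neutral) auto
  then show ?thesis using assms by (simp add: ell2_norm_def L2_set_def)
qed

text \<open>Bounds uniform over finite sets give summability together with the norm bound, so the
  latter does not rest on the default value of a divergent sum.\<close>

lemma ell2_norm_le:
  fixes g :: "'a \<Rightarrow> real"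
  assumes B: "\<And>X. finite X \<Longrightarrow> L2_set g X \<le> B"
  shows "has_ell2_norm g" and "ell2_norm g \<le> B"
proof -
  have B0: "B \<ge> 0" using B[of "{}"] by simp
  have fin: "(\<Sum>x\<in>X. (norm (g x))\<^sup>2) \<le> B\<^sup>2" if "finite X" for X
  proof -
    have "(L2_set g X)\<^sup>2 \<le> B\<^sup>2" using B[OF that] by (intro power_mono) auto
    then show ?thesis by (simp add: L2_set_def sum_nonneg)
  qed
  show "has_ell2_norm g" unfolding has_ell2_norm_def
  proof (rule nonneg_bdd_above_summable_on)
    show "bdd_above (sum (\<lambda>x. (norm (g x))\<^sup>2) ` {F. F \<subseteq> UNIV \<and> finite F})"
      by (rule bdd_aboveI2[of _ _ "B\<^sup>2"]) (use fin in auto)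
  qed simp
  then have "(\<Sum>\<^sub>\<infinity>x. (norm (g x))\<^sup>2) \<le> B\<^sup>2" unfolding has_ell2_norm_def
    by (rule infsum_le_finite_sums) (use fin in auto)
  then show "ell2_norm g \<le> B" unfolding ell2_norm_def using B0 by (simp add: real_le_lsqrt)
qed

text \<open>Choosing at each point an index that reaches half the supremum linearises it without any
  question of attainment, at the price of a factor 2.\<close>

lemma ell2_norm_SUP_le:
  fixes V :: "'i \<Rightarrow> 'a \<Rightarrow> real"
  assumes I: "I \<noteq> {}" and V0: "\<And>i x. 0 \<le> V i x" and bdd: "\<And>x. bdd_above ((\<lambda>i. V i x) ` I)"
    and B: "\<And>X t. finite X \<Longrightarrow> (\<And>x. t x \<in> I) \<Longrightarrow> L2_set (\<lambda>x. V (t x) x) X \<le> B"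
  shows "has_ell2_norm (\<lambda>x. SUP i\<in>I. V i x)" and "ell2_norm (\<lambda>x. SUP i\<in>I. V i x) \<le> 2 * B"
proof -
  define g where "g x = (SUP i\<in>I. V i x)" for x
  have "\<exists>i\<in>I. g x \<le> 2 * V i x" for x
  \<comment> \<open>Half the supremum is strictly smaller only if the supremum is positive;
    otherwise nonnegativity of \<open>V\<close> makes any index suitable.\<close>
  proof (cases "g x \<le> 0")
    case True
    obtain i where i: "i \<in> I" using I by auto
    then show ?thesis using True V0[of i x] by (intro bexI[of _ i]) auto
  next
    case False
    then have "g x / 2 < (SUP i\<in>I. V i x)" by (simp add: g_def)
    then obtain i where "i \<in> I" "g x / 2 < V i x" using less_cSUP_iff[OF I bdd] by blast
    then show ?thesis by (intro bexI[of _ i]) auto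
  qed
  then obtain t where t: "\<And>x. t x \<in> I" "\<And>x. g x \<le> 2 * V (t x) x" by metis
  have g0: "0 \<le> g x" for x
  proof -
    obtain i where i: "i \<in> I" using I by auto
    have "V i x \<le> g x" unfolding g_def using i bdd by (intro cSUP_upper)
    then show ?thesis using V0[of i x] by linarith
  qed
  have L: "L2_set g X \<le> 2 * B" if X: "finite X" for X
  proof -
    have "L2_set g X \<le> L2_set (\<lambda>x. 2 * V (t x) x) X" by (intro L2_set_mono t g0)
    also have "\<dots> = 2 * L2_set (\<lambda>x. V (t x) x) X" by (simp add: L2_set_right_distrib)
    also have "\<dots> \<le> 2 * B" using B[OF X t(1)] by simp
    finally show ?thesis .
  qed
  show "has_ell2_norm (\<lambda>x. SUP i\<in>I. V i x)" "ell2_norm (\<lambda>x. SUP i\<in>I. V i x) \<le> 2 * B"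
    using ell2_norm_le[OF L] unfolding g_def by auto
qed

text \<open>The substitution is m = x - n. The condition \<open>k 0 = 0\<close> lets m = x be
  included; \<open>carleson_kernel\<close> satisfies it because division by 0 gives 0.\<close>

lemma carleson_sum_eq:
  fixes f :: "int \<Rightarrow> complex" and a :: "int \<Rightarrow> int" and k :: "int \<Rightarrow> complex"
  assumes f: "finite {m. f m \<noteq> 0}" and k: "\<And>n. n \<noteq> 0 \<Longrightarrow> k n = ee (t * of_int (a n)) / of_int n" "k 0 = 0"
  shows "(\<Sum>\<^sub>\<infinity>n\<in>{n. n \<noteq> 0}. f (x - n) * (exp (2 * of_real pi * \<i> * of_real t * of_int (a n)) / of_int n))
     = (\<Sum>m\<in>{m. f m \<noteq> 0}. k (x - m) * f m)"
proof -
  have e: "exp (2 * of_real pi * \<i> * of_real t * of_int (a n)) = ee (t * of_int (a n))" for n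
    by (simp add: ee_def cis_conv_exp mult_ac)
  have "(\<Sum>\<^sub>\<infinity>n\<in>{n. n \<noteq> 0}. f (x - n) * (exp (2 * of_real pi * \<i> * of_real t * of_int (a n)) / of_int n))
    = (\<Sum>n | n \<noteq> 0 \<and> f (x - n) \<noteq> 0. f (x - n) * (exp (2 * of_real pi * \<i> * of_real t * of_int (a n)) / of_int n))"
    by (rule carleson_sum_finite(2)[OF f])
  also have "\<dots> = (\<Sum>n | n \<noteq> 0 \<and> f (x - n) \<noteq> 0. k n * f (x - n))"
    by (intro sum.cong refl) (simp add: k e)
  also have "\<dots> = (\<Sum>m\<in>{m. f m \<noteq> 0} - {x}. k (x - m) * f m)"
    by (rule sum.reindex_bij_witness[of _ "\<lambda>m. x - m" "\<lambda>n. x - n"]) auto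
  also have "\<dots> = (\<Sum>m\<in>{m. f m \<noteq> 0}. k (x - m) * f m)"
    using f k(2) by (intro sum.mono_neutral_left) auto
  finally show ?thesis .
qed

theorem mainTheorem3:
  shows "\<exists>C::real. C > 0 \<and>
    (\<forall>c::real. 1 < c \<and> c < 2 \<longrightarrow>
      (\<forall>f :: int \<Rightarrow> complex. finite {x. f x \<noteq> 0} \<longrightarrow>
        (has_ell2_norm (carleson c f) \<and>
         ell2_norm (carleson c f)
           \<le> C * (c - 1) powr (- 1 / 2) * (2 - c) powr (- 13 / 4) * ell2_norm f) \<and>
        (has_ell2_norm (carleson_sgn c f) \<and>
         ell2_norm (carleson_sgn c f)
           \<le> C * (c - 1) powr (- 1 / 2) * (2 - c) powr (- 13 / 4) * ell2_norm f)))"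
proof (intro exI[of _ 8000000] conjI allI impI)
  fix c :: real and f :: "int \<Rightarrow> complex"
  assume c: "1 < c \<and> c < 2" and f: "finite {x. f x \<noteq> 0}"
  interpret exponent c using c by unfold_locales auto
  define I where "I = {-1/2..<1/2::real}"
  have I: "I \<noteq> {}" by (simp add: I_def)
  define B where "B = 4000000 * (ec * gc\<^sup>2) * ell2_norm f"
  have E0: "ell2_norm f \<ge> 0" by (simp add: ell2_norm_finite_support[OF f])
  \<comment> \<open>The bound has the exponent - 2 in 2 - c, and lowering it to - 13/4 enlarges the
    right side as 0 < 2 - c < 1. The constant is twice 4000000 because of the near-maximal choice of
    the modulation.\<close>
  have BC: "2 * B \<le> 8000000 * (c - 1) powr (- 1 / 2) * (2 - c) powr (- 13 / 4) * ell2_norm f"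
  proof -
    have e: "ec = (c - 1) powr (- 1 / 2)"
      using c1 by (simp add: ec_def powr_minus_divide powr_half_sqrt flip: minus_divide_left)
    have "gc\<^sup>2 = (2 - c) powr (- 2)" using c2 by (simp add: gc_def power_divide powr_minus_divide powr_numeral)
    also have "\<dots> \<le> (2 - c) powr (- 13 / 4)" using c1 c2 by (intro powr_mono') auto
    finally have g: "gc\<^sup>2 \<le> (2 - c) powr (- 13 / 4)" .
    have "8000000 * ec * gc\<^sup>2 * ell2_norm f \<le> 8000000 * ec * (2 - c) powr (- 13 / 4) * ell2_norm f"
      using ec1 E0 by (intro mult_right_mono mult_left_mono g) auto
    then show ?thesis by (simp add: B_def e mult.assoc)
  qed
  have lin: "L2_set (\<lambda>x. norm (\<Sum>m\<in>{m. f m \<noteq> 0}. carleson_kernel s (t x) (x - m) * f m)) X \<le> B"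
    if "finite X" "s = 1 \<or> s = - 1" "\<And>x. t x \<in> I" for X s t
  proof -
    have "\<bar>t x\<bar> \<le> 1 / 2" for x using that(3)[of x] by (auto simp: I_def)
    then show ?thesis unfolding B_def ell2_norm_finite_support[OF f] by (intro linearised_bound that f)
  qed
  have e1: "carleson c f = (\<lambda>x. SUP t\<in>I. norm (\<Sum>m\<in>{m. f m \<noteq> 0}. carleson_kernel 1 t (x - m) * f m))"
    unfolding carleson_def I_def
    by (intro ext SUP_cong refl arg_cong[of _ _ norm] carleson_sum_eq[OF f]) (auto simp: carleson_kernel_def)
  have e2: "carleson_sgn c f = (\<lambda>x. SUP t\<in>I. norm (\<Sum>m\<in>{m. f m \<noteq> 0}. carleson_kernel (- 1) t (x - m) * f m))"
    unfolding carleson_sgn_def I_def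
    by (intro ext SUP_cong refl arg_cong[of _ _ norm] carleson_sum_eq[OF f]) (auto simp: carleson_kernel_def)
  have bdd: "bdd_above ((\<lambda>t. norm (\<Sum>m\<in>{m. f m \<noteq> 0}. carleson_kernel s t (x - m) * f m)) ` I)" for s x
  proof (rule bdd_aboveI2)
    fix t
    have "norm (carleson_kernel s t n) \<le> 1 / \<bar>real_of_int n\<bar>" for n by (simp add: carleson_kernel_def norm_divide)
    then show "norm (\<Sum>m\<in>{m. f m \<noteq> 0}. carleson_kernel s t (x - m) * f m) \<le> (\<Sum>m\<in>{m. f m \<noteq> 0}. 1 / \<bar>real_of_int (x - m)\<bar> * norm (f m))"
    proof (intro sum_norm_le)
      fix m
      show "norm (carleson_kernel s t (x - m) * f m) \<le> 1 / \<bar>real_of_int (x - m)\<bar> * norm (f m)"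
        unfolding norm_mult by (rule mult_right_mono[OF \<open>\<And>n. norm (carleson_kernel s t n) \<le> 1 / \<bar>real_of_int n\<bar>\<close>]) simp
    qed
  qed
  show "has_ell2_norm (carleson c f)" "has_ell2_norm (carleson_sgn c f)"
    unfolding e1 e2 by (intro ell2_norm_SUP_le(1)[OF I _ bdd, where B = B] lin; simp)+
  have "ell2_norm (carleson c f) \<le> 2 * B" "ell2_norm (carleson_sgn c f) \<le> 2 * B"
    unfolding e1 e2 by (intro ell2_norm_SUP_le(2)[OF I _ bdd, where B = B] lin; simp)+
  then show "ell2_norm (carleson c f) \<le> 8000000 * (c - 1) powr (- 1 / 2) * (2 - c) powr (- 13 / 4) * ell2_norm f"
    "ell2_norm (carleson_sgn c f) \<le> 8000000 * (c - 1) powr (- 1 / 2) * (2 - c) powr (- 13 / 4) * ell2_norm f"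
    using BC by linarith+
qed simp

end
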